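(* Consider the nonautonomous system $x'=f(x,\Lambda(\tau))/r$ on $\mathbb{R}^n$, $r>0$, with an input $\Lambda(\tau)$ that is exponentially asymptotically constant to $\lambda^+$. Suppose there is a moving sink $e(\Lambda(\tau))$ on $I=(\tau_0,+\infty)$, so that $e(\Lambda(\tau))\to e^+=e(\lambda^+)$ as $\tau\to+\infty$. Fix any $\delta>0$. (a) For any solution $x^{[r]}(\tau,x_0,\tau_0)$ with $x_0$ in the basin of attraction of $e(\Lambda(\tau_0))$ (for the frozen system with $\lambda=\Lambda(\tau_0)$), there is an $r^*(\delta)>0$ and a $\tau^*(r,\delta)\ge\tau_0$ such that $x^{[r]}(\tau,x_0,\tau_0)$ $\delta$-close and end-point tracks the moving sink $e(\Lambda(\tau))$ on $(\tau^*,+\infty)\subseteq I$ for any $r\in(0,r^* )$. (b) Suppose in addition that $\Lambda(\tau)$ is exponentially bi-asymptotically constant and $e(\Lambda(\tau))$ is a moving sink on $I=\mathbb{R}$, so that $e(\Lambda(\tau))\to e^-=e(\lambda^-)$ as $\tau\to-\infty$. Then there is an $r^*(\delta)>0$ such that: - the unique local pullback attractor $x^{[r]}(\tau,e^-)$ (the solution that limits to $e^-$ as $\tau\to-\infty$) exists for any $r\in(0,r^* )$ and all $\tau\in\mathbb{R}$; - $x^{[r]}(\tau,e^-)$ $\delta$-close and end-point tracks the moving sink $e(\Lambda(\tau))$ on $I=\mathbb{R}$ for any $r\in(0,r^* )$.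
   Context: Setting: $f:\mathbb{R}^n\times\mathbb{R}^d\to\mathbb{R}^n$ and $\Lambda:\mathbb{R}\to\mathbb{R}^d$ are $C^1$. For a constant rate parameter $r>0$ the nonautonomous system is $x'=f(x,\Lambda(\tau))/r$, where $'=d/d\tau$; the frozen system is $\dot x=f(x,\lambda)$ with $\lambda\in\mathbb{R}^d$ fixed. $x^{[r]}(\tau,x_0,\tau_0)$ is the solution of the nonautonomous system with value $x_0$ at $\tau=\tau_0$. Inputs: $\Lambda$ is asymptotically constant to $\lambda^+$ if $\Lambda(\tau)\to\lambda^+$ as $\tau\to+\infty$; bi-asymptotically constant if moreover $\Lambda(\tau)\to\lambda^-$ as $\tau\to-\infty$. It is exponentially asymptotically constant to $\lambda^+$ if there is $\rho>0$ such that $\lim_{\tau\to+\infty}\Lambda'(\tau)/e^{-\rho\tau}$ exists; exponentially bi-asymptotically constant if there is $\rho>0$ such that both $\lim_{\tau\to\pm\infty}\Lambda'(\tau)/e^{\mp\rho\tau}$ exist. The future and past limit systems are $\dot x=f(x,\lambda^+)$ and $\dot x=f(x,\lambda^-)$. Moving sink: for an interval $I=(\tau_-,\tau_+)$ ($\tau_\pm$ may be $\pm\infty$) let $P_{\Lambda,I}=\overline{\{\Lambda(\tau):\tau\in I\}}$. If the frozen system has an equilibrium $e(\lambda)$ that is a hyperbolic sink (all eigenvalues of the linearization have negative real part) varying $C^1$-smoothly with $\lambda\in P_{\Lambda,I}$, then $e(\Lambda(\tau))$ is called a moving sink on $I$. Its future limit is $e^+=e(\lambda^+)$ and (when $I$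 is unbounded below and $\lambda^-$ exists) its past limit is $e^-=e(\lambda^-)$. For $e^-$ a hyperbolic sink of the past limit system, $x^{[r]}(\tau,e^-)$ denotes the (unique) solution of the nonautonomous system that converges to $e^-$ as $\tau\to-\infty$; it is a local pullback attractor. Tracking, for a solution $x^{[r]}(\tau)$: it $\delta$-close tracks $e(\Lambda(\tau))$ on an interval $J$ if $\|x^{[r]}(\tau)-e(\Lambda(\tau))\|<\delta$ for all $\tau\in J$. It end-point tracks $e(\Lambda(\tau))$ on $J=(\tau_-,+\infty)$ if it exists for all $\tau\in J$ and $x^{[r]}(\tau)\to e^+$ as $\tau\to+\infty$. *)

theory Defs
  imports "HOL-Analysis.Analysis"
begin

text \<open>
  On a set that need not be open (such as the closure of a curve), being continuously
  differentiable means being the restriction of a \<open>C\<^sup>1\<close> function on an open neighbourhood.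
\<close>

definition C1_on ::
  "('a::real_normed_vector \<Rightarrow> 'b::real_normed_vector) \<Rightarrow> 'a set \<Rightarrow> bool"
  where "C1_on g S \<longleftrightarrow>
    (\<exists>U h h'. open U \<and> S \<subseteq> U \<and> (\<forall>x\<in>S. h x = g x) \<and>
      (\<forall>x\<in>U. (h has_derivative blinfun_apply (h' x)) (at x)) \<and>
      continuous_on U (h' :: 'a \<Rightarrow> 'a \<Rightarrow>\<^sub>L 'b))"

definition complex_eigenvalues :: "real^'n^'n \<Rightarrow> complex set"
  where "complex_eigenvalues A =
    {\<mu>. \<exists>v :: complex^'n. v \<noteq> 0 \<and> map_matrix complex_of_real A *v v = \<mu> *s v}"

text \<open>At an endpoint of \<open>J\<close> that lies in \<open>J\<close> the derivatives below are one-sided.\<close>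

definition solves_frozen ::
  "((real^'n) \<times> (real^'d) \<Rightarrow> real^'n) \<Rightarrow> real^'d \<Rightarrow> real set \<Rightarrow> (real \<Rightarrow> real^'n) \<Rightarrow> bool"
  where "solves_frozen f l J x \<longleftrightarrow>
    (\<forall>t\<in>J. (x has_vector_derivative f (x t, l)) (at t within J))"

definition solves_nonaut ::
  "((real^'n) \<times> (real^'d) \<Rightarrow> real^'n) \<Rightarrow> (real \<Rightarrow> real^'d) \<Rightarrow> real \<Rightarrow>
    real set \<Rightarrow> (real \<Rightarrow> real^'n) \<Rightarrow> bool"
  where "solves_nonaut f \<Lambda> r J x \<longleftrightarrow>
    (\<forall>\<tau>\<in>J. (x has_vector_derivative (f (x \<tau>, \<Lambda> \<tau>) /\<^sub>R r)) (at \<tau> within J))"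

definition hyperbolic_sink ::
  "((real^'n) \<times> (real^'d) \<Rightarrow> real^'n) \<Rightarrow> real^'d \<Rightarrow> real^'n \<Rightarrow> bool"
  where "hyperbolic_sink f l p \<longleftrightarrow>
    f (p, l) = 0 \<and> (\<forall>\<mu> \<in> complex_eigenvalues (jacobian (\<lambda>x. f (x, l)) (at p)). Re \<mu> < 0)"

definition basin ::
  "((real^'n) \<times> (real^'d) \<Rightarrow> real^'n) \<Rightarrow> real^'d \<Rightarrow> real^'n \<Rightarrow> (real^'n) set"
  where "basin f l p =
    {x0. \<exists>x. solves_frozen f l {0..} x \<and> x 0 = x0 \<and> (x \<longlongrightarrow> p) at_top}"

definition exp_asymptotically_constant :: "(real \<Rightarrow> real^'d) \<Rightarrow> real^'d \<Rightarrow> bool"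
  where "exp_asymptotically_constant \<Lambda> lp \<longleftrightarrow>
    (\<Lambda> \<longlongrightarrow> lp) at_top \<and>
    (\<exists>\<rho>>0. \<exists>L. ((\<lambda>\<tau>. vector_derivative \<Lambda> (at \<tau>) /\<^sub>R exp (- \<rho> * \<tau>)) \<longlongrightarrow> L) at_top)"

definition exp_bi_asymptotically_constant ::
  "(real \<Rightarrow> real^'d) \<Rightarrow> real^'d \<Rightarrow> real^'d \<Rightarrow> bool"
  where "exp_bi_asymptotically_constant \<Lambda> lm lp \<longleftrightarrow>
    (\<Lambda> \<longlongrightarrow> lp) at_top \<and> (\<Lambda> \<longlongrightarrow> lm) at_bot \<and>
    (\<exists>\<rho>>0.
      (\<exists>L. ((\<lambda>\<tau>. vector_derivative \<Lambda> (at \<tau>) /\<^sub>R exp (- \<rho> * \<tau>)) \<longlongrightarrow> L) at_top) \<and>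
      (\<exists>L. ((\<lambda>\<tau>. vector_derivative \<Lambda> (at \<tau>) /\<^sub>R exp (\<rho> * \<tau>)) \<longlongrightarrow> L) at_bot))"

text \<open>Only the values of \<open>e\<close> on the closure of \<open>\<Lambda> ` I\<close> are relevant.\<close>

definition moving_sink ::
  "((real^'n) \<times> (real^'d) \<Rightarrow> real^'n) \<Rightarrow> (real \<Rightarrow> real^'d) \<Rightarrow> (real^'d \<Rightarrow> real^'n) \<Rightarrow>
    real set \<Rightarrow> bool"
  where "moving_sink f \<Lambda> e I \<longleftrightarrow>
    (\<forall>l \<in> closure (\<Lambda> ` I). hyperbolic_sink f l (e l)) \<and> C1_on e (closure (\<Lambda> ` I))"

text \<open>
  A whole neighbourhood of \<open>x s\<close>, of radius independent of \<open>s\<close>, when started at time \<open>s\<close> is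
  carried by time \<open>t\<close> arbitrarily close to \<open>x t\<close>, as \<open>s\<close> tends to minus infinity with \<open>t\<close> fixed.
\<close>

definition local_pullback_attractor ::
  "((real^'n) \<times> (real^'d) \<Rightarrow> real^'n) \<Rightarrow> (real \<Rightarrow> real^'d) \<Rightarrow> real \<Rightarrow> (real \<Rightarrow> real^'n) \<Rightarrow> bool"
  where "local_pullback_attractor f \<Lambda> r x \<longleftrightarrow>
    solves_nonaut f \<Lambda> r UNIV x \<and>
    (\<exists>\<eta>>0. \<forall>t. \<forall>\<epsilon>>0. \<forall>\<^sub>F s in at_bot. \<forall>y \<in> ball (x s) \<eta>.
      \<exists>z. solves_nonaut f \<Lambda> r {s..t} z \<and> z s = y \<and> dist (z t) (x t) < \<epsilon>)"

definition close_tracks ::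
  "real \<Rightarrow> (real^'d \<Rightarrow> real^'n) \<Rightarrow> (real \<Rightarrow> real^'d) \<Rightarrow> real set \<Rightarrow> (real \<Rightarrow> real^'n) \<Rightarrow> bool"
  where "close_tracks \<delta> e \<Lambda> J x \<longleftrightarrow> (\<forall>\<tau>\<in>J. norm (x \<tau> - e (\<Lambda> \<tau>)) < \<delta>)"

text \<open>
  Meant for intervals \<open>J\<close> that are unbounded above; \<open>lp\<close> is the limit of the input at plus
  infinity.
\<close>

definition end_point_tracks ::
  "((real^'n) \<times> (real^'d) \<Rightarrow> real^'n) \<Rightarrow> (real \<Rightarrow> real^'d) \<Rightarrow> real \<Rightarrow>
    (real^'d \<Rightarrow> real^'n) \<Rightarrow> real^'d \<Rightarrow> real set \<Rightarrow> (real \<Rightarrow> real^'n) \<Rightarrow> bool"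
  where "end_point_tracks f \<Lambda> r e lp J x \<longleftrightarrow>
    solves_nonaut f \<Lambda> r J x \<and> (x \<longlongrightarrow> e lp) at_top"

end

theory Submission
  imports Defs "HOL-Computational_Algebra.Fundamental_Theorem_Algebra"
begin

text \<open>
  Each matrix \<open>D\<^sub>x f (e \<lambda>, \<lambda>)\<close> is Hurwitz and hence has a quadratic Lyapunov form. Such forms are a
  convex cone and persist under perturbation, so a partition by bump functions over the compact
  closure of the input path yields a \<open>C\<^sup>1\<close> family of forms \<open>Q \<lambda>\<close>. In the time scale \<open>\<tau>\<close> the quantity
  \<open>V = Q (\<Lambda> \<tau>) (x - e (\<Lambda> \<tau>)) (x - e (\<Lambda> \<tau>))\<close> satisfies \<open>V' \<le> - V / (r b) + O (r |\<Lambda>'|\<^sup>2)\<close> near the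
  moving sink: for small \<open>r\<close> a thin tube around the sink is forward invariant, \<open>V\<close> tends to zero
  where \<open>\<Lambda>'\<close> does, and solutions in the tube contract towards each other. For (a), the
  solution follows the frozen one for time \<open>r T\<close>, which carries it into the tube. For (b), the
  pullback attractor is the limit of the solutions that start on the sink at time \<open>-n\<close>.
\<close>

section \<open>Lyapunov forms of Hurwitz matrices\<close>

text \<open>The obstacle is uniformity: one threshold for \<open>r\<close> must serve an unbounded
  range of times, although each linearization is stable only in a norm of its own. Compactness of
  the closed input path gives constants valid for all times. The change of the norm along the path
  costs a term of size |\<Lambda>'| |v|^2, which the decay |v|^2 / r absorbs for small
  \<open>r\<close>. The drift of the sink is charged partly to the decay, partly to a residual of
  size r |\<Lambda>'|^2. That this residual is bounded gives closeness; that it vanishes at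
  infinity, by the exponential rate, gives end-point tracking. A second obstacle is that f is merely
  C^1, so its solutions may blow up. Existence is first obtained for f composed with the projection
  onto a large ball, where solutions are global; bounds found afterwards show that they never feel
  the projection.\<close>

definition shift :: "complex^'n^'n \<Rightarrow> complex \<Rightarrow> complex^'n \<Rightarrow> complex^'n"
  where "shift M \<mu> v = M *v v - \<mu> *s v"

text \<open>This is p(M) v. Recording only the action on vectors lets a linear factor of p turn
  directly into one application of \<open>shift\<close>.\<close>

definition poly_op :: "complex^'n^'n \<Rightarrow> complex poly \<Rightarrow> complex^'n \<Rightarrow> complex^'n"
  where "poly_op M p v = (\<Sum>i\<le>degree p. coeff p i *s (((*v) M) ^^ i) v)"

lemma scaleR_vec_complex: "c *\<^sub>R (v::complex^'n) = complex_of_real c *s v"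
  by (simp add: vec_eq_iff scaleR_conv_of_real[where 'a=complex])

lemma matrix_vector_mult_scalar: "(M::complex^'n^'n) *v (c *s v) = c *s (M *v v)"
  by (simp add: vec_eq_iff matrix_vector_mult_def sum_distrib_left mult_ac)

lemma shift_scalar: "shift M \<mu> (c *s v) = c *s shift M \<mu> v"
  by (simp add: shift_def matrix_vector_mult_scalar vec_eq_iff algebra_simps)

lemma shift_mult: "shift M \<mu> (M *v v) = M *v shift M \<mu> v"
  by (simp add: shift_def matrix_vector_mult_diff_distrib matrix_vector_mult_scalar)

lemma shift_commute: "shift M \<mu> (shift M \<nu> v) = shift M \<nu> (shift M \<mu> v)"
  by (simp add: shift_def matrix_vector_mult_diff_distrib matrix_vector_mult_scalar
      vec_eq_iff algebra_simps)

lemma linear_shift: "linear (shift M \<mu>)"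
  by (rule linearI)
    (simp_all add: shift_def matrix_vector_right_distrib scaleR_vec_complex
      matrix_vector_mult_scalar vec_eq_iff algebra_simps)

lemma fold_shift_commute: "fold (shift M) \<mu>s (shift M \<mu> v) = shift M \<mu> (fold (shift M) \<mu>s v)"
  by (induction \<mu>s arbitrary: v) (simp, metis fold_simps(2) shift_commute)

lemma poly_op_upto:
  assumes "degree p \<le> N"
  shows "poly_op M p v = (\<Sum>i\<le>N. coeff p i *s (((*v) M) ^^ i) v)"
  unfolding poly_op_def
  by (rule sum.mono_neutral_left) (use assms in \<open>auto simp: coeff_eq_0\<close>)

lemma poly_op_linear_factor: "poly_op M ([:-\<mu>, 1:] * q) v = shift M \<mu> (poly_op M q v)"
proof -
  let ?T = "(*v) M" and ?N = "degree q"
  have "poly_op M ([:-\<mu>, 1:] * q) v =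
      (\<Sum>i\<le>Suc ?N. coeff ([:-\<mu>, 1:] * q) i *s (?T ^^ i) v)"
    by (rule poly_op_upto) (use degree_mult_le[of "[:-\<mu>, 1:]" q] in simp)
  \<comment> \<open>Coefficientwise (X - \<mu>) q = X q - \<mu> q, with \<open>pCons 0 q\<close> for
    X q. The upper limit \<open>Suc ?N\<close> serves both sums, since the extra coefficient of q is
    0.\<close>
  also have "\<dots> = (\<Sum>i\<le>Suc ?N. coeff (pCons 0 q) i *s (?T ^^ i) v) -
      (\<Sum>i\<le>Suc ?N. (\<mu> * coeff q i) *s (?T ^^ i) v)"
    by (simp only: sum_subtractf[symmetric])
      (simp add: vec_eq_iff algebra_simps)
  also have "(\<Sum>i\<le>Suc ?N. coeff (pCons 0 q) i *s (?T ^^ i) v) =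
      (\<Sum>i\<le>?N. coeff q i *s ?T ((?T ^^ i) v))"
    by (subst sum.atMost_Suc_shift) simp
  also have "\<dots> = M *v poly_op M q v"
    by (simp add: poly_op_def matrix_vector_mult_scalar
        linear_sum[OF matrix_vector_mul_linear])
  also have "(\<Sum>i\<le>Suc ?N. (\<mu> * coeff q i) *s (?T ^^ i) v) = \<mu> *s poly_op M q v"
    by (simp add: poly_op_def coeff_eq_0 vec_eq_iff sum_distrib_left mult_ac)
  finally show ?thesis by (simp add: shift_def)
qed

text \<open>Over the complex numbers each root splits off one factor \<open>shift M \<mu>\<close>;
  at degree 0 the nonzero constant is left.\<close>

lemma poly_op_factorization:
  assumes "p \<noteq> 0"
  shows "\<exists>c \<mu>s. c \<noteq> 0 \<and> (\<forall>v. poly_op M p v = c *s fold (shift M) \<mu>s v)"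
  using assms
proof (induction "degree p" arbitrary: p)
  case 0
  then obtain c where "p = [:c:]" by (metis degree_eq_zeroE)
  with 0 show ?case
    by (intro exI[of _ c] exI[of _ "[]"]) (auto simp: poly_op_def)
next
  case (Suc n)
  then have "\<not> constant (poly p)" by (simp add: constant_degree)
  then obtain \<mu> where "poly p \<mu> = 0" using fundamental_theorem_of_algebra by blast
  then obtain q where q: "p = [:-\<mu>, 1:] * q" by (metis poly_eq_0_iff_dvd dvdE)
  then have "q \<noteq> 0" using Suc.prems by auto
  with q have "degree p = Suc (degree q)" using degree_mult_eq[of "[:-\<mu>, 1:]" q] by simp
  then obtain c \<mu>s where c: "c \<noteq> 0" "\<And>v. poly_op M q v = c *s fold (shift M) \<mu>s v"
    using Suc.hyps(1)[of q] Suc.hyps(2) \<open>q \<noteq> 0\<close> by auto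
  show ?case
    by (intro exI[of _ c] exI[of _ "\<mu> # \<mu>s"])
      (use c in \<open>simp add: q poly_op_linear_factor shift_scalar fold_shift_commute del: mult_pCons_left\<close>)
qed

text \<open>Dependence is a property of sets, so it applies to the first DIM + 1 terms only if they
  are distinct; a repetition is itself a relation, with coefficients 1 and -1.\<close>

lemma powers_dependent:
  fixes X :: "nat \<Rightarrow> 'a::euclidean_space"
  shows "\<exists>c N. (\<exists>i\<le>N. c i \<noteq> 0) \<and> (\<Sum>i\<le>N. c i *\<^sub>R X i) = 0"
proof (cases "inj_on X {..DIM('a)}")
  case True
  have "dependent (X ` {..DIM('a)})"
    by (rule dependent_biggerset) (use card_image[OF True] in simp_all)
  then obtain u where u: "\<exists>v\<in>X ` {..DIM('a)}. u v \<noteq> 0" "(\<Sum>v\<in>X ` {..DIM('a)}. u v *\<^sub>R v) = 0"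
    by (subst (asm) dependent_finite) auto
  then show ?thesis
    by (intro exI[of _ "u \<circ> X"] exI[of _ "DIM('a)"]) (auto simp: sum.reindex[OF True])
next
  case False
  then obtain i j where ij: "i \<le> DIM('a)" "j \<le> DIM('a)" "i \<noteq> j" "X i = X j"
    by (auto simp: inj_on_def)
  have "(\<Sum>k\<le>DIM('a). (if k = i then 1 else if k = j then - 1 else (0::real)) *\<^sub>R X k) =
      (\<Sum>k\<le>DIM('a). (if k = i then X k else 0) + (if k = j then - X k else 0))"
    by (rule sum.cong) (use ij in auto)
  also have "\<dots> = 0" using ij by (simp add: sum.distrib)
  finally show ?thesis
    using ij by (intro exI[of _ "\<lambda>k. if k = i then 1 else if k = j then - 1 else 0"]
        exI[of _ "DIM('a)"]) auto
qed

text \<open>The powers of M lie in a real vector space of finite dimension, so some real combination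
  of them vanishes; its coefficients are those of p.\<close>

lemma annihilating_poly:
  fixes M :: "complex^'n^'n"
  shows "\<exists>p. p \<noteq> 0 \<and> (\<forall>v. poly_op M p v = 0)"
proof -
  define X where "X i = (((**) M) ^^ i) (mat 1)" for i
  have X: "X i *v v = (((*v) M) ^^ i) v" for i v
    by (induction i) (simp_all add: X_def flip: matrix_vector_mul_assoc)
  obtain c N where c: "\<exists>i\<le>N. c i \<noteq> 0" "(\<Sum>i\<le>N. c i *\<^sub>R X i) = 0"
    using powers_dependent[of X] by blast
  define p where "p = (\<Sum>i\<le>N. monom (complex_of_real (c i)) i)"
  have coeff: "coeff p i = (if i \<le> N then complex_of_real (c i) else 0)" for i
    by (simp add: p_def coeff_sum)
  from c(1) coeff have "p \<noteq> 0" by (metis coeff_0 of_real_eq_0_iff)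
  moreover have "poly_op M p v = 0" for v
  proof -
    have "degree p \<le> N" by (rule degree_le) (simp add: coeff)
    then have "poly_op M p v = (\<Sum>i\<le>N. (c i *\<^sub>R X i) *v v)"
      by (subst poly_op_upto[of _ N])
        (auto simp: coeff X[symmetric] vec_eq_iff matrix_vector_mult_def sum_distrib_left
          scaleR_conv_of_real[where 'a=complex] mult_ac intro!: sum.cong)
    also have "\<dots> = (\<Sum>i\<le>N. c i *\<^sub>R X i) *v v"
      by (simp add: vec_eq_iff matrix_vector_mult_def sum_distrib_right sum.swap[of _ "{..N}"])
    finally show ?thesis by (simp add: c(2))
  qed
  ultimately show ?thesis by blast
qed

text \<open>A factor whose root is not an eigenvalue is injective, and the factors commute, so it
  can be moved outermost and cancelled. Only roots governed by the spectral hypothesis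
  remain.\<close>

lemma annihilating_eigenvalues:
  fixes M :: "complex^'n^'n"
  shows "\<exists>\<mu>s. (\<forall>\<mu>\<in>set \<mu>s. \<exists>v. v \<noteq> 0 \<and> M *v v = \<mu> *s v) \<and> (\<forall>v. fold (shift M) \<mu>s v = 0)"
proof -
  obtain p where p: "p \<noteq> 0" "\<And>v. poly_op M p v = 0" using annihilating_poly[of M] by blast
  obtain c \<mu>s where c: "c \<noteq> 0" "\<And>v. poly_op M p v = c *s fold (shift M) \<mu>s v"
    using poly_op_factorization[OF p(1), of M] by blast
  let ?eig = "\<lambda>\<mu>. \<exists>v. v \<noteq> 0 \<and> M *v v = \<mu> *s v"
  have *: "fold (shift M) \<mu>s v = 0 \<Longrightarrow> fold (shift M) (filter ?eig \<mu>s) v = 0" for \<mu>s v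
  proof (induction \<mu>s arbitrary: v)
    case (Cons \<mu> \<mu>s)
    show ?case
    proof (cases "?eig \<mu>")
      case False
      with Cons.prems have "fold (shift M) \<mu>s v = 0"
        by (auto simp: fold_shift_commute) (auto simp: shift_def)
      with False Cons.IH show ?thesis by auto
    qed (use Cons in auto)
  qed auto
  have "fold (shift M) \<mu>s v = 0" for v
    using p(2)[of v] c by (simp add: vec_eq_iff)
  with * show ?thesis by (intro exI[of _ "filter ?eig \<mu>s"]) auto
qed

section \<open>Quadratic forms from chains of factors\<close>

text \<open>The inner product is the real part of the Hermitian one, so the imaginary part of \<mu>
  acts as an infinitesimal rotation and contributes nothing.\<close>

lemma inner_scalar_self: "v \<bullet> (\<mu> *s v) = Re \<mu> * (norm (v::complex^'n))\<^sup>2"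
proof -
  have "v \<bullet> (\<mu> *s v) = (\<Sum>i\<in>UNIV. Re \<mu> * (v $ i \<bullet> v $ i))"
    unfolding inner_vec_def
    by (rule sum.cong) (auto simp: inner_complex_def algebra_simps)
  then show ?thesis
    by (simp add: power2_norm_eq_inner inner_vec_def sum_distrib_left)
qed

text \<open>The chain of vectors \<open>v\<close>, \<open>(M - \<mu>\<^sub>1) v\<close>, \<open>(M - \<mu>\<^sub>2) (M - \<mu>\<^sub>1) v\<close>, \<dots> ends in zero, and a sum of
  squared norms with rapidly increasing weights along the chain decreases: no Jordan form is needed.\<close>

lemma lyapunov_form_complex:
  fixes M :: "complex^'n^'n"
  assumes "\<forall>\<mu>\<in>set \<mu>s. Re \<mu> < 0"
  shows "\<exists>H c. bilinear H \<and> (\<forall>u v. H u v = H v u) \<and> c > 0 \<and>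
    (\<forall>v. fold (shift M) \<mu>s v = 0 \<longrightarrow> (norm v)\<^sup>2 \<le> H v v \<and> H v (M *v v) \<le> - c * (norm v)\<^sup>2)"
  using assms
proof (induction \<mu>s)
  case Nil
  show ?case
    by (intro exI[of _ inner] exI[of _ 1])
      (auto simp: inner_commute bilinear_conv_bounded_bilinear bounded_bilinear_inner)
next
  case (Cons \<mu> \<mu>s)
  then obtain H c where H: "bilinear H" "\<And>u v. H u v = H v u" "c > 0"
    "\<And>v. fold (shift M) \<mu>s v = 0 \<Longrightarrow> (norm v)\<^sup>2 \<le> H v v"
    "\<And>v. fold (shift M) \<mu>s v = 0 \<Longrightarrow> H v (M *v v) \<le> - c * (norm v)\<^sup>2" by auto
  define \<alpha> where "\<alpha> = - Re \<mu>"
  have "\<alpha> > 0" using Cons.prems by (simp add: \<alpha>_def)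
  \<comment> \<open>The cross term \<open>v \<bullet> ?w\<close> below leaves |w|^2 / (2 \<alpha>);
    with this weight the decay K c |w|^2 of the shorter chain cancels it exactly.\<close>
  define K where "K = 1 / (2 * \<alpha> * c)"
  have "K > 0" using \<open>\<alpha> > 0\<close> H(3) by (simp add: K_def)
  define H' where "H' u v = u \<bullet> v + K * H (shift M \<mu> u) (shift M \<mu> v)" for u v
  have "bilinear H'"
    using linear_shift[of M \<mu>]
    by (auto simp: bilinear_def H'_def linear_iff inner_add algebra_simps
        bilinear_ladd[OF H(1)] bilinear_radd[OF H(1)] bilinear_lmul[OF H(1)] bilinear_rmul[OF H(1)])
  moreover have "H' u v = H' v u" for u v
    by (simp add: H'_def H(2)[of "shift M \<mu> u"] inner_commute)
  moreover have "(norm v)\<^sup>2 \<le> H' v v \<and> H' v (M *v v) \<le> - (\<alpha> / 2) * (norm v)\<^sup>2"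
    if v: "fold (shift M) (\<mu> # \<mu>s) v = 0" for v
  proof -
    let ?w = "shift M \<mu> v"
    have w: "(norm ?w)\<^sup>2 \<le> H ?w ?w" "H ?w (M *v ?w) \<le> - c * (norm ?w)\<^sup>2"
      using H(4,5)[of ?w] v by auto
    have "H ?w ?w \<ge> 0" using w(1) by (rule order_trans[rotated]) simp
    then have "(norm v)\<^sup>2 \<le> H' v v"
      using \<open>K > 0\<close> by (simp add: H'_def power2_norm_eq_inner)
    \<comment> \<open>M v equals \<mu> v + w, and the shift of M v is M w because M commutes with
      the shift.\<close>
    moreover have "H' v (M *v v) = v \<bullet> (\<mu> *s v) + v \<bullet> ?w + K * H ?w (M *v ?w)"
      by (simp add: H'_def shift_mult) (simp add: shift_def inner_diff_right)
    moreover have "v \<bullet> ?w \<le> \<alpha> / 2 * (norm v)\<^sup>2 + (norm ?w)\<^sup>2 / (2 * \<alpha>)"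
    proof -
      have "0 \<le> (\<alpha> * norm v - norm ?w)\<^sup>2 / (2 * \<alpha>)" using \<open>\<alpha> > 0\<close> by simp
      also have "\<dots> = \<alpha> / 2 * (norm v)\<^sup>2 + (norm ?w)\<^sup>2 / (2 * \<alpha>) - norm v * norm ?w"
        using \<open>\<alpha> > 0\<close> by (simp add: field_simps power2_eq_square)
      finally show ?thesis using norm_cauchy_schwarz[of v ?w] by linarith
    qed
    moreover have "K * H ?w (M *v ?w) \<le> - (norm ?w)\<^sup>2 / (2 * \<alpha>)"
    proof -
      have "K * H ?w (M *v ?w) \<le> K * (- c * (norm ?w)\<^sup>2)"
        using w(2) \<open>K > 0\<close> by (intro mult_left_mono) auto
      also have "\<dots> = - (norm ?w)\<^sup>2 / (2 * \<alpha>)"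
        using \<open>\<alpha> > 0\<close> H(3) by (simp add: K_def field_simps)
      finally show ?thesis .
    qed
    ultimately show ?thesis by (simp add: inner_scalar_self \<alpha>_def algebra_simps)
  qed
  ultimately show ?case
    using \<open>\<alpha> > 0\<close> by (intro exI[of _ H'] exI[of _ "\<alpha> / 2"]) auto
qed

text \<open>Eigenvectors of a real matrix may be complex, so the form is found on complex vectors
  and pulled back along the embedding \<open>C\<close>, which preserves norms and intertwines A with
  its complexification.\<close>

lemma lyapunov_form:
  fixes A :: "real^'n^'n"
  assumes "\<forall>\<mu>\<in>complex_eigenvalues A. Re \<mu> < 0"
  obtains B c where "bounded_bilinear B" "\<And>u v. B u v = B v u" "c > 0"
    "\<And>v. (norm v)\<^sup>2 \<le> B v v" "\<And>v. B v (A *v v) \<le> - c * (norm v)\<^sup>2"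
proof -
  let ?M = "map_matrix complex_of_real A"
  define C :: "real^'n \<Rightarrow> complex^'n" where "C v = (\<chi> i. complex_of_real (v $ i))" for v
  have "linear C" by (rule linearI) (simp_all add: C_def vec_eq_iff scaleR_conv_of_real[where 'a=complex])
  obtain \<mu>s where \<mu>s: "\<forall>\<mu>\<in>set \<mu>s. \<exists>v. v \<noteq> 0 \<and> ?M *v v = \<mu> *s v" "\<And>v. fold (shift ?M) \<mu>s v = 0"
    using annihilating_eigenvalues[of ?M] by blast
  then have "\<forall>\<mu>\<in>set \<mu>s. Re \<mu> < 0" using assms by (auto simp: complex_eigenvalues_def)
  from lyapunov_form_complex[OF this, of ?M] obtain H c where
    H: "bilinear H" "\<And>u v. H u v = H v u" "c > 0"
    "\<And>v. (norm v)\<^sup>2 \<le> H v v" "\<And>v. H v (?M *v v) \<le> - c * (norm v)\<^sup>2"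
    using \<mu>s(2) by auto
  have norm_C: "norm (C v) = norm v" for v
    by (simp add: C_def norm_vec_def)
  have mult_C: "?M *v C v = C (A *v v)" for v
    by (simp add: C_def vec_eq_iff matrix_vector_mult_def map_matrix_def)
  have "bilinear (\<lambda>u v. H (C u) (C v))"
    using \<open>linear C\<close>
    by (auto simp: bilinear_def linear_iff bilinear_ladd[OF H(1)] bilinear_radd[OF H(1)]
        bilinear_lmul[OF H(1)] bilinear_rmul[OF H(1)])
  then show ?thesis
    using that[of "\<lambda>u v. H (C u) (C v)" c] H(2,3) H(4)[of "C _"] H(5)[of "C _"]
    by (simp add: bilinear_conv_bounded_bilinear norm_C mult_C)
qed

section \<open>Differential inequalities and the Picard theorem\<close>

lemma has_real_derivative_norm_square:
  fixes v :: "real \<Rightarrow> 'a::real_inner"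
  assumes "(v has_vector_derivative v') (at u within S)"
  shows "((\<lambda>u. (norm (v u))\<^sup>2) has_real_derivative 2 * (v u \<bullet> v')) (at u within S)"
proof -
  have "((\<lambda>u. v u \<bullet> v u) has_derivative (\<lambda>h. v u \<bullet> (h *\<^sub>R v') + (h *\<^sub>R v') \<bullet> v u)) (at u within S)"
    using assms unfolding has_vector_derivative_def by (intro has_derivative_inner)
  then show ?thesis
    by (simp add: has_field_derivative_def power2_norm_eq_inner inner_commute algebra_simps
        mult_commute_abs)
qed

text \<open>The product of exp (- k (u - s)) with the excess over the level \<theta> is
  nonincreasing. The rate k may have either sign: positive for the growth of errors, negative for
  decay towards \<theta>.\<close>

lemma gronwall:
  fixes \<phi> :: "real \<Rightarrow> real"
  assumes "s \<le> t"
    and "\<And>u. u \<in> {s..t} \<Longrightarrow> (\<phi> has_real_derivative \<phi>' u) (at u within {s..t})"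
    and "\<And>u. u \<in> {s..t} \<Longrightarrow> \<phi>' u \<le> k * (\<phi> u - \<theta>)"
  shows "\<phi> t - \<theta> \<le> exp (k * (t - s)) * (\<phi> s - \<theta>)"
proof -
  define \<psi> where "\<psi> u = exp (- k * (u - s)) * (\<phi> u - \<theta>)" for u
  have der: "(\<psi> has_real_derivative exp (- k * (u - s)) * (\<phi>' u - k * (\<phi> u - \<theta>))) (at u within {s..t})"
    if "u \<in> {s..t}" for u
    unfolding \<psi>_def
    by (rule derivative_eq_intros assms(2)[OF that] refl | simp add: algebra_simps)+
  have "\<psi> t \<le> \<psi> s"
  proof (rule DERIV_nonpos_imp_decreasing_open[OF assms(1)])
    show "continuous_on {s..t} \<psi>"
      using der by (intro DERIV_continuous_on) auto
    fix u assume "s < u" "u < t"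
    then have "(\<psi> has_real_derivative exp (- k * (u - s)) * (\<phi>' u - k * (\<phi> u - \<theta>))) (at u)"
      using der[of u] by (simp add: at_within_Icc_at)
    moreover have "exp (- k * (u - s)) * (\<phi>' u - k * (\<phi> u - \<theta>)) \<le> 0"
      using assms(3)[of u] \<open>s < u\<close> \<open>u < t\<close> by (simp add: mult_le_0_iff)
    ultimately show "\<exists>y. (\<psi> has_real_derivative y) (at u) \<and> y \<le> 0" by blast
  qed
  then have "exp (k * (t - s)) * \<psi> t \<le> exp (k * (t - s)) * \<psi> s"
    by simp
  then show ?thesis
    by (simp add: \<psi>_def mult.assoc[symmetric] flip: exp_add)
qed

text \<open>A first-exit argument. The estimate that keeps \<phi> below \<kappa> is available only
  while \<phi> has stayed at most \<kappa>; at the first time of reaching \<kappa> it still applies,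
  and its strict conclusion is a contradiction.\<close>

lemma continuous_trap:
  fixes \<phi> :: "real \<Rightarrow> real"
  assumes cont: "continuous_on {s..} \<phi>" and "\<phi> s < \<kappa>"
    and trap: "\<And>t. t > s \<Longrightarrow> \<forall>u\<in>{s..t}. \<phi> u \<le> \<kappa> \<Longrightarrow> \<phi> t < \<kappa>"
    and "t \<ge> s"
  shows "\<phi> t < \<kappa>"
proof (rule ccontr)
  assume "\<not> \<phi> t < \<kappa>"
  define S where "S = {u\<in>{s..t}. \<kappa> \<le> \<phi> u}"
  have "closed S"
    using continuous_on_closed_Collect_le[of "{s..t}" "\<lambda>_. \<kappa>" \<phi>]
      continuous_on_subset[OF cont, of "{s..t}"] by (simp add: S_def)
  have S: "S \<noteq> {}" "bdd_below S"
    using \<open>\<not> \<phi> t < \<kappa>\<close> \<open>t \<ge> s\<close> by (auto simp: S_def intro: bdd_belowI[of _ s])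
  define m where "m = Inf S"
  have "m \<in> S" unfolding m_def using S \<open>closed S\<close> by (rule closed_contains_Inf)
  then have m: "s \<le> m" "m \<le> t" "\<kappa> \<le> \<phi> m" by (auto simp: S_def)
  then have "s < m" using assms(2) by (cases "s = m") auto
  have less: "\<phi> u < \<kappa>" if "s \<le> u" "u < m" for u
    using cInf_lower[OF _ S(2), of u] that m by (force simp: S_def m_def)
  \<comment> \<open>The bound at the first exit time m itself is the limit of the strict bounds to
    its left.\<close>
  have "\<phi> m \<le> \<kappa>"
  proof (rule tendsto_upperbound)
    have "continuous (at m within {s..}) \<phi>"
      using cont m(1) by (simp add: continuous_on_eq_continuous_within)
    then have "(\<phi> \<longlongrightarrow> \<phi> m) (at m within {s..})" by (simp add: continuous_within)
    then have "(\<phi> \<longlongrightarrow> \<phi> m) (at m within {s..m})"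
      by (rule tendsto_within_subset) auto
    then show "(\<phi> \<longlongrightarrow> \<phi> m) (at_left m)"
      using \<open>s < m\<close> by (simp add: at_within_Icc_at_left)
    show "\<forall>\<^sub>F u in at_left m. \<phi> u \<le> \<kappa>"
      unfolding eventually_at_left[OF \<open>s < m\<close>] using \<open>s < m\<close> less
      by (intro exI[of _ s]) (auto intro: less_imp_le)
  qed simp
  then have "\<forall>u\<in>{s..m}. \<phi> u \<le> \<kappa>" using less by (force simp: le_less)
  from trap[OF \<open>s < m\<close> this] m(3) show False by simp
qed

text \<open>Squares avoid the point where the norm is not differentiable. The mixed term is split by
  2 |v| \<epsilon> \<le> |v|^2 + \<epsilon>^2, which gives the rate 2 L + 1 and the level
  -\<epsilon>^2 in \<open>gronwall\<close>.\<close>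

lemma norm_growth:
  fixes v :: "real \<Rightarrow> 'a::real_inner"
  assumes "s \<le> t" "L \<ge> 0"
    and der: "\<And>u. u \<in> {s..t} \<Longrightarrow> (v has_vector_derivative v' u) (at u within {s..t})"
    and bound: "\<And>u. u \<in> {s..t} \<Longrightarrow> norm (v' u) \<le> L * norm (v u) + \<epsilon>"
  shows "(norm (v t))\<^sup>2 + \<epsilon>\<^sup>2 \<le> exp ((2 * L + 1) * (t - s)) * ((norm (v s))\<^sup>2 + \<epsilon>\<^sup>2)"
proof -
  have "(norm (v t))\<^sup>2 - - \<epsilon>\<^sup>2 \<le> exp ((2 * L + 1) * (t - s)) * ((norm (v s))\<^sup>2 - - \<epsilon>\<^sup>2)"
  proof (rule gronwall[OF assms(1), where \<phi>' = "\<lambda>u. 2 * (v u \<bullet> v' u)"])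
    fix u assume u: "u \<in> {s..t}"
    show "((\<lambda>u. (norm (v u))\<^sup>2) has_real_derivative 2 * (v u \<bullet> v' u)) (at u within {s..t})"
      by (intro has_real_derivative_norm_square der u)
    have "v u \<bullet> v' u \<le> norm (v u) * (L * norm (v u) + \<epsilon>)"
      using norm_cauchy_schwarz[of "v u" "v' u"] mult_left_mono[OF bound[OF u], of "norm (v u)"] by simp
    moreover have "0 \<le> (norm (v u) - \<epsilon>)\<^sup>2" "0 \<le> 2 * L * \<epsilon>\<^sup>2" using \<open>L \<ge> 0\<close> by auto
    ultimately show "2 * (v u \<bullet> v' u) \<le> (2 * L + 1) * ((norm (v u))\<^sup>2 - - \<epsilon>\<^sup>2)"
      by (simp add: power2_eq_square algebra_simps)
  qed
  then show ?thesis by simp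
qed

section \<open>Global solutions from the Picard operator\<close>

lemma integral_from_has_vector_derivative:
  fixes h :: "real \<Rightarrow> 'a::banach"
  assumes "continuous_on {s..} h" "s \<le> t"
  shows "((\<lambda>u. integral {s..u} h) has_vector_derivative h t) (at t within {s..})"
proof -
  have "((\<lambda>u. integral {s..u} h) has_vector_derivative h t) (at t within {s..t + 1})"
    using assms by (intro integral_has_vector_derivative) (auto elim: continuous_on_subset)
  moreover have "at t within {s..t + 1} = at t within {s..}"
    by (rule at_within_nhd[of t "{..<t + 1}"]) auto
  ultimately show ?thesis by simp
qed

text \<open>The bounded continuous functions in \<open>picard\<close> are defined on the whole line.
  To the left of s the interval is empty and the integral is 0, and the two pieces agree at
  s.\<close>

lemma continuous_on_integral_from:
  fixes h :: "real \<Rightarrow> 'a::banach"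
  assumes "continuous_on {s..} h"
  shows "continuous_on UNIV (\<lambda>u. integral {s..u} h)"
proof -
  have "continuous_on {s..} (\<lambda>u. integral {s..u} h)"
    unfolding continuous_on_eq_continuous_within
    using integral_from_has_vector_derivative[OF assms] has_vector_derivative_continuous by blast
  moreover have "continuous_on {..s} (\<lambda>u. integral {s..u} h)"
  proof (rule continuous_on_eq[OF continuous_on_const[of _ 0]])
    fix u assume "u \<in> {..s}"
    then show "0 = integral {s..u} h" by (cases "u = s") auto
  qed
  ultimately have "continuous_on ({s..} \<union> {..s}) (\<lambda>u. integral {s..u} h)"
    by (intro continuous_on_closed_Un) auto
  moreover have "{s..} \<union> {..s} = (UNIV :: real set)" by auto
  ultimately show ?thesis by simp
qed

text \<open>Rescaling by \<open>exp (k (t - s))\<close> with \<open>k\<close> twice the Lipschitz constant turns the Picard operator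
  into a contraction on the whole half-line at once.\<close>

lemma picard:
  fixes G :: "real \<Rightarrow> 'a::banach \<Rightarrow> 'a"
  assumes cont: "\<And>u. continuous_on {s..} u \<Longrightarrow> continuous_on {s..} (\<lambda>t. G t (u t))"
    and bound: "\<And>t x. t \<ge> s \<Longrightarrow> norm (G t x) \<le> M"
    and lip: "\<And>t x y. t \<ge> s \<Longrightarrow> norm (G t x - G t y) \<le> L * norm (x - y)"
    and "L > 0"
  obtains x where "x s = y" "\<And>t. t \<ge> s \<Longrightarrow> (x has_vector_derivative G t (x t)) (at t within {s..})"
proof -
  define k where "k = 2 * L"
  have "k > 0" using \<open>L > 0\<close> by (simp add: k_def)
  \<comment> \<open>The maximum makes E equal to 1 before s, so that dividing by E is harmless on
    the whole line. The unknown is a bounded w, the solution being y + E w.\<close>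
  define E where "E t = exp (k * max 0 (t - s))" for t
  have E: "E t > 0" "continuous_on S E" for t S
    unfolding E_def by (auto intro!: continuous_intros)
  define X where "X w t = y + E t *\<^sub>R apply_bcontfun w t" for w t
  have cont_G: "continuous_on {s..} (\<lambda>t. G t (X w t))" for w
    unfolding X_def by (intro cont continuous_intros E) simp
  define I where "I w t = integral {s..t} (\<lambda>\<tau>. G \<tau> (X w \<tau>))" for w t
  have "M \<ge> 0" using bound[of s] norm_ge_zero order_trans by blast
  have le_E: "k * (t - s) \<le> E t" for t
  proof -
    have "k * (t - s) \<le> k * max 0 (t - s)" using \<open>k > 0\<close> by (intro mult_left_mono) auto
    also have "\<dots> \<le> 1 + k * max 0 (t - s)" by simp
    also have "\<dots> \<le> E t" unfolding E_def by (rule exp_ge_add_one_self)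
    finally show ?thesis .
  qed
  have integrable: "(\<lambda>\<tau>. G \<tau> (X w \<tau>)) integrable_on {s..t}" for w t
    by (rule integrable_continuous_real) (rule continuous_on_subset[OF cont_G], auto)
  have norm_I: "norm (I w t) \<le> M / k * E t" for w t
  proof (cases "t \<ge> s")
    case True
    have "norm (I w t) \<le> M * (t - s)"
      unfolding I_def using True integral_bound[of s t "\<lambda>\<tau>. G \<tau> (X w \<tau>)" M]
      by (auto intro!: integral_bound bound continuous_on_subset[OF cont_G])
    also have "\<dots> = M / k * (k * (t - s))" using \<open>k > 0\<close> by simp
    also have "\<dots> \<le> M / k * E t"
      using le_E[of t] \<open>M \<ge> 0\<close> \<open>k > 0\<close> by (intro mult_left_mono) auto
    finally show ?thesis .
  next
    case False
    then show ?thesis using \<open>M \<ge> 0\<close> \<open>k > 0\<close> E(1)[of t] by (simp add: I_def)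
  qed
  have "(\<lambda>t. I w t /\<^sub>R E t) \<in> bcontfun" for w
  proof (rule bcontfun_normI)
    show "continuous_on UNIV (\<lambda>t. I w t /\<^sub>R E t)"
      unfolding I_def
      by (intro continuous_intros continuous_on_integral_from cont_G E) (use E(1) in \<open>metis less_irrefl\<close>)
    show "norm (I w t /\<^sub>R E t) \<le> M / k" for t
      using norm_I[of w t] E(1)[of t] by (simp add: field_simps)
  qed
  moreover define \<Phi> where "\<Phi> w = Bcontfun (\<lambda>t. I w t /\<^sub>R E t)" for w
  ultimately have \<Phi>: "apply_bcontfun (\<Phi> w) t = I w t /\<^sub>R E t" for w t
    by (simp add: Bcontfun_inverse)
  have "\<exists>!w. \<Phi> w = w"
  proof (rule banach_fix_type[of "1/2"]; (intro allI)?)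
    fix w v
    show "dist (\<Phi> w) (\<Phi> v) \<le> 1 / 2 * dist w v"
    proof (rule dist_bound)
      fix t
      have "norm (I w t - I v t) \<le> dist w v / 2 * E t"
      proof (cases "t \<ge> s")
        case True
        have pt: "norm (G \<tau> (X w \<tau>) - G \<tau> (X v \<tau>)) \<le> dist w v * (L * exp (k * (\<tau> - s)))"
          if "\<tau> \<in> {s..t}" for \<tau>
        proof -
          have "norm (G \<tau> (X w \<tau>) - G \<tau> (X v \<tau>)) \<le> L * norm (X w \<tau> - X v \<tau>)"
            using that by (intro lip) auto
          also have "X w \<tau> - X v \<tau> = E \<tau> *\<^sub>R (w \<tau> - v \<tau>)" by (simp add: X_def algebra_simps)
          also have "L * norm \<dots> = L * E \<tau> * dist (w \<tau>) (v \<tau>)"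
            using E(1)[of \<tau>] by (simp add: dist_norm)
          also have "\<dots> \<le> L * E \<tau> * dist w v"
            using E(1)[of \<tau>] \<open>L > 0\<close> by (intro mult_left_mono dist_bounded) auto
          finally show ?thesis using that by (simp add: E_def mult_ac)
        qed
        \<comment> \<open>As k = 2 L, the antiderivative carries the factor L / k = 1 / 2, which is
          the contraction constant.\<close>
        have "((\<lambda>\<tau>. dist w v * (L * exp (k * (\<tau> - s)))) has_integral
            dist w v / 2 * exp (k * (t - s)) - dist w v / 2 * exp (k * (s - s))) {s..t}"
        proof (rule fundamental_theorem_of_calculus[OF True])
          fix \<tau>
          show "((\<lambda>\<tau>. dist w v / 2 * exp (k * (\<tau> - s))) has_vector_derivative
              dist w v * (L * exp (k * (\<tau> - s)))) (at \<tau> within {s..t})"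
            unfolding has_real_derivative_iff_has_vector_derivative[symmetric]
            by (rule derivative_eq_intros refl | simp add: k_def)+
        qed
        note int = this
        have "integral {s..t} (\<lambda>\<tau>. dist w v * (L * exp (k * (\<tau> - s)))) \<le> dist w v / 2 * E t"
          unfolding integral_unique[OF int] E_def using True by simp
        moreover have "norm (I w t - I v t) \<le> integral {s..t} (\<lambda>\<tau>. dist w v * (L * exp (k * (\<tau> - s))))"
          unfolding I_def integral_diff[OF integrable integrable, symmetric]
          by (rule integral_norm_bound_integral[OF integrable_diff[OF integrable integrable]])
            (use int pt in auto)
        ultimately show ?thesis by linarith
      next
        case False
        then show ?thesis using E(1)[of t] by (simp add: I_def)
      qed
      moreover have "dist (\<Phi> w t) (\<Phi> v t) = norm (I w t - I v t) / E t"
      proof -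
        have "\<Phi> w t - \<Phi> v t = (I w t - I v t) /\<^sub>R E t" by (simp add: \<Phi> scaleR_diff_right)
        then show ?thesis using E(1)[of t] by (simp add: dist_norm divide_inverse mult.commute)
      qed
      ultimately show "dist (\<Phi> w t) (\<Phi> v t) \<le> 1 / 2 * dist w v"
        using E(1)[of t] by (simp add: pos_divide_le_eq)
    qed
  qed auto
  then obtain w where w: "\<Phi> w = w" by blast
  have X_eq: "X w t = y + I w t" for t
    using \<Phi>[of w t] E(1)[of t] by (simp add: X_def w)
  show ?thesis
  proof
    show "X w s = y" using X_eq[of s] by (simp add: I_def)
    show "(X w has_vector_derivative G t (X w t)) (at t within {s..})" if "t \<ge> s" for t
    proof -
      have X_fix: "X w = (\<lambda>t. y + integral {s..t} (\<lambda>\<tau>. G \<tau> (X w \<tau>)))"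
        by (rule ext) (rule X_eq[unfolded I_def])
      have "((\<lambda>t. y + integral {s..t} (\<lambda>\<tau>. G \<tau> (X w \<tau>))) has_vector_derivative G t (X w t)) (at t within {s..})"
        using has_vector_derivative_add[OF has_vector_derivative_const
            integral_from_has_vector_derivative[OF cont_G that, of w], of y] by simp
      then show ?thesis unfolding X_fix[symmetric] .
    qed
  qed
qed

section \<open>Gluing Lyapunov forms over a compact set of parameters\<close>

text \<open>Continuity of f' keeps half of the decay rate near (p, l). Passing to differences of f
  by the mean value theorem along a segment lets one inequality treat both the distance to the
  equilibrium and the distance of two solutions.\<close>

lemma local_contraction:
  fixes f :: "'a::euclidean_space \<times> 'b::euclidean_space \<Rightarrow> 'a"
  assumes f': "\<And>z. (f has_derivative blinfun_apply (f' z)) (at z)"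
    and cont: "isCont f' (p, l)"
    and B: "bounded_bilinear B" and "c > 0"
    and neg: "\<And>h. B h (f' (p, l) (h, 0)) \<le> - c * (norm h)\<^sup>2"
  obtains \<rho> where "\<rho> > 0" "\<And>\<nu> x y. \<nu> \<in> ball l \<rho> \<Longrightarrow> x \<in> ball p \<rho> \<Longrightarrow> y \<in> ball p \<rho> \<Longrightarrow>
    B (x - y) (f (x, \<nu>) - f (y, \<nu>)) \<le> - (c / 2) * (norm (x - y))\<^sup>2"
proof -
  interpret B: bounded_bilinear B by fact
  obtain k where k: "k > 0" "\<And>u v. norm (B u v) \<le> norm u * norm v * k"
    using B.pos_bounded by blast
  \<comment> \<open>With k a bound for B, a change of the derivative below c / (2 k) alters the form
    by at most c / 2 times |h|^2.\<close>
  obtain d where d: "d > 0" "\<And>z. dist z (p, l) < d \<Longrightarrow> dist (f' z) (f' (p, l)) < c / (2 * k)"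
    using cont \<open>c > 0\<close> \<open>k > 0\<close> unfolding continuous_at_eps_delta
    by (metis divide_pos_pos mult_pos_pos zero_less_numeral)
  have near: "B h (f' (x, \<nu>) (h, 0)) \<le> - (c / 2) * (norm h)\<^sup>2"
    if "\<nu> \<in> ball l (d / 2)" "x \<in> ball p (d / 2)" for \<nu> x h
  proof -
    have "dist (x, \<nu>) (p, l) \<le> dist x p + dist \<nu> l"
      using sqrt_sum_squares_le_sum_abs[of "dist x p" "dist \<nu> l"] by (simp add: dist_Pair_Pair)
    then have "dist (f' (x, \<nu>)) (f' (p, l)) < c / (2 * k)"
      using that by (intro d(2)) (simp add: dist_commute)
    then have "norm (f' (x, \<nu>) (h, 0) - f' (p, l) (h, 0)) \<le> c / (2 * k) * norm h"
      using norm_blinfun[of "f' (x, \<nu>) - f' (p, l)" "(h, 0)"]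
        mult_right_mono[of "norm (f' (x, \<nu>) - f' (p, l))" "c / (2 * k)" "norm h"]
      by (simp add: dist_norm blinfun.diff_left)
    then have "norm h * norm (f' (x, \<nu>) (h, 0) - f' (p, l) (h, 0)) * k \<le>
        norm h * (c / (2 * k) * norm h) * k"
      using \<open>k > 0\<close> by (intro mult_right_mono mult_left_mono) auto
    also have "\<dots> = c / 2 * (norm h)\<^sup>2"
      using \<open>k > 0\<close> by (simp add: power2_eq_square)
    finally have "B h (f' (x, \<nu>) (h, 0) - f' (p, l) (h, 0)) \<le> c / 2 * (norm h)\<^sup>2"
      using k(2)[of h "f' (x, \<nu>) (h, 0) - f' (p, l) (h, 0)"] by simp
    then show ?thesis using neg[of h] by (simp add: B.diff_right)
  qed
  show ?thesis
  proof
    show "d / 2 > 0" using d(1) by simp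
    fix \<nu> x y assume \<nu>: "\<nu> \<in> ball l (d / 2)" and xy: "x \<in> ball p (d / 2)" "y \<in> ball p (d / 2)"
    define g where "g s = B (x - y) (f (y + s *\<^sub>R (x - y), \<nu>))" for s :: real
    have der: "(g has_real_derivative B (x - y) (f' (y + s *\<^sub>R (x - y), \<nu>) (x - y, 0))) (at s)" for s
    proof -
      have "((\<lambda>s. (y + s *\<^sub>R (x - y), \<nu>)) has_vector_derivative (x - y, 0)) (at s)"
        by (auto intro!: derivative_eq_intros simp: has_vector_derivative_def zero_prod_def)
      from vector_derivative_diff_chain_within[OF this has_derivative_at_withinI[OF f']]
      have "((\<lambda>s. f (y + s *\<^sub>R (x - y), \<nu>)) has_vector_derivative
          f' (y + s *\<^sub>R (x - y), \<nu>) (x - y, 0)) (at s)"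
        by (simp add: o_def)
      from bounded_linear.has_vector_derivative[OF B.bounded_linear_right this, of "x - y"]
      show ?thesis
        by (simp add: g_def[abs_def] has_real_derivative_iff_has_vector_derivative)
    qed
    obtain s where s: "0 < s" "s < 1"
      "g 1 - g 0 = (1 - 0) * B (x - y) (f' (y + s *\<^sub>R (x - y), \<nu>) (x - y, 0))"
      using MVT2[of 0 1 g "\<lambda>s. B (x - y) (f' (y + s *\<^sub>R (x - y), \<nu>) (x - y, 0))"] der by auto
    have "(1 - s) *\<^sub>R y + s *\<^sub>R x \<in> ball p (d / 2)"
      using s xy by (intro convexD convex_ball) auto
    also have "(1 - s) *\<^sub>R y + s *\<^sub>R x = y + s *\<^sub>R (x - y)" by (simp add: algebra_simps)
    finally have "B (x - y) (f' (y + s *\<^sub>R (x - y), \<nu>) (x - y, 0)) \<le> - (c / 2) * (norm (x - y))\<^sup>2"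
      by (intro near \<nu>)
    with s(3) show "B (x - y) (f (x, \<nu>) - f (y, \<nu>)) \<le> - (c / 2) * (norm (x - y))\<^sup>2"
      by (simp add: g_def B.diff_right)
  qed
qed

section \<open>Bump functions of class C^1\<close>

lemma DERIV_max_0_square: "((\<lambda>s::real. (max 0 s)\<^sup>2) has_real_derivative 2 * max 0 s) (at s)"
proof -
  consider "s > 0" | "s < 0" | "s = 0" by linarith
  then show ?thesis
  proof cases
    case 1
    then have "((\<lambda>s. s\<^sup>2) has_real_derivative 2 * max 0 s) (at s)"
      by (auto intro!: derivative_eq_intros)
    then show ?thesis
      by (rule has_field_derivative_transform_within_open[of _ _ _ "{0<..}"]) (use 1 in auto)
  next
    case 2
    then have "((\<lambda>s. 0) has_real_derivative 2 * max 0 s) (at s)"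
      by (auto intro!: derivative_eq_intros)
    then show ?thesis
      by (rule has_field_derivative_transform_within_open[of _ _ _ "{..<0}"]) (use 2 in auto)
  next
    case 3
    \<comment> \<open>At h = 0 both sides are 0, the left one because a quotient by 0 is 0.\<close>
    have "(\<lambda>h::real. ((max 0 (0 + h))\<^sup>2 - (max 0 0)\<^sup>2) / h) = max 0"
      by (auto simp: fun_eq_iff max_def power2_eq_square)
    moreover have "((max 0 :: real \<Rightarrow> real) \<longlongrightarrow> max 0 0) (at 0)"
      by (intro tendsto_intros)
    ultimately show ?thesis using 3 by (simp add: DERIV_def)
  qed
qed

text \<open>The inner square makes the function smooth at the centre; the outer one makes it C^1
  across the sphere of radius \<rho>, where the positive part has a corner.\<close>

definition bump :: "real \<Rightarrow> 'b::real_inner \<Rightarrow> 'b \<Rightarrow> real"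
  where "bump \<rho> l \<nu> = (max 0 (\<rho>\<^sup>2 - (norm (\<nu> - l))\<^sup>2))\<^sup>2"

lemma bump_nonneg: "bump \<rho> l \<nu> \<ge> 0"
  by (simp add: bump_def)

lemma bump_le: "bump \<rho> l \<nu> \<le> (\<rho>\<^sup>2)\<^sup>2"
  unfolding bump_def by (intro power_mono) auto

lemma bump_pos: "\<nu> \<in> ball l \<rho> \<Longrightarrow> bump \<rho> l \<nu> > 0"
  using power_strict_mono[of "norm (\<nu> - l)" \<rho> 2]
  by (simp add: bump_def dist_norm norm_minus_commute)

lemma bump_eq_0: "\<rho> > 0 \<Longrightarrow> \<nu> \<notin> ball l \<rho> \<Longrightarrow> bump \<rho> l \<nu> = 0"
  using power_mono[of \<rho> "norm (\<nu> - l)" 2]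
  by (simp add: bump_def dist_norm norm_minus_commute)

lemma continuous_on_bump: "continuous_on S (bump \<rho> l)"
  unfolding bump_def by (intro continuous_intros)

text \<open>The derivative is -4 m (u \<bullet> \<Lambda>'), with m the positive part and u the
  displacement. Where m is not 0 one has |u| < \<rho>, and m \<le> \<rho>^2, whence the constant 4
  \<rho>^3.\<close>

lemma bump_derivative:
  assumes "(\<Lambda> has_vector_derivative \<Lambda>') (at \<tau> within S)" "\<rho> > 0"
  obtains D where "((\<lambda>t. bump \<rho> l (\<Lambda> t)) has_real_derivative D) (at \<tau> within S)"
    "\<bar>D\<bar> \<le> 4 * \<rho> ^ 3 * norm \<Lambda>'"
proof -
  let ?m = "max 0 (\<rho>\<^sup>2 - (norm (\<Lambda> \<tau> - l))\<^sup>2)" and ?u = "\<Lambda> \<tau> - l"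
  have "((\<lambda>t. \<Lambda> t - l) has_vector_derivative \<Lambda>') (at \<tau> within S)"
    using has_vector_derivative_diff[OF assms(1) has_vector_derivative_const, of l] by simp
  from DERIV_diff[OF DERIV_const has_real_derivative_norm_square[OF this], of "\<rho>\<^sup>2"]
  have "((\<lambda>t. \<rho>\<^sup>2 - (norm (\<Lambda> t - l))\<^sup>2) has_real_derivative - (2 * (?u \<bullet> \<Lambda>'))) (at \<tau> within S)"
    by simp
  from DERIV_chain2[OF DERIV_max_0_square this]
  have "((\<lambda>t. bump \<rho> l (\<Lambda> t)) has_real_derivative 2 * ?m * - (2 * (?u \<bullet> \<Lambda>'))) (at \<tau> within S)"
    by (simp add: bump_def)
  moreover have "\<bar>2 * ?m * - (2 * (?u \<bullet> \<Lambda>'))\<bar> \<le> 4 * \<rho> ^ 3 * norm \<Lambda>'"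
  proof (cases "norm ?u < \<rho>")
    case True
    have "\<bar>?m\<bar> * \<bar>?u \<bullet> \<Lambda>'\<bar> \<le> \<rho>\<^sup>2 * (\<rho> * norm \<Lambda>')"
    proof (rule mult_mono)
      show "\<bar>?u \<bullet> \<Lambda>'\<bar> \<le> \<rho> * norm \<Lambda>'"
        using Cauchy_Schwarz_ineq2[of ?u \<Lambda>'] mult_right_mono[OF less_imp_le[OF True], of "norm \<Lambda>'"]
        by simp
    qed (use assms(2) in auto)
    moreover have "\<bar>2 * ?m * - (2 * (?u \<bullet> \<Lambda>'))\<bar> = 4 * (\<bar>?m\<bar> * \<bar>?u \<bullet> \<Lambda>'\<bar>)"
      by (simp only: abs_mult abs_minus_cancel)
    moreover have "4 * \<rho> ^ 3 * norm \<Lambda>' = 4 * (\<rho>\<^sup>2 * (\<rho> * norm \<Lambda>'))"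
      by (simp add: power2_eq_square power3_eq_cube)
    ultimately show ?thesis by linarith
  next
    case False
    then have "?m = 0" using assms(2) power_mono[of \<rho> "norm ?u" 2] by simp
    then show ?thesis using assms(2) by simp
  qed
  ultimately show ?thesis using that by blast
qed

text \<open>The forms that satisfy the Lyapunov inequality at a given parameter are a convex cone, so forms
  found locally in the parameter can be glued with bump functions.\<close>

lemma lyapunov_family:
  fixes f :: "'a::euclidean_space \<times> 'b::euclidean_space \<Rightarrow> 'a"
  assumes f': "\<And>z. (f has_derivative blinfun_apply (f' z)) (at z)"
    and cont: "continuous_on UNIV f'"
    and K: "compact K" "K \<noteq> {}" and e: "continuous_on K e"
    and sink: "\<And>l. l \<in> K \<Longrightarrow> \<exists>B c. bounded_bilinear B \<and> (\<forall>u v. B u v = B v u) \<and> c > 0 \<and>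
      (\<forall>v. (norm v)\<^sup>2 \<le> B v v) \<and> (\<forall>v. B v (f' (e l, l) (v, 0)) \<le> - c * (norm v)\<^sup>2)"
  obtains Q :: "'b \<Rightarrow> 'a \<Rightarrow> 'a \<Rightarrow> real" and a b C \<eta> where "a > 0" "b > 0" "C \<ge> 0" "\<eta> > 0"
    "\<And>\<nu>. bounded_bilinear (Q \<nu>)"
    "\<And>\<nu> v. \<nu> \<in> K \<Longrightarrow> a * (norm v)\<^sup>2 \<le> Q \<nu> v v"
    "\<And>\<nu> u v. \<bar>Q \<nu> u v\<bar> \<le> b * norm u * norm v"
    "\<And>\<nu> x y. \<nu> \<in> K \<Longrightarrow> x \<in> ball (e \<nu>) \<eta> \<Longrightarrow> y \<in> ball (e \<nu>) \<eta> \<Longrightarrow>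
      Q \<nu> (x - y) (f (x, \<nu>) - f (y, \<nu>)) \<le> - (norm (x - y))\<^sup>2"
    "\<And>\<Lambda> \<Lambda>' v v' \<tau> S. (\<Lambda> has_vector_derivative \<Lambda>') (at \<tau> within S) \<Longrightarrow>
      (v has_vector_derivative v') (at \<tau> within S) \<Longrightarrow>
      \<exists>D \<le> C * norm \<Lambda>' * (norm (v \<tau>))\<^sup>2.
        ((\<lambda>t. Q (\<Lambda> t) (v t) (v t)) has_real_derivative D + 2 * Q (\<Lambda> \<tau>) (v \<tau>) v') (at \<tau> within S)"
proof -
  \<comment> \<open>The decay is normalized to -|x - y|^2, so that combining forms needs no
    bookkeeping of rates. The tube is centred at the moving point e \<nu> rather than at e
    l.\<close>
  define good where "good l \<rho> B a \<longleftrightarrow> \<rho> > 0 \<and> bounded_bilinear B \<and> (\<forall>u v. B u v = B v u) \<and> a > 0 \<and>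
      (\<forall>v. a * (norm v)\<^sup>2 \<le> B v v) \<and>
      (\<forall>\<nu>\<in>K \<inter> ball l \<rho>. \<forall>x\<in>ball (e \<nu>) \<rho>. \<forall>y\<in>ball (e \<nu>) \<rho>.
        B (x - y) (f (x, \<nu>) - f (y, \<nu>)) \<le> - (norm (x - y))\<^sup>2)" for l \<rho> B a
  have "\<exists>\<rho> B a. good l \<rho> B a"
    if "l \<in> K" for l
  proof -
    from sink[OF that] obtain B c where B: "bounded_bilinear B" "\<And>u v. B u v = B v u" "c > 0"
      "\<And>v. (norm v)\<^sup>2 \<le> B v v" "\<And>v. B v (f' (e l, l) (v, 0)) \<le> - c * (norm v)\<^sup>2" by blast
    obtain \<rho> where \<rho>: "\<rho> > 0" "\<And>\<nu> x y. \<nu> \<in> ball l \<rho> \<Longrightarrow> x \<in> ball (e l) \<rho> \<Longrightarrow> y \<in> ball (e l) \<rho> \<Longrightarrow>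
        B (x - y) (f (x, \<nu>) - f (y, \<nu>)) \<le> - (c / 2) * (norm (x - y))\<^sup>2"
      using local_contraction[OF f' _ B(1,3,5)] cont by (metis continuous_on_eq_continuous_at open_UNIV UNIV_I)
    obtain \<sigma> where \<sigma>: "\<sigma> > 0" "\<And>\<nu>. \<nu> \<in> K \<Longrightarrow> dist \<nu> l < \<sigma> \<Longrightarrow> dist (e \<nu>) (e l) < \<rho> / 2"
      using e[unfolded continuous_on_iff, rule_format, OF \<open>l \<in> K\<close>, of "\<rho> / 2"] \<open>\<rho> > 0\<close> by auto
    \<comment> \<open>Within distance \<sigma> of l the equilibrium moves by less than \<rho> / 2,
      so a ball of radius r about e \<nu> stays in the ball of radius \<rho> about e l.\<close>
    define r where "r = min \<sigma> (\<rho> / 2)"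
    have r: "r > 0" "r \<le> \<sigma>" "r \<le> \<rho> / 2" using \<sigma>(1) \<rho>(1) by (auto simp: r_def)
    \<comment> \<open>Scaling the form by 2 / c turns the rate c / 2 into 1.\<close>
    show ?thesis unfolding good_def
    proof (rule exI[of _ r], rule exI[of _ "\<lambda>u v. 2 / c * B u v"], rule exI[of _ "2 / c"],
        intro conjI ballI allI)
      show "bounded_bilinear (\<lambda>u v. 2 / c * B u v)"
        using B(1) unfolding bilinear_conv_bounded_bilinear[symmetric]
        by (auto simp: bilinear_def linear_iff algebra_simps add_divide_distrib)
      show "2 / c * (norm v)\<^sup>2 \<le> 2 / c * B v v" for v
        using B(3,4) by (intro mult_left_mono) auto
      fix \<nu> x y assume \<nu>: "\<nu> \<in> K \<inter> ball l r" and xy: "x \<in> ball (e \<nu>) r" "y \<in> ball (e \<nu>) r"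
      have "dist (e \<nu>) (e l) < \<rho> / 2" using \<nu> r by (intro \<sigma>(2)) (auto simp: dist_commute)
      then have "dist (e l) z < \<rho>" if "dist (e \<nu>) z < r" for z
        using that r dist_triangle[of "e l" z "e \<nu>"] by (simp add: dist_commute)
      then have "B (x - y) (f (x, \<nu>) - f (y, \<nu>)) \<le> - (c / 2) * (norm (x - y))\<^sup>2"
        using \<nu> xy r by (intro \<rho>(2)) auto
      then show "2 / c * B (x - y) (f (x, \<nu>) - f (y, \<nu>)) \<le> - (norm (x - y))\<^sup>2"
        using B(3) by (simp add: field_simps)
    qed (use r B(2,3) in auto)
  qed
  then obtain \<rho> B a where good: "\<And>l. l \<in> K \<Longrightarrow> good l (\<rho> l) (B l) (a l)" by metis
  have
    \<rho>: "\<And>l. l \<in> K \<Longrightarrow> \<rho> l > 0" and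
    B: "\<And>l. l \<in> K \<Longrightarrow> bounded_bilinear (B l)" "\<And>l u v. l \<in> K \<Longrightarrow> B l u v = B l v u" and
    a: "\<And>l. l \<in> K \<Longrightarrow> a l > 0" "\<And>l v. l \<in> K \<Longrightarrow> a l * (norm v)\<^sup>2 \<le> B l v v" and
    neg: "\<And>l \<nu> x y. l \<in> K \<Longrightarrow> \<nu> \<in> K \<Longrightarrow> \<nu> \<in> ball l (\<rho> l) \<Longrightarrow> x \<in> ball (e \<nu>) (\<rho> l) \<Longrightarrow>
      y \<in> ball (e \<nu>) (\<rho> l) \<Longrightarrow> B l (x - y) (f (x, \<nu>) - f (y, \<nu>)) \<le> - (norm (x - y))\<^sup>2"
    using good unfolding good_def by blast+
  have "K \<subseteq> (\<Union>l\<in>K. ball l (\<rho> l))" using \<rho> by force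
  then obtain N where N: "N \<subseteq> K" "finite N" "K \<subseteq> (\<Union>l\<in>N. ball l (\<rho> l))"
    using compactE_image[OF K(1), of K "\<lambda>l. ball l (\<rho> l)"] by auto
  have NK: "l \<in> K" if "l \<in> N" for l using that N(1) by auto
  have "N \<noteq> {}" using N(3) K(2) by auto
  define \<phi> where "\<phi> l = bump (\<rho> l) l" for l
  have \<phi>: "\<phi> l \<nu> \<ge> 0" for l \<nu> by (simp add: \<phi>_def bump_nonneg)
  define \<Phi> where "\<Phi> \<nu> = (\<Sum>l\<in>N. \<phi> l \<nu>)" for \<nu>
  have "continuous_on K \<Phi>"
    unfolding \<Phi>_def \<phi>_def by (intro continuous_intros continuous_on_bump)
  then obtain \<nu>\<^sub>0 where \<nu>\<^sub>0: "\<nu>\<^sub>0 \<in> K" "\<And>\<nu>. \<nu> \<in> K \<Longrightarrow> \<Phi> \<nu>\<^sub>0 \<le> \<Phi> \<nu>"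
    using continuous_attains_inf[OF K] by blast
  define m where "m = \<Phi> \<nu>\<^sub>0"
  have "m > 0"
  proof -
    obtain l where l: "l \<in> N" "\<nu>\<^sub>0 \<in> ball l (\<rho> l)" using N(3) \<nu>\<^sub>0(1) by auto
    then show ?thesis
      unfolding m_def \<Phi>_def using N(2) \<phi> bump_pos[OF l(2)] by (intro sum_pos2[of N l]) (auto simp: \<phi>_def)
  qed
  have m: "m \<le> \<Phi> \<nu>" if "\<nu> \<in> K" for \<nu> using \<nu>\<^sub>0(2)[OF that] by (simp add: m_def)
  \<comment> \<open>Dividing by the minimum m of the total weight, instead of by the total weight
    \<Phi>, keeps the weights easy to differentiate. They then sum to at least 1 on K, which only
    strengthens the lower bound and the contraction.\<close>
  define Q where "Q \<nu> u v = (\<Sum>l\<in>N. \<phi> l \<nu> / m * B l u v)" for \<nu> u v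
  define a0 where "a0 = Min (a ` N)"
  have a0: "a0 > 0" "\<And>l. l \<in> N \<Longrightarrow> a0 \<le> a l"
    using N(2) \<open>N \<noteq> {}\<close> a(1) NK by (auto simp: a0_def)
  define \<eta> where "\<eta> = Min (\<rho> ` N)"
  have \<eta>: "\<eta> > 0" "\<And>l. l \<in> N \<Longrightarrow> \<eta> \<le> \<rho> l"
    using N(2) \<open>N \<noteq> {}\<close> \<rho> NK by (auto simp: \<eta>_def)
  have "\<exists>k\<ge>0. \<forall>u v. norm (B l u v) \<le> norm u * norm v * k" if "l \<in> N" for l
    using bounded_bilinear.nonneg_bounded[OF B(1)[OF NK[OF that]]] by blast
  then obtain k where k: "\<And>l. l \<in> N \<Longrightarrow> k l \<ge> 0"
    "\<And>l u v. l \<in> N \<Longrightarrow> norm (B l u v) \<le> norm u * norm v * k l" by metis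
  \<comment> \<open>The summand 1 makes b positive even if all the bounds \<open>k l\<close> are
    0.\<close>
  define b where "b = (\<Sum>l\<in>N. ((\<rho> l)\<^sup>2)\<^sup>2 / m * k l) + 1"
  define C where "C = (\<Sum>l\<in>N. 4 * \<rho> l ^ 3 / m * k l)"
  have \<rho>_nonneg: "\<rho> l \<ge> 0" if "l \<in> N" for l using \<rho>[OF NK[OF that]] by simp
  show ?thesis
  proof (rule that[where Q = Q and a = a0 and b = b and C = C and \<eta> = \<eta>])
    show "a0 > 0" "\<eta> > 0" by fact+
    have "(\<Sum>l\<in>N. ((\<rho> l)\<^sup>2)\<^sup>2 / m * k l) \<ge> 0" using k(1) \<open>m > 0\<close> by (intro sum_nonneg) auto
    then show "b > 0" by (simp add: b_def)
    show "C \<ge> 0" unfolding C_def using k(1) \<open>m > 0\<close> \<rho>_nonneg by (intro sum_nonneg) auto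
    show "bounded_bilinear (Q \<nu>)" for \<nu>
      unfolding bilinear_conv_bounded_bilinear[symmetric]
    proof -
      have "bilinear (B l)" if "l \<in> N" for l
        using B(1)[OF NK[OF that]] by (simp add: bilinear_conv_bounded_bilinear)
      then show "bilinear (Q \<nu>)"
        unfolding bilinear_def linear_iff Q_def
        by (auto simp: sum.distrib[symmetric] sum_distrib_left algebra_simps bilinear_ladd
            bilinear_radd bilinear_lmul bilinear_rmul intro!: sum.cong)
    qed
    show "a0 * (norm v)\<^sup>2 \<le> Q \<nu> v v" if "\<nu> \<in> K" for \<nu> v
    proof -
      have "a0 * (norm v)\<^sup>2 \<le> \<Phi> \<nu> / m * (a0 * (norm v)\<^sup>2)"
        using mult_right_mono[of 1 "\<Phi> \<nu> / m" "a0 * (norm v)\<^sup>2"] m[OF that] \<open>m > 0\<close> a0(1) by simp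
      also have "\<dots> = (\<Sum>l\<in>N. \<phi> l \<nu> / m * (a0 * (norm v)\<^sup>2))"
        by (simp add: \<Phi>_def sum_divide_distrib sum_distrib_right)
      also have "\<dots> \<le> Q \<nu> v v"
        unfolding Q_def
      proof (intro sum_mono mult_left_mono)
        fix l assume "l \<in> N"
        then show "a0 * (norm v)\<^sup>2 \<le> B l v v"
          using a(2)[OF NK, of l v] mult_right_mono[OF a0(2), of l "(norm v)\<^sup>2"] by simp
        show "0 \<le> \<phi> l \<nu> / m" using \<phi> \<open>m > 0\<close> by simp
      qed
      finally show ?thesis .
    qed
    show "\<bar>Q \<nu> u v\<bar> \<le> b * norm u * norm v" for \<nu> u v
    proof -
      have "\<bar>Q \<nu> u v\<bar> \<le> (\<Sum>l\<in>N. ((\<rho> l)\<^sup>2)\<^sup>2 / m * (norm u * norm v * k l))"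
        unfolding Q_def
      proof (rule order_trans[OF sum_abs sum_mono])
        fix l assume "l \<in> N"
        then show "\<bar>\<phi> l \<nu> / m * B l u v\<bar> \<le> ((\<rho> l)\<^sup>2)\<^sup>2 / m * (norm u * norm v * k l)"
          unfolding abs_mult
          using k[of l] bump_le[of "\<rho> l" l \<nu>] bump_nonneg[of "\<rho> l" l \<nu>] \<open>m > 0\<close>
          by (intro mult_mono) (auto simp: \<phi>_def intro!: divide_right_mono)
      qed
      also have "\<dots> = (b - 1) * norm u * norm v"
        by (simp add: b_def sum_distrib_left mult_ac)
      also have "\<dots> \<le> b * norm u * norm v" by (intro mult_right_mono) auto
      finally show ?thesis .
    qed
    show "Q \<nu> (x - y) (f (x, \<nu>) - f (y, \<nu>)) \<le> - (norm (x - y))\<^sup>2"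
      if "\<nu> \<in> K" and xy: "x \<in> ball (e \<nu>) \<eta>" "y \<in> ball (e \<nu>) \<eta>" for \<nu> x y
    proof -
      have "Q \<nu> (x - y) (f (x, \<nu>) - f (y, \<nu>)) \<le> (\<Sum>l\<in>N. \<phi> l \<nu> / m * - (norm (x - y))\<^sup>2)"
        unfolding Q_def
      proof (rule sum_mono)
        fix l assume l: "l \<in> N"
        show "\<phi> l \<nu> / m * B l (x - y) (f (x, \<nu>) - f (y, \<nu>)) \<le> \<phi> l \<nu> / m * - (norm (x - y))\<^sup>2"
        \<comment> \<open>Outside the ball around l no contraction is known for \<open>B l\<close>,
          but its weight vanishes there.\<close>
        proof (cases "\<nu> \<in> ball l (\<rho> l)")
          case True
          then show ?thesis
            using \<phi>[of l \<nu>] \<open>m > 0\<close> l xy \<eta>(2)[OF l] \<open>\<nu> \<in> K\<close>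
            by (intro mult_left_mono neg) (auto intro: NK)
        next
          case False
          then have "\<phi> l \<nu> = 0" unfolding \<phi>_def by (rule bump_eq_0[OF \<rho>[OF NK[OF l]]])
          then show ?thesis by simp
        qed
      qed
      also have "\<dots> = \<Phi> \<nu> / m * - (norm (x - y))\<^sup>2"
        by (simp add: \<Phi>_def sum_divide_distrib sum_distrib_right sum_negf)
      also have "\<dots> \<le> - (norm (x - y))\<^sup>2"
        using mult_right_mono[of 1 "\<Phi> \<nu> / m" "(norm (x - y))\<^sup>2"] m[OF \<open>\<nu> \<in> K\<close>] \<open>m > 0\<close> by simp
      finally show ?thesis .
    qed
    fix \<Lambda> :: "real \<Rightarrow> 'b" and \<Lambda>' and v :: "real \<Rightarrow> 'a" and v' \<tau> S
    assume \<Lambda>: "(\<Lambda> has_vector_derivative \<Lambda>') (at \<tau> within S)"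
      and v: "(v has_vector_derivative v') (at \<tau> within S)"
    have "\<exists>D. ((\<lambda>t. \<phi> l (\<Lambda> t)) has_real_derivative D) (at \<tau> within S) \<and> \<bar>D\<bar> \<le> 4 * \<rho> l ^ 3 * norm \<Lambda>'"
      if "l \<in> N" for l
      unfolding \<phi>_def by (rule bump_derivative[OF \<Lambda> \<rho>[OF NK[OF that]], of l]) blast
    then obtain D where D: "\<And>l. l \<in> N \<Longrightarrow> ((\<lambda>t. \<phi> l (\<Lambda> t)) has_real_derivative D l) (at \<tau> within S)"
      "\<And>l. l \<in> N \<Longrightarrow> \<bar>D l\<bar> \<le> 4 * \<rho> l ^ 3 * norm \<Lambda>'" by metis
    have term_der: "((\<lambda>t. \<phi> l (\<Lambda> t) / m * B l (v t) (v t)) has_real_derivative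
        D l / m * B l (v \<tau>) (v \<tau>) + 2 * (\<phi> l (\<Lambda> \<tau>) / m * B l (v \<tau>) v')) (at \<tau> within S)"
      if l: "l \<in> N" for l
    proof -
      \<comment> \<open>Symmetry of the form merges the two terms of the product rule.\<close>
      have "((\<lambda>t. B l (v t) (v t)) has_real_derivative 2 * B l (v \<tau>) v') (at \<tau> within S)"
        using bounded_bilinear.has_vector_derivative[OF B(1)[OF NK[OF l]] v v] B(2)[OF NK[OF l], of v' "v \<tau>"]
        by (simp add: has_real_derivative_iff_has_vector_derivative)
      from DERIV_mult[OF DERIV_cdivide[OF D(1)[OF l], of m] this] show ?thesis
        by (simp add: algebra_simps)
    qed
    show "\<exists>D \<le> C * norm \<Lambda>' * (norm (v \<tau>))\<^sup>2.
        ((\<lambda>t. Q (\<Lambda> t) (v t) (v t)) has_real_derivative D + 2 * Q (\<Lambda> \<tau>) (v \<tau>) v') (at \<tau> within S)"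
    proof (intro exI[of _ "\<Sum>l\<in>N. D l / m * B l (v \<tau>) (v \<tau>)"] conjI)
      show "((\<lambda>t. Q (\<Lambda> t) (v t) (v t)) has_real_derivative
          (\<Sum>l\<in>N. D l / m * B l (v \<tau>) (v \<tau>)) + 2 * Q (\<Lambda> \<tau>) (v \<tau>) v') (at \<tau> within S)"
        unfolding Q_def sum_distrib_left sum.distrib[symmetric] by (intro DERIV_sum term_der)
      have "(\<Sum>l\<in>N. D l / m * B l (v \<tau>) (v \<tau>)) \<le>
          (\<Sum>l\<in>N. 4 * \<rho> l ^ 3 * norm \<Lambda>' / m * (norm (v \<tau>) * norm (v \<tau>) * k l))"
      proof (rule sum_mono)
        fix l assume l: "l \<in> N"
        have "\<bar>D l / m * B l (v \<tau>) (v \<tau>)\<bar> \<le> 4 * \<rho> l ^ 3 * norm \<Lambda>' / m * (norm (v \<tau>) * norm (v \<tau>) * k l)"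
          unfolding abs_mult using k[OF l] D(2)[OF l] \<open>m > 0\<close> \<rho>_nonneg[OF l]
          by (intro mult_mono) (auto intro!: divide_right_mono)
        then show "D l / m * B l (v \<tau>) (v \<tau>) \<le> 4 * \<rho> l ^ 3 * norm \<Lambda>' / m * (norm (v \<tau>) * norm (v \<tau>) * k l)"
          by (rule order_trans[OF abs_ge_self])
      qed
      also have "\<dots> = C * norm \<Lambda>' * (norm (v \<tau>))\<^sup>2"
        by (simp add: C_def sum_distrib_left power2_eq_square mult_ac)
      finally show "(\<Sum>l\<in>N. D l / m * B l (v \<tau>) (v \<tau>)) \<le> C * norm \<Lambda>' * (norm (v \<tau>))\<^sup>2" .
    qed
  qed
qed

section \<open>Attracting tubes\<close>

text \<open>The rate \<open>r\<close> is absent here, so a, b, C and \<eta> are fixed before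
  \<open>r\<close> is chosen small. In \<open>chain\<close>, D is the contribution of the time
  dependence of the form. Closure of J under later times covers both a half-line and the whole
  line.\<close>

locale attracting_tube =
  fixes F :: "real \<Rightarrow> 'a::euclidean_space \<Rightarrow> 'a"
    and p p' :: "real \<Rightarrow> 'a"
    and Q :: "real \<Rightarrow> 'a \<Rightarrow> 'a \<Rightarrow> real"
    and J :: "real set"
    and a b C \<eta> :: real
  assumes pos: "a > 0" "b > 0" "C \<ge> 0" "\<eta> > 0"
    and J_up: "s \<in> J \<Longrightarrow> t \<ge> s \<Longrightarrow> t \<in> J"
    and bilinear: "bounded_bilinear (Q \<tau>)"
    and lower: "\<tau> \<in> J \<Longrightarrow> a * (norm v)\<^sup>2 \<le> Q \<tau> v v"
    and upper: "\<bar>Q \<tau> u v\<bar> \<le> b * norm u * norm v"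
    and contracting: "\<tau> \<in> J \<Longrightarrow> x \<in> ball (p \<tau>) \<eta> \<Longrightarrow> y \<in> ball (p \<tau>) \<eta> \<Longrightarrow>
      Q \<tau> (x - y) (F \<tau> x - F \<tau> y) \<le> - (norm (x - y))\<^sup>2"
    and equilibrium: "\<tau> \<in> J \<Longrightarrow> F \<tau> (p \<tau>) = 0"
    and p_derivative: "\<tau> \<in> J \<Longrightarrow> (p has_vector_derivative p' \<tau>) (at \<tau> within J)"
    and chain: "\<tau> \<in> J \<Longrightarrow> S \<subseteq> J \<Longrightarrow> (w has_vector_derivative w') (at \<tau> within S) \<Longrightarrow>
      \<exists>D \<le> C * (norm (w \<tau>))\<^sup>2.
        ((\<lambda>t. Q t (w t) (w t)) has_real_derivative D + 2 * Q \<tau> (w \<tau>) w') (at \<tau> within S)"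
begin

text \<open>Here w measures how far y fails to be a solution: it is p' for y = p and 0 for a second
  solution. Let n be the norm of x - y. Of the decay -2 n^2 / r, the changing form takes n^2 / (2 r)
  by \<open>r * C \<le> 1 / 2\<close>, and the cross term with w another n^2 / (2 r). The remaining
  -n^2 / r is at most the energy divided by -r b, and the residual 2 r b^2 M^2 becomes the level 2
  r^2 b^3 M^2.\<close>

lemma energy_decay:
  assumes r: "r > 0" "r * C \<le> 1 / 2" and "s \<le> t" "s \<in> J"
    and in_tube: "\<And>u. u \<in> {s..t} \<Longrightarrow> x u \<in> ball (p u) \<eta>" "\<And>u. u \<in> {s..t} \<Longrightarrow> y u \<in> ball (p u) \<eta>"
    and der: "\<And>u. u \<in> {s..t} \<Longrightarrow> ((\<lambda>u. x u - y u) has_vector_derivative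
      (F u (x u) - F u (y u)) /\<^sub>R r - w u) (at u within {s..t})"
    and w: "\<And>u. u \<in> {s..t} \<Longrightarrow> norm (w u) \<le> M"
  shows "Q t (x t - y t) (x t - y t) - 2 * r\<^sup>2 * b ^ 3 * M\<^sup>2 \<le>
    exp (- (t - s) / (r * b)) * (Q s (x s - y s) (x s - y s) - 2 * r\<^sup>2 * b ^ 3 * M\<^sup>2)"
proof -
  let ?v = "\<lambda>u. x u - y u"
  let ?v' = "\<lambda>u. (F u (x u) - F u (y u)) /\<^sub>R r - w u"
  let ?V = "\<lambda>u. Q u (?v u) (?v u)"
  have J: "u \<in> J" if "u \<in> {s..t}" for u using that J_up[OF \<open>s \<in> J\<close>] by auto
  have "\<exists>V'. (?V has_real_derivative V') (at u within {s..t}) \<and>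
      V' \<le> - 1 / (r * b) * (?V u - 2 * r\<^sup>2 * b ^ 3 * M\<^sup>2)" if u: "u \<in> {s..t}" for u
  proof -
    interpret Q: bounded_bilinear "Q u" by (rule bilinear)
    obtain D where D: "D \<le> C * (norm (?v u))\<^sup>2"
      "(?V has_real_derivative D + 2 * Q u (?v u) (?v' u)) (at u within {s..t})"
      using chain[OF J[OF u] subsetI[OF J] der[OF u]] by blast
    let ?n = "norm (?v u)"
    have "Q u (?v u) (?v' u) = Q u (?v u) (F u (x u) - F u (y u)) / r - Q u (?v u) (w u)"
      unfolding Q.diff_right[of "?v u" "(F u (x u) - F u (y u)) /\<^sub>R r" "w u"] Q.scaleR_right
      by (simp add: divide_inverse mult.commute)
    moreover have "Q u (?v u) (F u (x u) - F u (y u)) / r \<le> - ?n\<^sup>2 / r"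
      using contracting[OF J[OF u] in_tube[OF u]] \<open>r > 0\<close> by (intro divide_right_mono) auto
    moreover have "- Q u (?v u) (w u) \<le> ?n\<^sup>2 / (4 * r) + r * b\<^sup>2 * M\<^sup>2"
    proof -
      have "M \<ge> 0" using w[OF u] norm_ge_zero order_trans by blast
      have "- Q u (?v u) (w u) \<le> b * ?n * norm (w u)" using upper[of u "?v u" "w u"] by linarith
      also have "\<dots> \<le> b * ?n * M" using w[OF u] pos by (intro mult_left_mono) auto
      also have "\<dots> \<le> ?n\<^sup>2 / (4 * r) + r * b\<^sup>2 * M\<^sup>2"
      proof -
        have "0 \<le> (?n - 2 * r * b * M)\<^sup>2 / (4 * r)" using \<open>r > 0\<close> by simp
        also have "\<dots> = ?n\<^sup>2 / (4 * r) + r * b\<^sup>2 * M\<^sup>2 - b * ?n * M"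
          using \<open>r > 0\<close> by (simp add: field_simps power2_eq_square)
        finally show ?thesis by simp
      qed
      finally show ?thesis .
    qed
    moreover have "C * ?n\<^sup>2 \<le> ?n\<^sup>2 / (2 * r)"
    proof -
      have "C \<le> 1 / (2 * r)" using r by (simp add: field_simps)
      from mult_right_mono[OF this, of "?n\<^sup>2"] show ?thesis by simp
    qed
    moreover have "?V u / (r * b) \<le> ?n\<^sup>2 / r"
    proof -
      have "?V u \<le> b * ?n\<^sup>2" using upper[of u "?v u" "?v u"] by (simp add: power2_eq_square mult.assoc)
      then show ?thesis using \<open>r > 0\<close> pos by (simp add: field_simps)
    qed
    moreover have "- 1 / (r * b) * (?V u - 2 * r\<^sup>2 * b ^ 3 * M\<^sup>2) = - (?V u / (r * b)) + 2 * (r * b\<^sup>2 * M\<^sup>2)"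
      using \<open>r > 0\<close> pos by (simp add: field_simps power2_eq_square power3_eq_cube)
    moreover have "?n\<^sup>2 / (4 * r) = ?n\<^sup>2 / r / 4" "?n\<^sup>2 / (2 * r) = ?n\<^sup>2 / r / 2" by simp_all
    ultimately have "D + 2 * Q u (?v u) (?v' u) \<le> - 1 / (r * b) * (?V u - 2 * r\<^sup>2 * b ^ 3 * M\<^sup>2)"
      using D(1) by linarith
    then show ?thesis using D(2) by blast
  qed
  then have "\<forall>u\<in>{s..t}. \<exists>V'. (?V has_real_derivative V') (at u within {s..t}) \<and>
      V' \<le> - 1 / (r * b) * (?V u - 2 * r\<^sup>2 * b ^ 3 * M\<^sup>2)" by blast
  from bchoice[OF this] obtain V' where V': "\<And>u. u \<in> {s..t} \<Longrightarrow> (?V has_real_derivative V' u) (at u within {s..t})"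
    "\<And>u. u \<in> {s..t} \<Longrightarrow> V' u \<le> - 1 / (r * b) * (?V u - 2 * r\<^sup>2 * b ^ 3 * M\<^sup>2)"
    by blast
  have "- 1 / (r * b) * (t - s) = - (t - s) / (r * b)"
    by (simp only: times_divide_eq_left mult_minus1)
  with gronwall[OF \<open>s \<le> t\<close> V'] show ?thesis by (simp only:)
qed

definition V :: "(real \<Rightarrow> 'a) \<Rightarrow> real \<Rightarrow> real"
  where "V x u = Q u (x u - p u) (x u - p u)"

lemma V_upper: "V x u \<le> b * (norm (x u - p u))\<^sup>2"
  using upper[of u "x u - p u" "x u - p u"] by (simp add: V_def power2_eq_square mult.assoc)

lemma V_lower: "u \<in> J \<Longrightarrow> a * (norm (x u - p u))\<^sup>2 \<le> V x u"
  unfolding V_def by (rule lower)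

lemma V_decay:
  assumes r: "r > 0" "r * C \<le> 1 / 2" and "s \<le> t" "s \<in> J"
    and in_tube: "\<And>u. u \<in> {s..t} \<Longrightarrow> x u \<in> ball (p u) \<eta>"
    and der: "\<And>u. u \<in> {s..t} \<Longrightarrow> (x has_vector_derivative F u (x u) /\<^sub>R r) (at u within {s..t})"
    and p': "\<And>u. u \<in> {s..t} \<Longrightarrow> norm (p' u) \<le> M"
  shows "V x t - 2 * r\<^sup>2 * b ^ 3 * M\<^sup>2 \<le> exp (- (t - s) / (r * b)) * (V x s - 2 * r\<^sup>2 * b ^ 3 * M\<^sup>2)"
  unfolding V_def
proof (rule energy_decay[OF r \<open>s \<le> t\<close> \<open>s \<in> J\<close> in_tube _ _ p'])
  fix u assume u: "u \<in> {s..t}"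
  then have "u \<in> J" "{s..t} \<subseteq> J" using J_up[OF \<open>s \<in> J\<close>] by auto
  then show "((\<lambda>u. x u - p u) has_vector_derivative (F u (x u) - F u (p u)) /\<^sub>R r - p' u) (at u within {s..t})"
    using has_vector_derivative_diff[OF der[OF u] has_vector_derivative_within_subset[OF p_derivative]]
    by (simp add: equilibrium)
qed (use pos in auto)

text \<open>Without drift the level in \<open>energy_decay\<close> is 0. Going from the energy back
  to the norm costs sqrt (b / a) and halves the rate.\<close>

lemma pair_decay:
  assumes r: "r > 0" "r * C \<le> 1 / 2" and "s \<le> t" "s \<in> J"
    and in_tube: "\<And>u. u \<in> {s..t} \<Longrightarrow> x u \<in> ball (p u) \<eta>" "\<And>u. u \<in> {s..t} \<Longrightarrow> y u \<in> ball (p u) \<eta>"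
    and der: "\<And>u. u \<in> {s..t} \<Longrightarrow> (x has_vector_derivative F u (x u) /\<^sub>R r) (at u within {s..t})"
      "\<And>u. u \<in> {s..t} \<Longrightarrow> (y has_vector_derivative F u (y u) /\<^sub>R r) (at u within {s..t})"
  shows "norm (x t - y t) \<le> sqrt (b / a) * exp (- (t - s) / (2 * r * b)) * norm (x s - y s)"
proof -
  have "Q t (x t - y t) (x t - y t) - 2 * r\<^sup>2 * b ^ 3 * 0\<^sup>2 \<le>
    exp (- (t - s) / (r * b)) * (Q s (x s - y s) (x s - y s) - 2 * r\<^sup>2 * b ^ 3 * 0\<^sup>2)"
    by (rule energy_decay[OF r \<open>s \<le> t\<close> \<open>s \<in> J\<close> in_tube, where w = "\<lambda>_. 0"])
      (use has_vector_derivative_diff[OF der] in \<open>auto simp: scaleR_diff_right\<close>)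
  then have "Q t (x t - y t) (x t - y t) \<le> exp (- (t - s) / (r * b)) * Q s (x s - y s) (x s - y s)"
    by simp
  also have "\<dots> \<le> exp (- (t - s) / (r * b)) * (b * (norm (x s - y s))\<^sup>2)"
    using upper[of s "x s - y s" "x s - y s"]
    by (intro mult_left_mono) (auto simp: power2_eq_square mult.assoc)
  finally have "a * (norm (x t - y t))\<^sup>2 \<le> exp (- (t - s) / (r * b)) * (b * (norm (x s - y s))\<^sup>2)"
    using lower[of t "x t - y t"] J_up[OF \<open>s \<in> J\<close> \<open>s \<le> t\<close>] by linarith
  then have "(norm (x t - y t))\<^sup>2 \<le> b / a * exp (- (t - s) / (r * b)) * (norm (x s - y s))\<^sup>2"
    using pos by (simp add: field_simps)
  also have "exp (- (t - s) / (r * b)) = (exp (- (t - s) / (2 * r * b)))\<^sup>2"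
    by (simp add: power2_eq_square field_simps flip: exp_add)
  also have "b / a = (sqrt (b / a))\<^sup>2" using pos by simp
  finally show ?thesis
    unfolding power_mult_distrib[symmetric]
    by (rule power2_le_imp_le) (use pos in auto)
qed

text \<open>The field G need agree with the true one only inside the tube, so global solutions of a
  truncated system can be used before it is known that they stay inside. As \<kappa> lies above the
  residual level, the energy cannot climb to \<kappa>;
  \<open>\<kappa> \<le> a * \<epsilon>\<^sup>2\<close> converts this into distance.\<close>

lemma trapped:
  assumes r: "r > 0" "r * C \<le> 1 / 2" "2 * r\<^sup>2 * b ^ 3 * M\<^sup>2 < \<kappa>" and \<kappa>: "\<kappa> \<le> a * \<epsilon>\<^sup>2" "0 < \<epsilon>" "\<epsilon> < \<eta>"
    and "s \<in> J" and p': "\<And>u. u \<in> J \<Longrightarrow> norm (p' u) \<le> M"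
    and der: "\<And>u. u \<ge> s \<Longrightarrow> (x has_vector_derivative G u (x u) /\<^sub>R r) (at u within {s..})"
    and G: "\<And>u z. u \<in> J \<Longrightarrow> z \<in> ball (p u) \<eta> \<Longrightarrow> G u z = F u z"
    and "V x s < \<kappa>" "t \<ge> s"
  shows "norm (x t - p t) < \<epsilon>"
proof -
  have J: "u \<in> J" if "u \<ge> s" for u using J_up[OF \<open>s \<in> J\<close> that] .
  have close: "norm (x u - p u) \<le> \<epsilon>" if "V x u \<le> \<kappa>" "u \<ge> s" for u
  proof (rule power2_le_imp_le)
    have "a * (norm (x u - p u))\<^sup>2 \<le> a * \<epsilon>\<^sup>2"
      using V_lower[OF J[OF that(2)], of x] that(1) \<kappa>(1) by linarith
    then show "(norm (x u - p u))\<^sup>2 \<le> \<epsilon>\<^sup>2" using pos by simp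
  qed (use \<kappa> in simp)
  have "V x t < \<kappa>"
  proof (rule continuous_trap[where s = s and t = t and \<phi> = "V x" and \<kappa> = \<kappa>])
    show "continuous_on {s..} (V x)"
      unfolding continuous_on_eq_continuous_within
    proof
      fix u assume "u \<in> {s..}"
      then have u: "u \<in> J" "{s..} \<subseteq> J" "u \<ge> s" using J by auto
      have "((\<lambda>u. x u - p u) has_vector_derivative G u (x u) /\<^sub>R r - p' u) (at u within {s..})"
        using u by (intro has_vector_derivative_diff der has_vector_derivative_within_subset[OF p_derivative])
      from chain[OF u(1,2) this] show "continuous (at u within {s..}) (V x)"
        unfolding V_def[abs_def] by (blast intro: DERIV_continuous)
    qed
    fix t assume t: "t > s" "\<forall>u\<in>{s..t}. V x u \<le> \<kappa>"
    have tube: "x u \<in> ball (p u) \<eta>" if "u \<in> {s..t}" for u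
      using close[of u] t(2) that \<kappa>(3) by (auto simp: dist_norm norm_minus_commute)
    let ?\<theta> = "2 * r\<^sup>2 * b ^ 3 * M\<^sup>2"
    have "V x t - ?\<theta> \<le> exp (- (t - s) / (r * b)) * (V x s - ?\<theta>)"
    proof (rule V_decay[OF r(1,2) less_imp_le[OF t(1)] \<open>s \<in> J\<close> tube _ p'])
      fix u assume u: "u \<in> {s..t}"
      then show "(x has_vector_derivative F u (x u) /\<^sub>R r) (at u within {s..t})"
        using has_vector_derivative_within_subset[OF der[of u], of "{s..t}"] G[OF J tube, of u] by auto
      show "u \<in> J" using u J by auto
    qed
    \<comment> \<open>The start may lie above or below the residual level; either way the excess at
      t is at most the positive part of the excess at s.\<close>
    also have "\<dots> \<le> max 0 (V x s - ?\<theta>)"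
    proof (cases "V x s - ?\<theta> \<ge> 0")
      case True
      have "exp (- (t - s) / (r * b)) \<le> 1"
        unfolding exp_le_one_iff using t(1) r(1) pos by (intro divide_nonpos_pos) auto
      from mult_right_mono[OF this True] show ?thesis by simp
    next
      case False
      then have "exp (- (t - s) / (r * b)) * (V x s - ?\<theta>) \<le> 0" by (intro mult_nonneg_nonpos) auto
      then show ?thesis by simp
    qed
    also have "\<dots> < \<kappa> - ?\<theta>" using r(3) \<open>V x s < \<kappa>\<close> by simp
    finally show "V x t < \<kappa>" by simp
  qed fact+
  show ?thesis
  proof (rule power2_less_imp_less)
    have "a * (norm (x t - p t))\<^sup>2 < a * \<epsilon>\<^sup>2"
      using V_lower[OF J[OF \<open>t \<ge> s\<close>], of x] \<open>V x t < \<kappa>\<close> \<kappa>(1) by linarith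
    then show "(norm (x t - p t))\<^sup>2 < \<epsilon>\<^sup>2" using pos by simp
  qed (use \<kappa> in simp)
qed

lemma V_bounded:
  assumes "x u \<in> ball (p u) \<eta>"
  shows "V x u \<le> b * \<eta>\<^sup>2"
proof -
  have "b * (norm (x u - p u))\<^sup>2 \<le> b * \<eta>\<^sup>2"
    using assms pos by (intro mult_left_mono power_mono) (auto simp: dist_norm norm_minus_commute)
  then show ?thesis using V_upper[of x u] by linarith
qed

lemma tendsto_of_V:
  assumes ev: "\<And>\<epsilon>. \<epsilon> > 0 \<Longrightarrow> \<forall>\<^sub>F t in F0. t \<in> J \<and> V x t < 2 * \<epsilon>"
  shows "((\<lambda>t. x t - p t) \<longlongrightarrow> 0) F0"
proof (rule tendstoI)
  fix d :: real assume "d > 0"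
  then have "a * d\<^sup>2 / 2 > 0" using pos by simp
  from ev[OF this] show "\<forall>\<^sub>F t in F0. dist (x t - p t) 0 < d"
  proof (rule eventually_mono)
    fix t assume "t \<in> J \<and> V x t < 2 * (a * d\<^sup>2 / 2)"
    then have "a * (norm (x t - p t))\<^sup>2 < a * d\<^sup>2" using V_lower[of t x] by auto
    then have "(norm (x t - p t))\<^sup>2 < d\<^sup>2" using pos by simp
    then show "dist (x t - p t) 0 < d" using \<open>d > 0\<close> power2_less_imp_less[of "norm (x t - p t)" d] by simp
  qed
qed

text \<open>M is the drift bound at which the residual level of \<open>V_decay\<close> is a
  prescribed \<epsilon>; convergence of p' to 0 then provides this bound near infinity.\<close>

lemma small_rate:
  assumes "r > 0" "\<epsilon> > 0"
  obtains M where "M > 0" "2 * r\<^sup>2 * b ^ 3 * M\<^sup>2 = \<epsilon>"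
proof
  show "sqrt (\<epsilon> / (2 * r\<^sup>2 * b ^ 3)) > 0" using assms pos by simp
  show "2 * r\<^sup>2 * b ^ 3 * (sqrt (\<epsilon> / (2 * r\<^sup>2 * b ^ 3)))\<^sup>2 = \<epsilon>" using assms pos by simp
qed

text \<open>Once |p'| is below M the residual level is \<epsilon>, and the energy present at that
  moment is forgotten exponentially.\<close>

lemma tracks_at_top:
  assumes r: "r > 0" "r * C \<le> 1 / 2" and "s \<in> J"
    and in_tube: "\<And>u. u \<ge> s \<Longrightarrow> x u \<in> ball (p u) \<eta>"
    and der: "\<And>u. u \<ge> s \<Longrightarrow> (x has_vector_derivative F u (x u) /\<^sub>R r) (at u within {s..})"
    and p': "(p' \<longlongrightarrow> 0) at_top"
  shows "((\<lambda>t. x t - p t) \<longlongrightarrow> 0) at_top"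
proof (rule tendsto_of_V)
  fix \<epsilon> :: real assume "\<epsilon> > 0"
  obtain M where M: "M > 0" "2 * r\<^sup>2 * b ^ 3 * M\<^sup>2 = \<epsilon>" by (rule small_rate[OF r(1) \<open>\<epsilon> > 0\<close>])
  have "\<forall>\<^sub>F t in at_top. norm (p' t) < M" using tendstoD[OF p' M(1)] by simp
  then obtain t1 where t1: "\<And>u. u \<ge> t1 \<Longrightarrow> norm (p' u) < M" by (auto simp: eventually_at_top_linorder)
  define t0 where "t0 = max s t1"
  have t0: "t0 \<ge> s" "t0 \<ge> t1" "t0 \<in> J" using J_up[OF \<open>s \<in> J\<close>] by (auto simp: t0_def)
  have decay: "V x t - \<epsilon> \<le> exp (- (t - t0) / (r * b)) * (V x t0 - \<epsilon>)" if "t \<ge> t0" for t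
    unfolding M(2)[symmetric]
    by (rule V_decay[OF r that t0(3)])
      (use t0 in_tube in \<open>auto intro!: less_imp_le[OF t1] has_vector_derivative_within_subset[OF der]\<close>)
  have "((\<lambda>t. exp (- (t - t0) / (r * b)) * (V x t0 - \<epsilon>)) \<longlongrightarrow> 0 * (V x t0 - \<epsilon>)) at_top"
  proof (intro tendsto_mult tendsto_const filterlim_compose[OF exp_at_bot])
    have "\<forall>\<^sub>F t in at_top. - (t - t0) / (r * b) \<le> Z" for Z
      by (rule eventually_mono[OF eventually_ge_at_top[of "t0 - Z * (r * b)"]])
        (use r pos in \<open>simp add: field_simps\<close>)
    then show "filterlim (\<lambda>t. - (t - t0) / (r * b)) at_bot at_top" by (simp add: filterlim_at_bot)
  qed
  then have "\<forall>\<^sub>F t in at_top. exp (- (t - t0) / (r * b)) * (V x t0 - \<epsilon>) < \<epsilon>"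
    using \<open>\<epsilon> > 0\<close> by (intro order_tendstoD(2)) auto
  then show "\<forall>\<^sub>F t in at_top. t \<in> J \<and> V x t < 2 * \<epsilon>"
    using eventually_ge_at_top[of t0]
  proof eventually_elim
    case (elim t)
    then show ?case using decay[of t] J_up[OF t0(3), of t] by simp
  qed
qed

lemma exp_decay_at_bot:
  assumes "r > 0"
  shows "((\<lambda>s. exp (- (t - s) / (r * b))) \<longlongrightarrow> 0) at_bot"
proof (rule filterlim_compose[OF exp_at_bot])
  have "\<forall>\<^sub>F s in at_bot. - (t - s) / (r * b) \<le> Z" for Z
    by (rule eventually_mono[OF eventually_le_at_bot[of "t + Z * (r * b)"]])
      (use assms pos in \<open>simp add: field_simps\<close>)
  then show "filterlim (\<lambda>s. - (t - s) / (r * b)) at_bot at_bot" by (simp add: filterlim_at_bot)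
qed

text \<open>Decay runs forward in time, so t is held in the region of small drift while the start s
  goes to minus infinity: the energy at s is at most b \<eta>^2, and its weight tends to 0.\<close>

lemma tracks_at_bot:
  assumes r: "r > 0" "r * C \<le> 1 / 2" and J: "J = UNIV"
    and in_tube: "\<And>u. u \<le> T \<Longrightarrow> x u \<in> ball (p u) \<eta>"
    and der: "\<And>s u. s \<le> u \<Longrightarrow> u \<le> T \<Longrightarrow> (x has_vector_derivative F u (x u) /\<^sub>R r) (at u within {s..T})"
    and p': "(p' \<longlongrightarrow> 0) at_bot"
  shows "((\<lambda>t. x t - p t) \<longlongrightarrow> 0) at_bot"
proof (rule tendsto_of_V)
  fix \<epsilon> :: real assume "\<epsilon> > 0"
  obtain M where M: "M > 0" "2 * r\<^sup>2 * b ^ 3 * M\<^sup>2 = \<epsilon>" by (rule small_rate[OF r(1) \<open>\<epsilon> > 0\<close>])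
  have "\<forall>\<^sub>F t in at_bot. norm (p' t) < M" using tendstoD[OF p' M(1)] by simp
  then obtain t1 where t1: "\<And>u. u \<le> t1 \<Longrightarrow> norm (p' u) < M" by (auto simp: eventually_at_bot_linorder)
  have "V x t \<le> \<epsilon>" if t: "t \<le> min T t1" for t
  proof -
    have "V x t - \<epsilon> \<le> exp (- (t - s) / (r * b)) * (b * \<eta>\<^sup>2)" if "s \<le> t" for s
    proof -
      have "V x t - \<epsilon> \<le> exp (- (t - s) / (r * b)) * (V x s - \<epsilon>)"
        unfolding M(2)[symmetric]
        by (rule V_decay[OF r that])
          (use t J in_tube in \<open>auto intro!: less_imp_le[OF t1] has_vector_derivative_within_subset[OF der[of s]]\<close>)
      also have "\<dots> \<le> exp (- (t - s) / (r * b)) * (b * \<eta>\<^sup>2)"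
        using V_bounded[of x s] in_tube[of s] that t \<open>\<epsilon> > 0\<close> by (intro mult_left_mono) auto
      finally show ?thesis .
    qed
    then have "\<forall>\<^sub>F s in at_bot. V x t - \<epsilon> \<le> exp (- (t - s) / (r * b)) * (b * \<eta>\<^sup>2)"
      by (rule eventually_mono[OF eventually_le_at_bot])
    moreover have "((\<lambda>s. exp (- (t - s) / (r * b)) * (b * \<eta>\<^sup>2)) \<longlongrightarrow> 0 * (b * \<eta>\<^sup>2)) at_bot"
      by (intro tendsto_mult tendsto_const exp_decay_at_bot r)
    ultimately have "V x t - \<epsilon> \<le> 0 * (b * \<eta>\<^sup>2)" by (intro tendsto_lowerbound) auto
    then show ?thesis by simp
  qed
  then have "\<And>t. t \<le> min T t1 \<Longrightarrow> t \<in> J \<and> V x t < 2 * \<epsilon>" using J \<open>\<epsilon> > 0\<close> by force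
  then show "\<forall>\<^sub>F t in at_bot. t \<in> J \<and> V x t < 2 * \<epsilon>"
    by (rule eventually_mono[OF eventually_le_at_bot])
qed

section \<open>Solutions in the tube for all past times\<close>

text \<open>Two such solutions are at most 2 \<eta> apart at every s, and the contraction from s to
  t becomes arbitrarily strong as s goes to minus infinity.\<close>

lemma unique_past:
  assumes r: "r > 0" "r * C \<le> 1 / 2" and J: "J = UNIV"
    and in_tube: "\<And>u. u \<le> t \<Longrightarrow> x u \<in> ball (p u) \<eta>" "\<And>u. u \<le> t \<Longrightarrow> y u \<in> ball (p u) \<eta>"
    and der: "\<And>s u. s \<le> u \<Longrightarrow> u \<le> t \<Longrightarrow> (x has_vector_derivative F u (x u) /\<^sub>R r) (at u within {s..t})"
      "\<And>s u. s \<le> u \<Longrightarrow> u \<le> t \<Longrightarrow> (y has_vector_derivative F u (y u) /\<^sub>R r) (at u within {s..t})"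
  shows "x t = y t"
proof -
  have "norm (x t - y t) \<le> sqrt (b / a) * exp (- (t - s) / (2 * r * b)) * (2 * \<eta>)" if "s \<le> t" for s
  proof -
    have "norm (x t - y t) \<le> sqrt (b / a) * exp (- (t - s) / (2 * r * b)) * norm (x s - y s)"
      by (rule pair_decay[OF r that]) (use J in_tube der in auto)
    also have "\<dots> \<le> sqrt (b / a) * exp (- (t - s) / (2 * r * b)) * (2 * \<eta>)"
    proof (intro mult_left_mono)
      show "norm (x s - y s) \<le> 2 * \<eta>"
        using in_tube(1)[of s] in_tube(2)[of s] that dist_triangle2[of "x s" "y s" "p s"]
        by (simp add: dist_norm[symmetric] dist_commute)
    qed (use pos in auto)
    finally show ?thesis .
  qed
  then have "\<forall>\<^sub>F s in at_bot. norm (x t - y t) \<le> sqrt (b / a) * exp (- (t - s) / (2 * r * b)) * (2 * \<eta>)"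
    by (rule eventually_mono[OF eventually_le_at_bot])
  moreover have "((\<lambda>s. sqrt (b / a) * exp (- (t - s) / (2 * r * b)) * (2 * \<eta>)) \<longlongrightarrow>
      sqrt (b / a) * 0 * (2 * \<eta>)) at_bot"
    using exp_decay_at_bot[of "2 * r" t] r by (intro tendsto_mult tendsto_const) auto
  ultimately have "norm (x t - y t) \<le> sqrt (b / a) * 0 * (2 * \<eta>)" by (intro tendsto_lowerbound) auto
  then show ?thesis by simp
qed

text \<open>For m \<ge> n, contraction from -n to t makes X m and X n close at t, whence a Cauchy
  sequence at each time. The Lipschitz bound for G carries locally uniform convergence over to the
  derivatives, so the limit is again a solution.\<close>

lemma pullback_solution_exists:
  assumes r: "r > 0" "r * C \<le> 1 / 2" "2 * r\<^sup>2 * b ^ 3 * M\<^sup>2 < \<kappa>"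
    and \<kappa>: "\<kappa> \<le> a * \<epsilon>\<^sup>2" "0 < \<epsilon>" "\<epsilon> < \<eta>" and J: "J = UNIV"
    and p': "\<And>u. norm (p' u) \<le> M"
    and G: "\<And>u z. z \<in> ball (p u) \<eta> \<Longrightarrow> G u z = F u z"
    and lip: "\<And>u x y. norm (G u x - G u y) \<le> L * norm (x - y)"
    and solvable: "\<And>s y. \<exists>x. x s = y \<and>
      (\<forall>u\<ge>s. (x has_vector_derivative G u (x u) /\<^sub>R r) (at u within {s..}))"
  obtains x where "\<And>t. (x has_vector_derivative G t (x t) /\<^sub>R r) (at t)" "\<And>t. norm (x t - p t) \<le> \<epsilon>"
proof -
  have "\<forall>n. \<exists>x. x (- real n) = p (- real n) \<and>
      (\<forall>u\<ge>- real n. (x has_vector_derivative G u (x u) /\<^sub>R r) (at u within {- real n..}))"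
    using solvable by blast
  from choice[OF this] obtain X where X0: "\<And>n. X n (- real n) = p (- real n)"
    and X: "\<And>n u. u \<ge> - real n \<Longrightarrow> (X n has_vector_derivative G u (X n u) /\<^sub>R r) (at u within {- real n..})"
    by blast
  have "\<kappa> > 0" by (rule le_less_trans[OF _ r(3)]) (use pos in simp)
  have V0: "V (X n) (- real n) = 0" for n
    using bounded_bilinear.zero_left[OF bilinear] by (simp add: V_def X0)
  have close: "norm (X n t - p t) < \<epsilon>" if "t \<ge> - real n" for n t
    by (rule trapped[OF r \<kappa>, where G = G and s = "- real n"])
      (use J p' X G V0 \<open>\<kappa> > 0\<close> that in auto)
  then have tube: "X n t \<in> ball (p t) \<eta>" if "t \<ge> - real n" for n t
    using that \<kappa>(3) less_trans by (fastforce simp: dist_norm norm_minus_commute)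
  have X_F: "(X m has_vector_derivative F u (X m u) /\<^sub>R r) (at u within {- real n..t})"
    if "n \<le> m" "u \<in> {- real n..t}" for m n u t
  proof -
    have u: "u \<ge> - real m" using that by auto
    have "{- real n..t} \<subseteq> {- real m..}" using that(1) by auto
    from has_vector_derivative_within_subset[OF X[OF u] this] show ?thesis
      using G[OF tube[OF u]] by simp
  qed
  \<comment> \<open>The factor 2 \<eta> generously bounds the distance at time -n: X n is on the
    sink there and X m is within \<epsilon> < \<eta> of it.\<close>
  define E where "E n t = sqrt (b / a) * exp (- (t - - real n) / (2 * r * b)) * (2 * \<eta>)" for n t
  have E: "norm (X m t - X n t) \<le> E n t" if "n \<le> m" "t \<ge> - real n" for m n t
  proof -
    have "norm (X m t - X n t) \<le> sqrt (b / a) * exp (- (t - - real n) / (2 * r * b)) *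
        norm (X m (- real n) - X n (- real n))"
      by (rule pair_decay[OF r(1,2) that(2)]) (use J tube X_F that in auto)
    also have "\<dots> \<le> E n t"
      unfolding E_def
    proof (intro mult_left_mono)
      have "norm (X m (- real n) - p (- real n)) < \<epsilon>" by (rule close) (use that in auto)
      then show "norm (X m (- real n) - X n (- real n)) \<le> 2 * \<eta>" using \<kappa> by (simp add: X0)
    qed (use pos in auto)
    finally show ?thesis .
  qed
  have E_lim: "(\<lambda>n. E n t) \<longlonglongrightarrow> 0" for t
  proof -
    have "filterlim (\<lambda>n. - real n) at_bot sequentially"
      by (simp add: filterlim_uminus_at_bot filterlim_real_sequentially)
    from filterlim_compose[OF exp_decay_at_bot[of "2 * r" t] this] r(1)
    have "(\<lambda>n. exp (- (t - - real n) / (2 * r * b))) \<longlonglongrightarrow> 0" by simp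
    from tendsto_mult[OF tendsto_mult[OF tendsto_const[of "sqrt (b / a)"] this] tendsto_const[of "2 * \<eta>"]]
    show ?thesis unfolding E_def by simp
  qed
  have "convergent (\<lambda>n. X n t)" for t
    unfolding Cauchy_convergent_iff[symmetric] Cauchy_altdef2
  proof (intro allI impI)
    fix d :: real assume "d > 0"
    have "\<forall>\<^sub>F n in sequentially. E n t < d" by (rule order_tendstoD(2)[OF E_lim \<open>d > 0\<close>])
    moreover have "\<forall>\<^sub>F n in sequentially. - t \<le> real n"
      using filterlim_real_sequentially by (simp add: filterlim_at_top)
    ultimately have "\<forall>\<^sub>F n in sequentially. E n t < d \<and> - t \<le> real n" by (rule eventually_conj)
    then obtain N where "E N t < d" "- t \<le> real N"
      by (auto simp: eventually_sequentially)
    then show "\<exists>N. \<forall>n\<ge>N. dist (X n t) (X N t) < d"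
      using E[of N _ t] by (intro exI[of _ N]) (force simp: dist_norm)
  qed
  then obtain x where x: "\<And>t. (\<lambda>n. X n t) \<longlonglongrightarrow> x t" unfolding convergent_def by metis
  have Ex: "norm (x t - X n t) \<le> E n t" if "t \<ge> - real n" for n t
  proof (rule tendsto_upperbound)
    show "(\<lambda>m. norm (X m t - X n t)) \<longlonglongrightarrow> norm (x t - X n t)" by (intro tendsto_intros x)
    show "\<forall>\<^sub>F m in sequentially. norm (X m t - X n t) \<le> E n t"
      by (rule eventually_mono[OF eventually_ge_at_top[of n]]) (use E that in auto)
  qed simp
  show ?thesis
  proof
    fix t
    show "norm (x t - p t) \<le> \<epsilon>"
    proof (rule tendsto_upperbound)
      show "(\<lambda>m. norm (X m t - p t)) \<longlonglongrightarrow> norm (x t - p t)" by (intro tendsto_intros x)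
      have "\<forall>\<^sub>F n in sequentially. - t \<le> real n"
        using filterlim_real_sequentially by (simp add: filterlim_at_top)
      then show "\<forall>\<^sub>F m in sequentially. norm (X m t - p t) \<le> \<epsilon>"
        by (rule eventually_mono) (use close in \<open>force intro: less_imp_le\<close>)
    qed simp
    \<comment> \<open>Indices from N on have starting times at most -N, so all these solutions live
      on S, an open set containing t.\<close>
    obtain N :: nat where N: "- t < real N" using reals_Archimedean2 by blast
    define S where "S = {- real N<..}"
    have "\<exists>g. \<forall>u\<in>S. (\<lambda>n. X (n + N) u) \<longlonglongrightarrow> g u \<and>
        (g has_derivative (\<lambda>h. h *\<^sub>R (G u (x u) /\<^sub>R r))) (at u within S)"
    proof (rule has_derivative_sequence[where f' = "\<lambda>n u h. h *\<^sub>R (G u (X (n + N) u) /\<^sub>R r)" and l = "x t"])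
      show "convex S" by (simp add: S_def)
      show "t \<in> S" using N by (simp add: S_def)
      show "(\<lambda>n. X (n + N) t) \<longlonglongrightarrow> x t" by (rule LIMSEQ_ignore_initial_segment[OF x])
      show "(X (n + N) has_derivative (\<lambda>h. h *\<^sub>R (G u (X (n + N) u) /\<^sub>R r))) (at u within S)"
        if "u \<in> S" for n u
      proof -
        have "(X (n + N) has_vector_derivative G u (X (n + N) u) /\<^sub>R r) (at u within S)"
          by (rule has_vector_derivative_within_subset[OF X]) (use that in \<open>auto simp: S_def\<close>)
        then show ?thesis by (simp add: has_vector_derivative_def)
      qed
      fix d :: real assume "d > 0"
      \<comment> \<open>No sign of L is given: two distinct points force it to be nonnegative, and
        for equal points both sides of the bound are 0.\<close>
      have "L \<ge> 0" if "x \<noteq> y" for x y :: 'a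
        using order_trans[OF norm_ge_zero lip[of 0 x y]] that by (simp add: zero_le_mult_iff)
      then have L: "norm (G u x - G u y) \<le> \<bar>L\<bar> * norm (x - y)" for u x y
        using lip[of u x y] by (cases "x = y") auto
      have "(\<lambda>n. \<bar>L\<bar> / r * E (n + N) (- real N)) \<longlonglongrightarrow> \<bar>L\<bar> / r * 0"
        by (intro tendsto_mult tendsto_const LIMSEQ_ignore_initial_segment[OF E_lim])
      then have "\<forall>\<^sub>F n in sequentially. \<bar>L\<bar> / r * E (n + N) (- real N) < d"
        using \<open>d > 0\<close> by (intro order_tendstoD(2)) auto
      then show "\<forall>\<^sub>F n in sequentially. \<forall>u\<in>S. \<forall>h.
          norm (h *\<^sub>R (G u (X (n + N) u) /\<^sub>R r) - h *\<^sub>R (G u (x u) /\<^sub>R r)) \<le> d * norm h"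
      proof (rule eventually_mono, intro ballI allI)
        fix n u and h :: real assume n: "\<bar>L\<bar> / r * E (n + N) (- real N) < d" and u: "u \<in> S"
        have "norm (x u - X (n + N) u) \<le> E (n + N) u" by (rule Ex) (use u in \<open>auto simp: S_def\<close>)
        \<comment> \<open>E decreases in time, so its value at the left end -N bounds it on all of
          S; this is the uniformity needed to differentiate the limit.\<close>
        also have "\<dots> \<le> E (n + N) (- real N)"
        proof -
          have "- (u - - real (n + N)) / (2 * r * b) \<le> - (- real N - - real (n + N)) / (2 * r * b)"
            using u pos r(1) by (intro divide_right_mono) (auto simp: S_def)
          then show ?thesis
            unfolding E_def using pos by (intro mult_right_mono mult_left_mono) auto
        qed
        finally have "\<bar>L\<bar> / r * norm (x u - X (n + N) u) \<le> \<bar>L\<bar> / r * E (n + N) (- real N)"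
          using r(1) by (intro mult_left_mono) auto
        moreover have "norm (G u (X (n + N) u) - G u (x u)) / r \<le> \<bar>L\<bar> * norm (X (n + N) u - x u) / r"
          using r(1) by (intro divide_right_mono L) auto
        ultimately have "norm (G u (X (n + N) u) - G u (x u)) / r \<le> d"
          using n by (simp add: norm_minus_commute)
        then have "\<bar>h\<bar> * (norm (G u (X (n + N) u) - G u (x u)) / r) \<le> \<bar>h\<bar> * d"
          by (intro mult_left_mono) auto
        then show "norm (h *\<^sub>R (G u (X (n + N) u) /\<^sub>R r) - h *\<^sub>R (G u (x u) /\<^sub>R r)) \<le> d * norm h"
          using r(1) by (simp add: divide_inverse abs_mult mult_ac flip: scaleR_diff_right)
      qed
    qed
    then obtain g where g: "\<And>u. u \<in> S \<Longrightarrow> (\<lambda>n. X (n + N) u) \<longlonglongrightarrow> g u"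
      "\<And>u. u \<in> S \<Longrightarrow> (g has_derivative (\<lambda>h. h *\<^sub>R (G u (x u) /\<^sub>R r))) (at u within S)" by blast
    have "g u = x u" if "u \<in> S" for u
      using LIMSEQ_unique[OF g(1)[OF that] LIMSEQ_ignore_initial_segment[OF x]] .
    moreover have "open S" "t \<in> S" using N by (auto simp: S_def)
    moreover have "(g has_derivative (\<lambda>h. h *\<^sub>R (G t (x t) /\<^sub>R r))) (at t)"
      using g(2)[OF \<open>t \<in> S\<close>] by (simp only: at_within_open[OF \<open>t \<in> S\<close> \<open>open S\<close>])
    ultimately show "(x has_vector_derivative G t (x t) /\<^sub>R r) (at t)"
      unfolding has_vector_derivative_def by (blast intro: has_derivative_transform_within_open)
  qed
qed

end

section \<open>Moving sinks\<close>

lemma bounded_at_top_limit: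
  fixes h :: "real \<Rightarrow> 'a::real_normed_vector"
  assumes "continuous_on UNIV h" "(h \<longlongrightarrow> l) at_top"
  shows "bounded (h ` {s..})"
proof -
  have "\<forall>\<^sub>F t in at_top. dist (h t) l < 1" using tendstoD[OF assms(2), of 1] by simp
  then obtain T where T: "\<And>t. t \<ge> T \<Longrightarrow> dist (h t) l < 1" by (auto simp: eventually_at_top_linorder)
  have "bounded (h ` {s..T} \<union> ball l 1)"
    using compact_continuous_image[OF continuous_on_subset[OF assms(1)], of "{s..T}"]
    by (simp add: compact_imp_bounded)
  moreover have "h ` {s..} \<subseteq> h ` {s..T} \<union> ball l 1"
  proof
    fix y assume "y \<in> h ` {s..}"
    then obtain t where "y = h t" "t \<ge> s" by auto
    then show "y \<in> h ` {s..T} \<union> ball l 1"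
      using T[of t] by (cases "t \<ge> T") (auto simp: dist_commute)
  qed
  ultimately show ?thesis by (rule bounded_subset)
qed

lemma bounded_at_bot_limit:
  fixes h :: "real \<Rightarrow> 'a::real_normed_vector"
  assumes "continuous_on UNIV h" "(h \<longlongrightarrow> l) at_bot"
  shows "bounded (h ` {..s})"
proof -
  have "continuous_on UNIV (\<lambda>t. h (- t))"
    by (rule continuous_on_compose2[OF assms(1)]) (auto intro: continuous_intros)
  moreover have "((\<lambda>t. h (- t)) \<longlongrightarrow> l) at_top"
    using assms(2) by (simp add: filterlim_at_bot_mirror)
  ultimately have "bounded ((\<lambda>t. h (- t)) ` {- s..})" by (rule bounded_at_top_limit)
  moreover have "(\<lambda>t. h (- t)) ` {- s..} = h ` (uminus ` {- s..})" by (simp only: image_image)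
  ultimately show ?thesis by simp
qed

lemma tendsto_0_of_exp_rate:
  fixes g :: "real \<Rightarrow> 'a::real_normed_vector"
  assumes "((\<lambda>t. g t /\<^sub>R exp (\<beta> t)) \<longlongrightarrow> L) F" "filterlim \<beta> at_bot F"
  shows "(g \<longlongrightarrow> 0) F"
proof -
  have "((\<lambda>t. exp (\<beta> t)) \<longlongrightarrow> 0) F" by (rule filterlim_compose[OF exp_at_bot assms(2)])
  from tendsto_scaleR[OF this assms(1)] show ?thesis by simp
qed

text \<open>Connects the matrix whose eigenvalues are controlled with the total derivative f', whose
  joint continuity in state and parameter drives \<open>local_contraction\<close>.\<close>

lemma jacobian_partial:
  fixes f :: "(real^'n) \<times> (real^'d) \<Rightarrow> real^'n"
  assumes "(f has_derivative blinfun_apply D) (at (p, l))"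
  shows "jacobian (\<lambda>x. f (x, l)) (at p) *v h = D (h, 0)"
proof -
  have "((\<lambda>x. (x, l)) has_derivative (\<lambda>h. (h, 0))) (at p)"
    by (intro has_derivative_Pair has_derivative_ident has_derivative_const)
  from has_derivative_compose[OF this assms]
  have der: "((\<lambda>x. f (x, l)) has_derivative (\<lambda>h. D (h, 0))) (at p)" .
  then have "frechet_derivative (\<lambda>x. f (x, l)) (at p) = (\<lambda>h. D (h, 0))"
    by (rule frechet_derivative_at[symmetric])
  then show ?thesis
    unfolding jacobian_def using has_derivative_linear[OF der] by (simp add: matrix_works)
qed

lemma hyperbolic_sink_lyapunov_form:
  fixes f :: "(real^'n) \<times> (real^'d) \<Rightarrow> real^'n"
  assumes "hyperbolic_sink f l p" "(f has_derivative blinfun_apply D) (at (p, l))"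
  shows "\<exists>B c. bounded_bilinear B \<and> (\<forall>u v. B u v = B v u) \<and> c > 0 \<and>
    (\<forall>v. (norm v)\<^sup>2 \<le> B v v) \<and> (\<forall>v. B v (D (v, 0)) \<le> - c * (norm v)\<^sup>2)"
proof -
  have "\<forall>\<mu>\<in>complex_eigenvalues (jacobian (\<lambda>x. f (x, l)) (at p)). Re \<mu> < 0"
    using assms(1) by (simp add: hyperbolic_sink_def)
  from lyapunov_form[OF this] show ?thesis
    unfolding jacobian_partial[OF assms(2)] by metis
qed

lemma C1_on_continuous_on:
  assumes "C1_on e S"
  shows "continuous_on S e"
proof -
  obtain U h h' where h: "S \<subseteq> U" "\<forall>l\<in>S. h l = e l"
    "\<forall>l\<in>U. (h has_derivative blinfun_apply (h' l)) (at l)"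
    using assms unfolding C1_on_def by blast
  have "continuous_on U h"
    by (rule has_derivative_continuous_on[OF has_derivative_at_withinI[OF h(3)[rule_format]]])
  then have "continuous_on S h" using h(1) by (rule continuous_on_subset)
  then show ?thesis by (rule continuous_on_eq) (use h(2) in blast)
qed

lemma moving_sink_continuous_on:
  "moving_sink f \<Lambda> e I \<Longrightarrow> continuous_on (closure (\<Lambda> ` I)) e"
  unfolding moving_sink_def by (blast intro: C1_on_continuous_on)

text \<open>The speed bound M1 turns the factor |\<Lambda>'| in the variation of the form into the
  constant C M1. The drift keeps its factor |\<Lambda>'|, since it has to vanish together with
  it.\<close>

lemma moving_sink_tube:
  fixes f :: "(real^'n) \<times> (real^'d) \<Rightarrow> real^'n" and \<Lambda> :: "real \<Rightarrow> real^'d"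
  assumes f': "\<And>z. (f has_derivative blinfun_apply (f' z)) (at z)" "continuous_on UNIV f'"
    and \<Lambda>': "\<And>\<tau>. (\<Lambda> has_vector_derivative \<Lambda>' \<tau>) (at \<tau>)"
    and bound: "\<And>\<tau>. \<tau> \<in> J \<Longrightarrow> norm (\<Lambda>' \<tau>) \<le> M1"
    and J: "\<And>s t. s \<in> J \<Longrightarrow> t \<ge> s \<Longrightarrow> t \<in> J" "J \<noteq> {}"
    and K: "compact (closure (\<Lambda> ` I))" "\<And>\<tau>. \<tau> \<in> J \<Longrightarrow> \<Lambda> \<tau> \<in> closure (\<Lambda> ` I)"
    and sink: "moving_sink f \<Lambda> e I"
  obtains Q p' a b C \<eta> M2 where
    "attracting_tube (\<lambda>\<tau> x. f (x, \<Lambda> \<tau>)) (\<lambda>\<tau>. e (\<Lambda> \<tau>)) p' Q J a b C \<eta>"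
    "\<And>\<tau>. \<tau> \<in> J \<Longrightarrow> norm (p' \<tau>) \<le> M2 * norm (\<Lambda>' \<tau>)" "M2 \<ge> 0"
proof -
  let ?K = "closure (\<Lambda> ` I)"
  have hyp: "hyperbolic_sink f l (e l)" if "l \<in> ?K" for l
    using sink that by (simp add: moving_sink_def)
  obtain \<tau>1 where "\<tau>1 \<in> J" using J by auto
  then have "M1 \<ge> 0" using bound norm_ge_zero order_trans by blast
  have "?K \<noteq> {}" using K(2)[OF \<open>\<tau>1 \<in> J\<close>] by auto
  obtain U h h' where h: "?K \<subseteq> U" "\<forall>l\<in>?K. h l = e l"
    "\<forall>l\<in>U. (h has_derivative blinfun_apply (h' l)) (at l)"
    "continuous_on U (h' :: real^'d \<Rightarrow> (real^'d) \<Rightarrow>\<^sub>L (real^'n))"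
    using sink unfolding moving_sink_def C1_on_def by blast
  have "bounded (h' ` ?K)"
    by (intro compact_imp_bounded compact_continuous_image continuous_on_subset[OF h(4)] h K)
  then obtain M2 where M2: "M2 > 0" "\<And>l. l \<in> ?K \<Longrightarrow> norm (h' l) \<le> M2"
    unfolding bounded_pos by auto
  define p' where "p' \<tau> = blinfun_apply (h' (\<Lambda> \<tau>)) (\<Lambda>' \<tau>)" for \<tau>
  show ?thesis
  proof (rule lyapunov_family[OF f' K(1) \<open>?K \<noteq> {}\<close> moving_sink_continuous_on[OF sink]
      hyperbolic_sink_lyapunov_form[OF hyp f'(1)]])
    fix Q :: "real^'d \<Rightarrow> real^'n \<Rightarrow> real^'n \<Rightarrow> real" and a b C \<eta>
    assume Q: "a > 0" "b > 0" "C \<ge> 0" "\<eta> > 0"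
    "\<And>\<nu>. bounded_bilinear (Q \<nu>)"
    "\<And>\<nu> v. \<nu> \<in> ?K \<Longrightarrow> a * (norm v)\<^sup>2 \<le> Q \<nu> v v"
    "\<And>\<nu> u v. \<bar>Q \<nu> u v\<bar> \<le> b * norm u * norm v"
    "\<And>\<nu> x y. \<nu> \<in> ?K \<Longrightarrow> x \<in> ball (e \<nu>) \<eta> \<Longrightarrow> y \<in> ball (e \<nu>) \<eta> \<Longrightarrow>
      Q \<nu> (x - y) (f (x, \<nu>) - f (y, \<nu>)) \<le> - (norm (x - y))\<^sup>2"
    and chain: "\<And>\<Lambda> \<Lambda>' v v' \<tau> S. (\<Lambda> has_vector_derivative \<Lambda>') (at \<tau> within S) \<Longrightarrow>
      (v has_vector_derivative v') (at \<tau> within S) \<Longrightarrow>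
      \<exists>D \<le> C * norm \<Lambda>' * (norm (v \<tau>))\<^sup>2.
        ((\<lambda>t. Q (\<Lambda> t) (v t) (v t)) has_real_derivative D + 2 * Q (\<Lambda> \<tau>) (v \<tau>) v') (at \<tau> within S)"
    show thesis
    proof
      show "norm (p' \<tau>) \<le> M2 * norm (\<Lambda>' \<tau>)" if "\<tau> \<in> J" for \<tau>
        unfolding p'_def using norm_blinfun[of "h' (\<Lambda> \<tau>)" "\<Lambda>' \<tau>"] M2(2)[OF K(2)[OF that]]
        by (meson mult_right_mono norm_ge_zero order_trans)
      show "M2 \<ge> 0" using M2(1) by simp
      show "attracting_tube (\<lambda>\<tau> x. f (x, \<Lambda> \<tau>)) (\<lambda>\<tau>. e (\<Lambda> \<tau>)) p' (\<lambda>\<tau>. Q (\<Lambda> \<tau>)) J a b (C * M1) \<eta>"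
      proof (rule attracting_tube.intro)
        show "f (e (\<Lambda> \<tau>), \<Lambda> \<tau>) = 0" if "\<tau> \<in> J" for \<tau>
          using hyp[OF K(2)[OF that]] by (simp add: hyperbolic_sink_def)
        show "((\<lambda>\<tau>. e (\<Lambda> \<tau>)) has_vector_derivative p' \<tau>) (at \<tau> within J)" if "\<tau> \<in> J" for \<tau>
        proof -
          \<comment> \<open>Only the extension h of e is differentiable on an open set; the curves e
            \<circ> \<Lambda> and h \<circ> \<Lambda> coincide on J.\<close>
          have "((\<lambda>\<tau>. h (\<Lambda> \<tau>)) has_vector_derivative p' \<tau>) (at \<tau> within J)"
            using vector_derivative_diff_chain_within[OF has_vector_derivative_at_within[OF \<Lambda>']
                has_derivative_at_withinI[OF h(3)[rule_format]], of \<tau>] K(2)[OF that] h(1)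
            by (auto simp: o_def p'_def)
          then show ?thesis
            by (rule has_vector_derivative_transform[OF that, rotated]) (use h(2) K(2) in auto)
        qed
        show "\<exists>D\<le>C * M1 * (norm (v \<tau>))\<^sup>2.
            ((\<lambda>t. Q (\<Lambda> t) (v t) (v t)) has_real_derivative D + 2 * Q (\<Lambda> \<tau>) (v \<tau>) v') (at \<tau> within S)"
          if "\<tau> \<in> J" and v: "(v has_vector_derivative v') (at \<tau> within S)" for \<tau> S v v'
        proof -
          obtain D where D: "D \<le> C * norm (\<Lambda>' \<tau>) * (norm (v \<tau>))\<^sup>2"
            "((\<lambda>t. Q (\<Lambda> t) (v t) (v t)) has_real_derivative D + 2 * Q (\<Lambda> \<tau>) (v \<tau>) v') (at \<tau> within S)"
            using chain[OF has_vector_derivative_at_within[OF \<Lambda>'] v] by blast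
          have "C * norm (\<Lambda>' \<tau>) * (norm (v \<tau>))\<^sup>2 \<le> C * M1 * (norm (v \<tau>))\<^sup>2"
            using bound[OF \<open>\<tau> \<in> J\<close>] Q(3) by (intro mult_right_mono mult_left_mono) auto
          with D show ?thesis by (intro exI[of _ D]) auto
        qed
        show "C * M1 \<ge> 0" using Q(3) \<open>M1 \<ge> 0\<close> by simp
        show "s \<in> J \<Longrightarrow> t \<ge> s \<Longrightarrow> t \<in> J" for s t by (rule J(1))
      qed (use Q K(2) in auto)
    qed
  qed
qed

section \<open>Truncated vector fields and their solutions\<close>

text \<open>The projection onto a ball is bounded, nonexpansive and the identity inside, so
  composing f with it gives a globally Lipschitz field without any smoothing.\<close>

abbreviation cutoff :: "real \<Rightarrow> 'a::euclidean_space \<Rightarrow> 'a"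
  where "cutoff R \<equiv> closest_point (cball 0 R)"

lemma cutoff_mem: "R \<ge> 0 \<Longrightarrow> cutoff R x \<in> cball 0 R"
  by (rule closest_point_in_set) auto

lemma cutoff_eq: "norm x \<le> R \<Longrightarrow> cutoff R x = x"
  by (rule closest_point_self) simp

text \<open>The derivative is bounded on the compact product, the mean value inequality applies
  because the ball is convex, and the projection does not expand distances.\<close>

lemma cutoff_bounds:
  fixes f :: "'a::euclidean_space \<times> 'b::euclidean_space \<Rightarrow> 'a"
  assumes f': "\<And>z. (f has_derivative blinfun_apply (f' z)) (at z)" "continuous_on UNIV f'"
    and "compact K" "R \<ge> 0"
  obtains L M where "L > 0"
    "\<And>l x y. l \<in> K \<Longrightarrow> norm (f (cutoff R x, l) - f (cutoff R y, l)) \<le> L * norm (x - y)"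
    "\<And>l x. l \<in> K \<Longrightarrow> norm (f (cutoff R x, l)) \<le> M"
proof -
  let ?S = "cball (0::'a) R"
  have comp: "compact (?S \<times> K)" using assms(3) by (intro compact_Times) auto
  have "bounded (f' ` (?S \<times> K))" "bounded (f ` (?S \<times> K))"
    by (intro compact_imp_bounded compact_continuous_image comp continuous_on_subset[OF f'(2)]
        has_derivative_continuous_on[OF has_derivative_at_withinI[OF f'(1)]] subset_UNIV)+
  then obtain L M where L: "L > 0" "\<And>z. z \<in> ?S \<times> K \<Longrightarrow> norm (f' z) \<le> L"
    and M: "\<And>z. z \<in> ?S \<times> K \<Longrightarrow> norm (f z) \<le> M"
    unfolding bounded_pos by (metis imageI)
  show ?thesis
  proof
    show "L > 0" by fact
    show "norm (f (cutoff R x, l)) \<le> M" if "l \<in> K" for l x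
      using cutoff_mem[OF \<open>R \<ge> 0\<close>, of x] that by (intro M) auto
    show "norm (f (cutoff R x, l) - f (cutoff R y, l)) \<le> L * norm (x - y)" if "l \<in> K" for l x y
    proof -
      have "norm (f (cutoff R x, l) - f (cutoff R y, l)) \<le> L * norm (cutoff R x - cutoff R y)"
      proof (rule differentiable_bound[where f = "\<lambda>x. f (x, l)" and f' = "\<lambda>x h. f' (x, l) (h, 0)"])
        fix z assume z: "z \<in> ?S"
        have "((\<lambda>x. (x, l)) has_derivative (\<lambda>h. (h, 0))) (at z within ?S)"
          by (intro has_derivative_Pair has_derivative_ident has_derivative_const)
        from has_derivative_compose[OF this f'(1)]
        show "((\<lambda>x. f (x, l)) has_derivative (\<lambda>h. f' (z, l) (h, 0))) (at z within ?S)" .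
        show "onorm (\<lambda>h. f' (z, l) (h, 0)) \<le> L"
        proof (rule onorm_le)
          fix h
          show "norm (f' (z, l) (h, 0)) \<le> L * norm h"
            using norm_blinfun[of "f' (z, l)" "(h, 0)"] L(2)[of "(z, l)"] z that
            by (simp add: norm_Pair) (meson mult_right_mono norm_ge_zero order_trans)
        qed
      qed (use cutoff_mem[OF \<open>R \<ge> 0\<close>] in auto)
      also have "\<dots> \<le> L * norm (x - y)"
        using closest_point_lipschitz[of ?S x y] \<open>L > 0\<close> \<open>R \<ge> 0\<close>
        by (intro mult_left_mono) (auto simp: dist_norm)
      finally show ?thesis .
    qed
  qed
qed

text \<open>Solutions for f itself may escape in finite time; the truncated field is bounded and
  Lipschitz uniformly in t, as \<open>picard\<close> requires.\<close>

lemma cutoff_solution: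
  fixes f :: "'a::euclidean_space \<times> 'b::euclidean_space \<Rightarrow> 'a"
  assumes f': "\<And>z. (f has_derivative blinfun_apply (f' z)) (at z)" "continuous_on UNIV f'"
    and "compact K" "R \<ge> 0" "r > 0" and \<Lambda>: "continuous_on UNIV \<Lambda>" "\<And>t. t \<ge> s \<Longrightarrow> \<Lambda> t \<in> K"
  shows "\<exists>x. x s = y \<and>
    (\<forall>t\<ge>s. (x has_vector_derivative f (cutoff R (x t), \<Lambda> t) /\<^sub>R r) (at t within {s..}))"
proof -
  obtain L M where LM: "L > 0"
    "\<And>l x y. l \<in> K \<Longrightarrow> norm (f (cutoff R x, l) - f (cutoff R y, l)) \<le> L * norm (x - y)"
    "\<And>l x. l \<in> K \<Longrightarrow> norm (f (cutoff R x, l)) \<le> M"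
    by (rule cutoff_bounds[OF f' assms(3,4)]) blast
  have cont_f: "continuous_on UNIV f"
    by (rule has_derivative_continuous_on[OF has_derivative_at_withinI[OF f'(1)]])
  obtain x where "x s = y"
    "\<And>t. t \<ge> s \<Longrightarrow> (x has_vector_derivative f (cutoff R (x t), \<Lambda> t) /\<^sub>R r) (at t within {s..})"
  proof (rule picard[where G = "\<lambda>t x. f (cutoff R x, \<Lambda> t) /\<^sub>R r" and L = "L / r" and M = "M / r" and s = s and y = y])
    fix u :: "real \<Rightarrow> 'a" assume "continuous_on {s..} u"
    then show "continuous_on {s..} (\<lambda>t. f (cutoff R (u t), \<Lambda> t) /\<^sub>R r)"
      using \<open>R \<ge> 0\<close>
      by (intro continuous_intros continuous_on_compose2[OF cont_f]
          continuous_on_compose2[OF continuous_on_closest_point[of "cball 0 R" UNIV]]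
          continuous_on_subset[OF \<Lambda>(1)]) auto
  next
    fix t x y assume "t \<ge> s"
    from divide_right_mono[OF LM(2)[OF \<Lambda>(2)[OF this], of x y], of r] \<open>r > 0\<close>
    show "norm (f (cutoff R x, \<Lambda> t) /\<^sub>R r - f (cutoff R y, \<Lambda> t) /\<^sub>R r) \<le> L / r * norm (x - y)"
      by (simp add: divide_inverse mult_ac flip: scaleR_diff_right)
  next
    fix t x assume "t \<ge> s"
    from divide_right_mono[OF LM(3)[OF \<Lambda>(2)[OF this], of x], of r] \<open>r > 0\<close>
    show "norm (f (cutoff R x, \<Lambda> t) /\<^sub>R r) \<le> M / r"
      by (simp add: divide_inverse mult_ac)
  qed (use LM \<open>r > 0\<close> in auto)
  then show ?thesis by blast
qed

lemma solves_nonaut_subset: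
  "solves_nonaut f \<Lambda> r J x \<Longrightarrow> J' \<subseteq> J \<Longrightarrow> solves_nonaut f \<Lambda> r J' x"
  unfolding solves_nonaut_def by (blast intro: has_vector_derivative_within_subset)

text \<open>A ball containing both trajectories makes the truncation invisible along them, so its
  Lipschitz constant is available and \<open>norm_growth\<close> applies with error 0.\<close>

lemma solves_nonaut_unique:
  assumes f': "\<And>z. (f has_derivative blinfun_apply (f' z)) (at z)" "continuous_on UNIV f'"
    and \<Lambda>: "continuous_on UNIV \<Lambda>" and "r > 0" "s \<le> t"
    and x: "solves_nonaut f \<Lambda> r {s..t} x" and y: "solves_nonaut f \<Lambda> r {s..t} y" and "x s = y s"
  shows "x t = y t"
proof -
  have "continuous_on {s..t} x" "continuous_on {s..t} y"
    using x y unfolding solves_nonaut_def continuous_on_eq_continuous_within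
    by (blast intro: has_vector_derivative_continuous)+
  then have "bounded (x ` {s..t} \<union> y ` {s..t})"
    by (auto intro!: compact_imp_bounded compact_continuous_image)
  then obtain R where R: "R > 0" "\<And>u. u \<in> {s..t} \<Longrightarrow> norm (x u) \<le> R" "\<And>u. u \<in> {s..t} \<Longrightarrow> norm (y u) \<le> R"
    unfolding bounded_pos by blast
  have "compact (\<Lambda> ` {s..t})"
    by (intro compact_continuous_image continuous_on_subset[OF \<Lambda>]) auto
  then obtain L where L: "L > 0"
    "\<And>l x y. l \<in> \<Lambda> ` {s..t} \<Longrightarrow> norm (f (cutoff R x, l) - f (cutoff R y, l)) \<le> L * norm (x - y)"
    by (rule cutoff_bounds[OF f' _ less_imp_le[OF R(1)]]) blast
  have "(norm (x t - y t))\<^sup>2 + 0\<^sup>2 \<le> exp ((2 * (L / r) + 1) * (t - s)) * ((norm (x s - y s))\<^sup>2 + 0\<^sup>2)"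
  proof (rule norm_growth[OF \<open>s \<le> t\<close>, where v' = "\<lambda>u. f (x u, \<Lambda> u) /\<^sub>R r - f (y u, \<Lambda> u) /\<^sub>R r"])
    fix u assume u: "u \<in> {s..t}"
    then show "((\<lambda>u. x u - y u) has_vector_derivative f (x u, \<Lambda> u) /\<^sub>R r - f (y u, \<Lambda> u) /\<^sub>R r) (at u within {s..t})"
      using x y unfolding solves_nonaut_def by (intro has_vector_derivative_diff) auto
    have "norm (f (x u, \<Lambda> u) - f (y u, \<Lambda> u)) \<le> L * norm (x u - y u)"
      using L(2)[of "\<Lambda> u" "x u" "y u"] u R by (simp add: cutoff_eq)
    from divide_right_mono[OF this, of r] \<open>r > 0\<close>
    show "norm (f (x u, \<Lambda> u) /\<^sub>R r - f (y u, \<Lambda> u) /\<^sub>R r) \<le> L / r * norm (x u - y u) + 0"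
      by (simp add: divide_inverse mult_ac flip: scaleR_diff_right)
  qed (use L \<open>r > 0\<close> in auto)
  then show ?thesis using \<open>x s = y s\<close> by simp
qed

section \<open>Tracking\<close>

lemma follows_frozen:
  fixes f :: "(real^'n) \<times> (real^'d) \<Rightarrow> real^'n"
  assumes f': "\<And>z. (f has_derivative blinfun_apply (f' z)) (at z)" "continuous_on UNIV f'"
    and K: "compact K" "\<And>t. t \<ge> \<tau>0 \<Longrightarrow> \<Lambda> t \<in> K" and \<Lambda>: "continuous_on UNIV \<Lambda>"
    and X: "solves_frozen f (\<Lambda> \<tau>0) {0..} X" and "T \<ge> 0" "\<omega> > 0"
    and R: "\<And>t. t \<in> {0..T} \<Longrightarrow> norm (X t) \<le> R"
  shows "\<forall>\<^sub>F r in at_right 0. \<forall>x. x \<tau>0 = X 0 \<and>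
    (\<forall>t\<ge>\<tau>0. (x has_vector_derivative f (cutoff R (x t), \<Lambda> t) /\<^sub>R r) (at t within {\<tau>0..})) \<longrightarrow>
    (\<forall>t\<in>{0..T}. norm (x (\<tau>0 + r * t) - X t) \<le> \<omega>)"
proof -
  have "R \<ge> 0" using order_trans[OF norm_ge_zero R[of 0]] \<open>T \<ge> 0\<close> by simp
  obtain L where L: "L > 0"
    "\<And>l x y. l \<in> K \<Longrightarrow> norm (f (cutoff R x, l) - f (cutoff R y, l)) \<le> L * norm (x - y)"
    by (rule cutoff_bounds[OF f' K(1) \<open>R \<ge> 0\<close>]) blast
  define q where "q = exp ((2 * L + 1) * T)"
  have "q > 0" by (simp add: q_def)
  \<comment> \<open>Squared errors grow by at most q over the time T, so an error \<epsilon> in the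
    field costs at most \<omega> in the solution.\<close>
  define \<epsilon> where "\<epsilon> = \<omega> / sqrt q"
  have \<epsilon>: "\<epsilon> > 0" "q * \<epsilon>\<^sup>2 = \<omega>\<^sup>2"
    using \<open>q > 0\<close> \<open>\<omega> > 0\<close> by (auto simp: \<epsilon>_def power_divide)
  have "uniformly_continuous_on (cball 0 R \<times> K) f"
    by (intro compact_uniformly_continuous compact_Times K(1) compact_cball
        has_derivative_continuous_on[OF has_derivative_at_withinI[OF f'(1)]])
  then obtain d where d: "d > 0"
    "\<And>z z'. z \<in> cball 0 R \<times> K \<Longrightarrow> z' \<in> cball 0 R \<times> K \<Longrightarrow> dist z' z < d \<Longrightarrow> dist (f z') (f z) < \<epsilon>"
    using \<epsilon>(1) unfolding uniformly_continuous_on_def by metis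
  have "isCont \<Lambda> \<tau>0" using \<Lambda> by (simp add: continuous_on_eq_continuous_at)
  then obtain d' where d': "d' > 0" "\<And>t. dist t \<tau>0 < d' \<Longrightarrow> dist (\<Lambda> t) (\<Lambda> \<tau>0) < d"
    using d(1) unfolding continuous_at_eps_delta dist_norm by (metis real_norm_def)
  have "((\<lambda>r. r * T) \<longlongrightarrow> 0) (at_right 0)" by (auto intro!: tendsto_eq_intros)
  then have "\<forall>\<^sub>F r in at_right 0. r * T < d'" using d'(1) by (rule order_tendstoD(2))
  then show ?thesis
    using eventually_at_right_less[of 0]
  proof eventually_elim
    case (elim r)
    show ?case
    proof (intro allI impI ballI, elim conjE)
      fix x t
      assume t: "t \<in> {0..T}" and x0: "x \<tau>0 = X 0"
        and x: "\<forall>t\<ge>\<tau>0. (x has_vector_derivative f (cutoff R (x t), \<Lambda> t) /\<^sub>R r) (at t within {\<tau>0..})"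
      define y where "y s = x (\<tau>0 + r * s)" for s
      have "(norm (y t - X t))\<^sup>2 + \<epsilon>\<^sup>2 \<le> exp ((2 * L + 1) * (t - 0)) * ((norm (y 0 - X 0))\<^sup>2 + \<epsilon>\<^sup>2)"
      proof (rule norm_growth[where v' = "\<lambda>s. f (cutoff R (y s), \<Lambda> (\<tau>0 + r * s)) - f (X s, \<Lambda> \<tau>0)"])
        fix s assume s: "s \<in> {0..t}"
        then have "r * s \<ge> 0" using elim by simp
        have inner: "((\<lambda>s. \<tau>0 + r * s) has_vector_derivative r) (at s within {0..t})"
          by (auto intro!: derivative_eq_intros)
        have outer: "(x has_vector_derivative f (cutoff R (y s), \<Lambda> (\<tau>0 + r * s)) /\<^sub>R r)
            (at (\<tau>0 + r * s) within (\<lambda>s. \<tau>0 + r * s) ` {0..t})"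
          using x[rule_format, of "\<tau>0 + r * s"] \<open>r * s \<ge> 0\<close> elim unfolding y_def
          by (auto intro!: has_vector_derivative_within_subset[of x _ _ "{\<tau>0..}"])
        have "(y has_vector_derivative f (cutoff R (y s), \<Lambda> (\<tau>0 + r * s))) (at s within {0..t})"
          using vector_diff_chain_within[OF inner outer] elim
          by (simp add: o_def y_def[abs_def])
        moreover have "(X has_vector_derivative f (X s, \<Lambda> \<tau>0)) (at s within {0..t})"
          by (rule has_vector_derivative_within_subset[of X _ _ "{0..}"])
            (use X s in \<open>auto simp: solves_frozen_def\<close>)
        ultimately show "((\<lambda>s. y s - X s) has_vector_derivative
            f (cutoff R (y s), \<Lambda> (\<tau>0 + r * s)) - f (X s, \<Lambda> \<tau>0)) (at s within {0..t})"
          by (rule has_vector_derivative_diff)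
        have Xs: "norm (X s) \<le> R" using R[of s] s t by auto
        have mem: "\<Lambda> (\<tau>0 + r * s) \<in> K" "\<Lambda> \<tau>0 \<in> K" using \<open>r * s \<ge> 0\<close> by (auto intro: K(2))
        have "norm (f (cutoff R (y s), \<Lambda> (\<tau>0 + r * s)) - f (X s, \<Lambda> (\<tau>0 + r * s))) \<le> L * norm (y s - X s)"
          using L(2)[OF mem(1), of "y s" "X s"] by (simp add: cutoff_eq Xs)
        moreover have "dist (\<Lambda> (\<tau>0 + r * s)) (\<Lambda> \<tau>0) < d"
        proof (rule d'(2))
          have "r * s \<le> r * T" using elim s t by (intro mult_left_mono) auto
          moreover have "dist (\<tau>0 + r * s) \<tau>0 = r * s" using \<open>r * s \<ge> 0\<close> by (simp add: dist_norm)
          ultimately show "dist (\<tau>0 + r * s) \<tau>0 < d'" using elim by linarith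
        qed
        then have "norm (f (X s, \<Lambda> (\<tau>0 + r * s)) - f (X s, \<Lambda> \<tau>0)) < \<epsilon>"
          using d(2)[of "(X s, \<Lambda> \<tau>0)" "(X s, \<Lambda> (\<tau>0 + r * s))"] Xs mem
          by (simp add: dist_Pair_Pair dist_norm)
        ultimately show "norm (f (cutoff R (y s), \<Lambda> (\<tau>0 + r * s)) - f (X s, \<Lambda> \<tau>0)) \<le>
            L * norm (y s - X s) + \<epsilon>"
          using norm_triangle_ineq[of "f (cutoff R (y s), \<Lambda> (\<tau>0 + r * s)) - f (X s, \<Lambda> (\<tau>0 + r * s))"
              "f (X s, \<Lambda> (\<tau>0 + r * s)) - f (X s, \<Lambda> \<tau>0)"] by simp
      qed (use t L(1) in auto)
      also have "\<dots> = exp ((2 * L + 1) * t) * \<epsilon>\<^sup>2" by (simp add: y_def x0)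
      also have "\<dots> \<le> q * \<epsilon>\<^sup>2" unfolding q_def using t L(1) by (intro mult_right_mono) auto
      finally have "(norm (y t - X t))\<^sup>2 \<le> \<omega>\<^sup>2" 
        unfolding \<epsilon>(2) by (rule order_trans[rotated]) simp
      then have "norm (y t - X t) \<le> \<omega>" by (rule power2_le_imp_le) (use \<open>\<omega> > 0\<close> in simp)
      then show "norm (x (\<tau>0 + r * t) - X t) \<le> \<omega>" by (simp add: y_def)
    qed
  qed
qed

lemma small_rate_eventually:
  fixes b C M \<kappa> :: real
  assumes "\<kappa> > 0"
  shows "\<forall>\<^sub>F r in at_right 0. r > 0 \<and> r * C \<le> 1 / 2 \<and> 2 * r\<^sup>2 * b ^ 3 * M\<^sup>2 < \<kappa>"
proof -
  have "((\<lambda>r. r * C) \<longlongrightarrow> 0) (at_right 0)" "((\<lambda>r. 2 * r\<^sup>2 * b ^ 3 * M\<^sup>2) \<longlongrightarrow> 0) (at_right 0)"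
    by (auto intro!: tendsto_eq_intros)
  then have "\<forall>\<^sub>F r in at_right 0. r * C < 1 / 2" "\<forall>\<^sub>F r in at_right 0. 2 * r\<^sup>2 * b ^ 3 * M\<^sup>2 < \<kappa>"
    using assms by (auto dest: order_tendstoD(2)[of _ 0 _ "1 / 2"] order_tendstoD(2)[of _ 0 _ \<kappa>])
  then show ?thesis using eventually_at_right_less[of 0] by eventually_elim auto
qed

locale smooth_input =
  fixes f :: "(real^'n) \<times> (real^'d) \<Rightarrow> real^'n"
    and f' :: "(real^'n) \<times> (real^'d) \<Rightarrow> ((real^'n) \<times> (real^'d)) \<Rightarrow>\<^sub>L (real^'n)"
    and \<Lambda> \<Lambda>' :: "real \<Rightarrow> real^'d" and e :: "real^'d \<Rightarrow> real^'n" and lp :: "real^'d"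
  assumes f': "\<And>z. (f has_derivative blinfun_apply (f' z)) (at z)" "continuous_on UNIV f'"
    and \<Lambda>': "\<And>\<tau>. (\<Lambda> has_vector_derivative \<Lambda>' \<tau>) (at \<tau>)" "continuous_on UNIV \<Lambda>'"
    and lim: "(\<Lambda> \<longlongrightarrow> lp) at_top" "(\<Lambda>' \<longlongrightarrow> 0) at_top"
begin

lemma \<Lambda>_continuous: "continuous_on UNIV \<Lambda>"
  unfolding continuous_on_eq_continuous_at[OF open_UNIV]
  using \<Lambda>'(1) has_vector_derivative_continuous by blast

text \<open>The limit of the input lies in the closure of its path, and e is continuous
  there.\<close>

lemma equilibrium_tendsto:
  assumes "moving_sink f \<Lambda> e I" "F \<noteq> bot" "\<forall>\<^sub>F \<tau> in F. \<Lambda> \<tau> \<in> closure (\<Lambda> ` I)" "(\<Lambda> \<longlongrightarrow> l) F"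
  shows "((\<lambda>\<tau>. e (\<Lambda> \<tau>)) \<longlongrightarrow> e l) F"
proof (rule continuous_on_tendsto_compose[OF moving_sink_continuous_on[OF assms(1)] assms(4) _ assms(3)])
  show "l \<in> closure (\<Lambda> ` I)"
    by (rule Lim_in_closed_set[OF closed_closure assms(3,2,4)])
qed

lemma forward_tracking:
  assumes sink: "moving_sink f \<Lambda> e {\<tau>0<..}" and "\<delta> > 0"
    and x0: "x0 \<in> basin f (\<Lambda> \<tau>0) (e (\<Lambda> \<tau>0))"
  shows "\<forall>\<^sub>F r in at_right 0. \<exists>\<tau>s\<ge>\<tau>0. \<exists>x. solves_nonaut f \<Lambda> r {\<tau>0..} x \<and> x \<tau>0 = x0 \<and>
    close_tracks \<delta> e \<Lambda> {\<tau>s<..} x \<and> (x \<longlongrightarrow> e lp) at_top"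
proof -
  let ?K = "closure (\<Lambda> ` {\<tau>0<..})" and ?p = "\<lambda>\<tau>. e (\<Lambda> \<tau>)"
  have "bounded (\<Lambda> ` {\<tau>0<..})"
    by (rule bounded_subset[OF bounded_at_top_limit[OF \<Lambda>_continuous lim(1), of \<tau>0]]) auto
  then have K: "compact ?K" by simp
  \<comment> \<open>The sink is given over an open half-line; continuity puts \<Lambda> \<tau>0 into
    the closure as well.\<close>
  have mem: "\<Lambda> \<tau> \<in> ?K" if "\<tau> \<ge> \<tau>0" for \<tau>
    using image_closure_subset[of "{\<tau>0<..}" \<Lambda> ?K] continuous_on_subset[OF \<Lambda>_continuous]
      closure_subset[of "\<Lambda> ` {\<tau>0<..}"] that by auto
  obtain M1 where M1: "\<And>\<tau>. \<tau> \<in> {\<tau>0..} \<Longrightarrow> norm (\<Lambda>' \<tau>) \<le> M1"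
    using bounded_at_top_limit[OF \<Lambda>'(2) lim(2), of \<tau>0] unfolding bounded_iff by auto
  have J: "s \<in> {\<tau>0..} \<Longrightarrow> t \<ge> s \<Longrightarrow> t \<in> {\<tau>0..}" "{\<tau>0..} \<noteq> {}" for s t :: real by auto
  have mem': "\<Lambda> \<tau> \<in> ?K" if "\<tau> \<in> {\<tau>0..}" for \<tau> using mem that by simp
  obtain Q p' a b C \<eta> M2 where tube:
    "attracting_tube (\<lambda>\<tau> x. f (x, \<Lambda> \<tau>)) ?p p' Q {\<tau>0..} a b C \<eta>"
    and M2: "\<And>\<tau>. \<tau> \<in> {\<tau>0..} \<Longrightarrow> norm (p' \<tau>) \<le> M2 * norm (\<Lambda>' \<tau>)" "M2 \<ge> 0"
    by (rule moving_sink_tube[OF f' \<Lambda>'(1) M1 J K mem' sink]) (assumption+, rule that)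
  interpret attracting_tube "\<lambda>\<tau> x. f (x, \<Lambda> \<tau>)" ?p p' Q "{\<tau>0..}" a b C \<eta> by (rule tube)
  have p'_bound: "norm (p' \<tau>) \<le> M2 * M1" if "\<tau> \<in> {\<tau>0..}" for \<tau>
    using order_trans[OF M2(1)[OF that] mult_left_mono[OF M1[OF that] M2(2)]] .
  have p'_lim: "(p' \<longlongrightarrow> 0) at_top"
  proof (rule Lim_null_comparison)
    show "\<forall>\<^sub>F \<tau> in at_top. norm (p' \<tau>) \<le> M2 * norm (\<Lambda>' \<tau>)"
      using eventually_ge_at_top[of \<tau>0] by (rule eventually_mono) (use M2(1) in auto)
    show "((\<lambda>\<tau>. M2 * norm (\<Lambda>' \<tau>)) \<longlongrightarrow> 0) at_top"
      using tendsto_mult[OF tendsto_const tendsto_norm[OF lim(2)], of M2] by simp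
  qed
  have p_lim: "(?p \<longlongrightarrow> e lp) at_top"
    by (rule equilibrium_tendsto[OF sink _ _ lim(1)])
      (auto intro: eventually_mono[OF eventually_ge_at_top[of \<tau>0]] mem)
  have p_cont: "continuous_on {\<tau>0..} ?p"
    using mem by (intro continuous_on_compose2[OF moving_sink_continuous_on[OF sink]]
        continuous_on_subset[OF \<Lambda>_continuous]) auto
  define \<epsilon> where "\<epsilon> = min \<eta> \<delta> / 2"
  have \<epsilon>: "0 < \<epsilon>" "\<epsilon> < \<eta>" "\<epsilon> < \<delta>" using pos \<open>\<delta> > 0\<close> by (auto simp: \<epsilon>_def)
  define \<kappa> where "\<kappa> = a * \<epsilon>\<^sup>2"
  have "\<kappa> > 0" using pos \<epsilon> by (simp add: \<kappa>_def)
  define \<sigma> where "\<sigma> = sqrt (\<kappa> / b) / 2"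
  have \<sigma>: "\<sigma> > 0" "b * (2 * \<sigma>)\<^sup>2 = \<kappa>" using \<open>\<kappa> > 0\<close> pos by (auto simp: \<sigma>_def)
  obtain X where X: "solves_frozen f (\<Lambda> \<tau>0) {0..} X" "X 0 = x0" "(X \<longlongrightarrow> ?p \<tau>0) at_top"
    using x0 by (auto simp: basin_def)
  have "\<forall>\<^sub>F t in at_top. dist (X t) (?p \<tau>0) < \<sigma> / 2 \<and> t \<ge> 0"
    using tendstoD[OF X(3), of "\<sigma> / 2"] eventually_ge_at_top[of 0] \<sigma>(1) by (auto intro: eventually_conj)
  then obtain T where T: "T \<ge> 0" "dist (X T) (?p \<tau>0) < \<sigma> / 2"
    by (auto simp: eventually_at_top_linorder)
  have "continuous_on {0..} X"
    using X(1) unfolding solves_frozen_def continuous_on_eq_continuous_within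
    by (blast intro: has_vector_derivative_continuous)
  then have "bounded (X ` {0..T})"
    by (intro compact_imp_bounded compact_continuous_image) (auto elim: continuous_on_subset)
  moreover have "bounded (e ` ?K)"
    by (intro compact_imp_bounded compact_continuous_image moving_sink_continuous_on[OF sink] K)
  ultimately have "bounded (X ` {0..T} \<union> e ` ?K)" by simp
  then obtain R0 where R0: "\<And>t. t \<in> {0..T} \<Longrightarrow> norm (X t) \<le> R0" "\<And>l. l \<in> ?K \<Longrightarrow> norm (e l) \<le> R0"
    unfolding bounded_iff by blast
  define \<omega> where "\<omega> = min 1 (\<sigma> / 2)"
  have \<omega>: "\<omega> > 0" "\<omega> \<le> 1" "\<omega> \<le> \<sigma> / 2" using \<sigma>(1) by (auto simp: \<omega>_def)
  define R where "R = R0 + 1 + \<eta>"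
  have R: "R \<ge> 0" "\<And>t. t \<in> {0..T} \<Longrightarrow> norm (X t) \<le> R"
    using R0(2)[OF mem[of \<tau>0]] norm_ge_zero[of "?p \<tau>0"] R0(1) pos
    by (auto simp: R_def intro: order_trans simp del: norm_ge_zero) force+
  have R_ball: "norm z \<le> R" if "norm (z - ?p \<tau>) < \<eta>" "\<tau> \<ge> \<tau>0" for z \<tau>
    using norm_triangle_sub[of z "?p \<tau>"] R0(2)[OF mem[OF that(2)]] that(1) by (simp add: R_def)
  obtain d where d: "d > 0" "\<And>t. t \<ge> \<tau>0 \<Longrightarrow> dist t \<tau>0 < d \<Longrightarrow> dist (?p t) (?p \<tau>0) < \<sigma>"
    using p_cont[unfolded continuous_on_iff, rule_format, of \<tau>0 \<sigma>] \<sigma>(1) by auto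
  have "((\<lambda>r. r * T) \<longlongrightarrow> 0) (at_right 0)" by (auto intro!: tendsto_eq_intros)
  then have "\<forall>\<^sub>F r in at_right 0. r * T < d" using d(1) by (rule order_tendstoD(2))
  have follow: "\<forall>\<^sub>F r in at_right 0. \<forall>x. x \<tau>0 = X 0 \<and>
      (\<forall>t\<ge>\<tau>0. (x has_vector_derivative f (cutoff R (x t), \<Lambda> t) /\<^sub>R r) (at t within {\<tau>0..})) \<longrightarrow>
      (\<forall>t\<in>{0..T}. norm (x (\<tau>0 + r * t) - X t) \<le> \<omega>)"
    by (rule follows_frozen[OF f' K mem \<Lambda>_continuous X(1) T(1) \<omega>(1) R(2)])
  from follow small_rate_eventually[OF \<open>\<kappa> > 0\<close>, of C b "M2 * M1"]
    \<open>\<forall>\<^sub>F r in at_right 0. r * T < d\<close>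
  show ?thesis
  proof eventually_elim
    case (elim r)
    note r = elim(2)[THEN conjunct1] elim(2)[THEN conjunct2, THEN conjunct1]
      elim(2)[THEN conjunct2, THEN conjunct2]
    have "\<exists>x. x \<tau>0 = x0 \<and>
        (\<forall>t\<ge>\<tau>0. (x has_vector_derivative f (cutoff R (x t), \<Lambda> t) /\<^sub>R r) (at t within {\<tau>0..}))"
      by (rule cutoff_solution[OF f' K R(1) r(1) \<Lambda>_continuous mem])
    then obtain x where x: "x \<tau>0 = x0"
      "\<forall>t\<ge>\<tau>0. (x has_vector_derivative f (cutoff R (x t), \<Lambda> t) /\<^sub>R r) (at t within {\<tau>0..})" by blast
    have near: "norm (x (\<tau>0 + r * t) - X t) \<le> \<omega>" if "t \<in> {0..T}" for t
      using elim(1)[THEN spec, THEN mp, OF conjI, OF _ x(2)] x(1) X(2) that by simp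
    define \<tau>1 where "\<tau>1 = \<tau>0 + r * T"
    have \<tau>1: "\<tau>1 \<ge> \<tau>0" using r(1) T(1) by (simp add: \<tau>1_def)
    have V1: "V x \<tau>1 < \<kappa>"
    proof -
      have "dist (?p \<tau>1) (?p \<tau>0) < \<sigma>"
        using elim(3) \<tau>1 by (intro d(2)) (auto simp: \<tau>1_def dist_norm)
      have "norm (x \<tau>1 - ?p \<tau>1) \<le> dist (x \<tau>1) (X T) + dist (X T) (?p \<tau>0) + dist (?p \<tau>1) (?p \<tau>0)"
        using dist_triangle[of "x \<tau>1" "?p \<tau>1" "X T"] dist_triangle2[of "X T" "?p \<tau>1" "?p \<tau>0"]
        by (simp add: dist_norm[symmetric])
      also have "\<dots> < 2 * \<sigma>"
        using near[of T] T \<omega>(3) \<open>dist (?p \<tau>1) (?p \<tau>0) < \<sigma>\<close> by (simp add: \<tau>1_def dist_norm)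
      finally have "(norm (x \<tau>1 - ?p \<tau>1))\<^sup>2 < (2 * \<sigma>)\<^sup>2" by (intro power_strict_mono) auto
      then have "b * (norm (x \<tau>1 - ?p \<tau>1))\<^sup>2 < \<kappa>" unfolding \<sigma>(2)[symmetric] using pos by simp
      then show ?thesis using V_upper[of x \<tau>1] by linarith
    qed
    have close: "norm (x t - ?p t) < \<epsilon>" if "t \<ge> \<tau>1" for t
    proof (rule trapped[OF r _ \<epsilon>(1,2), where G = "\<lambda>t z. f (cutoff R z, \<Lambda> t)" and s = \<tau>1])
      show "\<kappa> \<le> a * \<epsilon>\<^sup>2" by (simp add: \<kappa>_def)
      show "(x has_vector_derivative f (cutoff R (x u), \<Lambda> u) /\<^sub>R r) (at u within {\<tau>1..})" if "u \<ge> \<tau>1" for u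
        by (rule has_vector_derivative_within_subset[of x _ _ "{\<tau>0..}"]) (use x(2) \<tau>1 that in auto)
      show "f (cutoff R z, \<Lambda> u) = f (z, \<Lambda> u)" if "u \<in> {\<tau>0..}" "z \<in> ball (?p u) \<eta>" for u z
        using R_ball[of z u] that by (simp add: cutoff_eq dist_norm norm_minus_commute)
    qed (use \<tau>1 p'_bound V1 that in auto)
    have bounded: "norm (x t) \<le> R" if "t \<ge> \<tau>0" for t
    proof (cases "t \<ge> \<tau>1")
      case True
      then show ?thesis using close[OF True] \<epsilon>(2) \<tau>1 by (intro R_ball[of _ t]) auto
    next
      case False
      define s where "s = (t - \<tau>0) / r"
      have s: "t = \<tau>0 + r * s" "s \<in> {0..T}"
        using False that r(1) by (auto simp: s_def \<tau>1_def field_simps)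
      have "norm (x t) \<le> norm (X s) + \<omega>"
        using near[OF s(2)] norm_triangle_sub[of "x t" "X s"] by (simp add: s(1))
      then show ?thesis using R0(1)[OF s(2)] \<omega>(2) pos by (simp add: R_def)
    qed
    have sol: "solves_nonaut f \<Lambda> r {\<tau>0..} x"
      using x(2) bounded by (simp add: solves_nonaut_def cutoff_eq)
    have "((\<lambda>t. x t - ?p t) \<longlongrightarrow> 0) at_top"
    proof (rule tracks_at_top[OF r(1,2), of \<tau>1])
      show "x u \<in> ball (?p u) \<eta>" if "u \<ge> \<tau>1" for u
        using close[OF that] \<epsilon>(2) by (simp add: dist_norm norm_minus_commute)
      show "(x has_vector_derivative f (x u, \<Lambda> u) /\<^sub>R r) (at u within {\<tau>1..})" if "u \<ge> \<tau>1" for u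
        by (rule has_vector_derivative_within_subset[of x _ _ "{\<tau>0..}"])
          (use sol that \<tau>1 in \<open>auto simp: solves_nonaut_def\<close>)
    qed (use \<tau>1 p'_lim in auto)
    from tendsto_add[OF this p_lim] have "(x \<longlongrightarrow> e lp) at_top" by simp
    moreover have "close_tracks \<delta> e \<Lambda> {\<tau>1<..} x"
      unfolding close_tracks_def
    proof
      fix t assume "t \<in> {\<tau>1<..}"
      then have "norm (x t - ?p t) < \<epsilon>" by (intro close) simp
      then show "norm (x t - ?p t) < \<delta>" using \<epsilon>(3) by simp
    qed
    ultimately show ?case using \<tau>1 sol x(1) by blast
  qed
qed

text \<open>Staying in the tube is what ties the claims together: it makes x converge at both ends,
  agree with every solution that has the same past limit, and attract its neighbours by
  \<open>pair_decay\<close>.\<close>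

lemma pullback_tracking:
  assumes sink: "moving_sink f \<Lambda> e UNIV" and "\<delta> > 0"
    and lim_bot: "(\<Lambda> \<longlongrightarrow> lm) at_bot" "(\<Lambda>' \<longlongrightarrow> 0) at_bot"
  shows "\<forall>\<^sub>F r in at_right 0. \<exists>x. solves_nonaut f \<Lambda> r UNIV x \<and> (x \<longlongrightarrow> e lm) at_bot \<and>
    (\<forall>T y. solves_nonaut f \<Lambda> r {..<T} y \<and> (y \<longlongrightarrow> e lm) at_bot \<longrightarrow> (\<forall>\<tau><T. y \<tau> = x \<tau>)) \<and>
    local_pullback_attractor f \<Lambda> r x \<and> close_tracks \<delta> e \<Lambda> UNIV x \<and> (x \<longlongrightarrow> e lp) at_top"
proof -
  let ?K = "closure (range \<Lambda>)" and ?p = "\<lambda>\<tau>. e (\<Lambda> \<tau>)"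
  have split: "range h = h ` {..0} \<union> h ` {0..}" for h :: "real \<Rightarrow> real^'d"
    by (metis image_Un UNIV_eq_I Un_iff atLeast_iff atMost_iff linear)
  have "bounded (range \<Lambda>)"
    unfolding split[of \<Lambda>]
    using bounded_at_top_limit[OF \<Lambda>_continuous lim(1), of 0] bounded_at_bot_limit[OF \<Lambda>_continuous lim_bot(1), of 0]
    by simp
  then have K: "compact ?K" by simp
  have mem: "\<Lambda> \<tau> \<in> ?K" for \<tau> using closure_subset[of "range \<Lambda>"] by auto
  have "bounded (range \<Lambda>')"
    unfolding split[of \<Lambda>']
    using bounded_at_top_limit[OF \<Lambda>'(2) lim(2), of 0] bounded_at_bot_limit[OF \<Lambda>'(2) lim_bot(2), of 0]
    by simp
  then obtain M1 where M1: "\<And>\<tau>. norm (\<Lambda>' \<tau>) \<le> M1" unfolding bounded_iff by auto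
  obtain Q p' a b C \<eta> M2 where tube:
    "attracting_tube (\<lambda>\<tau> x. f (x, \<Lambda> \<tau>)) ?p p' Q UNIV a b C \<eta>"
    and M2: "\<And>\<tau>. \<tau> \<in> UNIV \<Longrightarrow> norm (p' \<tau>) \<le> M2 * norm (\<Lambda>' \<tau>)" "M2 \<ge> 0"
    by (rule moving_sink_tube[OF f' \<Lambda>'(1) M1 UNIV_I UNIV_not_empty K mem sink]) (rule that)
  interpret attracting_tube "\<lambda>\<tau> x. f (x, \<Lambda> \<tau>)" ?p p' Q UNIV a b C \<eta> by (rule tube)
  have p'_bound: "norm (p' \<tau>) \<le> M2 * M1" for \<tau>
    using order_trans[OF M2(1)[OF UNIV_I] mult_left_mono[OF M1 M2(2)]] .
  have p'_lim: "(p' \<longlongrightarrow> 0) F" if "(\<Lambda>' \<longlongrightarrow> 0) F" for F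
  proof (rule Lim_null_comparison)
    show "\<forall>\<^sub>F \<tau> in F. norm (p' \<tau>) \<le> M2 * norm (\<Lambda>' \<tau>)"
      using M2(1) by simp
    show "((\<lambda>\<tau>. M2 * norm (\<Lambda>' \<tau>)) \<longlongrightarrow> 0) F"
      using tendsto_mult[OF tendsto_const tendsto_norm[OF that], of M2] by simp
  qed
  have p_top: "(?p \<longlongrightarrow> e lp) at_top"
    by (rule equilibrium_tendsto[OF sink _ _ lim(1)]) (use mem in auto)
  have p_bot: "(?p \<longlongrightarrow> e lm) at_bot"
    by (rule equilibrium_tendsto[OF sink _ _ lim_bot(1)]) (use mem in auto)
  define \<epsilon> where "\<epsilon> = min \<eta> \<delta> / 2"
  have \<epsilon>: "0 < \<epsilon>" "\<epsilon> < \<eta>" "\<epsilon> < \<delta>" using pos \<open>\<delta> > 0\<close> by (auto simp: \<epsilon>_def)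
  define \<kappa> where "\<kappa> = a * \<epsilon>\<^sup>2"
  have "\<kappa> > 0" "\<kappa> \<le> a * \<epsilon>\<^sup>2" using pos \<epsilon> by (auto simp: \<kappa>_def)
  define \<sigma> where "\<sigma> = sqrt (\<kappa> / b) / 2"
  have \<sigma>: "\<sigma> > 0" "b * (2 * \<sigma>)\<^sup>2 = \<kappa>" using \<open>\<kappa> > 0\<close> pos by (auto simp: \<sigma>_def)
  have "bounded (e ` ?K)"
    by (intro compact_imp_bounded compact_continuous_image moving_sink_continuous_on[OF sink] K)
  then obtain R0 where R0: "\<And>l. l \<in> ?K \<Longrightarrow> norm (e l) \<le> R0"
    unfolding bounded_iff by blast
  define R where "R = R0 + \<eta>"
  have R: "R \<ge> 0"
    using order_trans[OF norm_ge_zero R0[OF mem]] pos by (simp add: R_def)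
  have R_ball: "norm z \<le> R" if "norm (z - ?p \<tau>) < \<eta>" for z \<tau>
    using norm_triangle_sub[of z "?p \<tau>"] R0[OF mem[of \<tau>]] that by (simp add: R_def)
  let ?G = "\<lambda>t z. f (cutoff R z, \<Lambda> t)"
  have G: "?G u z = f (z, \<Lambda> u)" if "z \<in> ball (?p u) \<eta>" for u z
    using R_ball[of z u] that by (simp add: cutoff_eq dist_norm norm_minus_commute)
  obtain L where L: "\<And>l x y. l \<in> ?K \<Longrightarrow> norm (f (cutoff R x, l) - f (cutoff R y, l)) \<le> L * norm (x - y)"
    by (rule cutoff_bounds[OF f' K R]) blast
  show ?thesis
    using small_rate_eventually[OF \<open>\<kappa> > 0\<close>, of C b "M2 * M1"]
  proof eventually_elim
    case (elim r)
    then have r: "r > 0" "r * C \<le> 1 / 2" "2 * r\<^sup>2 * b ^ 3 * (M2 * M1)\<^sup>2 < \<kappa>" by auto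
    have solvable: "\<exists>x. x s = y \<and> (\<forall>u\<ge>s. (x has_vector_derivative ?G u (x u) /\<^sub>R r) (at u within {s..}))"
      for s y by (rule cutoff_solution[OF f' K R r(1) \<Lambda>_continuous mem])
    obtain x where x: "\<And>t. (x has_vector_derivative ?G t (x t) /\<^sub>R r) (at t)"
      "\<And>t. norm (x t - ?p t) \<le> \<epsilon>"
      by (rule pullback_solution_exists[OF r \<open>\<kappa> \<le> a * \<epsilon>\<^sup>2\<close> \<epsilon>(1,2) refl p'_bound G L[OF mem] solvable])
        (assumption, rule that)
    have tube_x: "x t \<in> ball (?p t) \<eta>" for t
      using le_less_trans[OF x(2) \<epsilon>(2)] by (simp add: dist_norm norm_minus_commute)
    have der: "(x has_vector_derivative f (x t, \<Lambda> t) /\<^sub>R r) (at t within S)" for t S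
      using x(1)[of t] unfolding G[OF tube_x] by (rule has_vector_derivative_at_within)
    then have sol: "solves_nonaut f \<Lambda> r S x" for S by (simp add: solves_nonaut_def)
    have "((\<lambda>t. x t - ?p t) \<longlongrightarrow> 0) at_top"
      by (rule tracks_at_top[OF r(1,2) UNIV_I[of 0] tube_x der p'_lim[OF lim(2)]])
    from tendsto_add[OF this p_top] have x_top: "(x \<longlongrightarrow> e lp) at_top" by simp
    have x_p_bot: "((\<lambda>t. x t - ?p t) \<longlongrightarrow> 0) at_bot"
      by (rule tracks_at_bot[OF r(1,2) refl tube_x der p'_lim[OF lim_bot(2)]])
    from tendsto_add[OF this p_bot] have x_bot: "(x \<longlongrightarrow> e lm) at_bot" by simp
    have unique: "y \<tau> = x \<tau>"
      if y: "solves_nonaut f \<Lambda> r {..<T} y" "(y \<longlongrightarrow> e lm) at_bot" and "\<tau> < T" for T y \<tau>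
    proof -
      have "((\<lambda>t. y t - ?p t) \<longlongrightarrow> 0) at_bot" using tendsto_diff[OF y(2) p_bot] by simp
      from tendstoD[OF this pos(4)] obtain T0 where T0: "\<And>t. t \<le> T0 \<Longrightarrow> norm (y t - ?p t) < \<eta>"
        by (auto simp: eventually_at_bot_linorder)
      \<comment> \<open>Up to t both solutions are in the tube, so \<open>unique_past\<close>
        applies; from t to \<tau> forward uniqueness takes over.\<close>
      define t where "t = min T0 \<tau>"
      have t: "t \<le> T0" "t \<le> \<tau>" "t < T" using \<open>\<tau> < T\<close> by (auto simp: t_def)
      have "y t = x t"
      proof (rule unique_past[OF r(1,2) refl _ tube_x _ der])
        show "y u \<in> ball (?p u) \<eta>" if "u \<le> t" for u
          using T0[of u] that t by (simp add: dist_norm norm_minus_commute)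
        show "(y has_vector_derivative f (y u, \<Lambda> u) /\<^sub>R r) (at u within {s..t})" if "s \<le> u" "u \<le> t" for s u
          by (rule has_vector_derivative_within_subset[of y _ _ "{..<T}"])
            (use y(1) t that in \<open>auto simp: solves_nonaut_def\<close>)
      qed
      moreover have "solves_nonaut f \<Lambda> r {t..\<tau>} y"
        by (rule solves_nonaut_subset[OF y(1)]) (use \<open>\<tau> < T\<close> in auto)
      ultimately show ?thesis
        using solves_nonaut_unique[OF f' \<Lambda>_continuous r(1) t(2) _ sol] by blast
    qed
    have "local_pullback_attractor f \<Lambda> r x"
      unfolding local_pullback_attractor_def
    \<comment> \<open>For early s the point x s is within \<sigma> of the sink, so its \<sigma>-ball
      lies within 2 \<sigma> of the sink and has energy below \<kappa>: solutions started there are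
      trapped. The radius depends on neither s nor t.\<close>
    proof (intro conjI sol exI[of _ \<sigma>] allI impI)
      fix t d :: real assume "d > 0"
      have "((\<lambda>s. sqrt (b / a) * exp (- (t - s) / (2 * r * b)) * \<sigma>) \<longlongrightarrow> sqrt (b / a) * 0 * \<sigma>) at_bot"
        using exp_decay_at_bot[of "2 * r" t] r(1) by (intro tendsto_mult tendsto_const) auto
      then have "\<forall>\<^sub>F s in at_bot. sqrt (b / a) * exp (- (t - s) / (2 * r * b)) * \<sigma> < d"
        using \<open>d > 0\<close> by (intro order_tendstoD(2)) auto
      moreover have "\<forall>\<^sub>F s in at_bot. dist (x s - ?p s) 0 < \<sigma>"
        by (rule tendstoD[OF x_p_bot \<sigma>(1)])
      ultimately show "\<forall>\<^sub>F s in at_bot. \<forall>y\<in>ball (x s) \<sigma>.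
          \<exists>z. solves_nonaut f \<Lambda> r {s..t} z \<and> z s = y \<and> dist (z t) (x t) < d"
        using eventually_le_at_bot[of t]
      proof eventually_elim
        case (elim s)
        show ?case
        proof
          fix y assume y: "y \<in> ball (x s) \<sigma>"
          obtain z where z: "z s = y"
            "\<forall>u\<ge>s. (z has_vector_derivative ?G u (z u) /\<^sub>R r) (at u within {s..})"
            using solvable by blast
          have "norm (y - ?p s) < 2 * \<sigma>"
            using y elim(2) dist_triangle[of y "?p s" "x s"] by (simp add: dist_norm norm_minus_commute)
          then have "(norm (y - ?p s))\<^sup>2 < (2 * \<sigma>)\<^sup>2" by (intro power_strict_mono) auto
          then have "b * (norm (y - ?p s))\<^sup>2 < \<kappa>" unfolding \<sigma>(2)[symmetric] using pos by simp
          then have V: "V z s < \<kappa>" using V_upper[of z s] z(1) by simp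
          have close: "norm (z u - ?p u) < \<epsilon>" if "u \<ge> s" for u
            by (rule trapped[OF r \<open>\<kappa> \<le> a * \<epsilon>\<^sup>2\<close> \<epsilon>(1,2) UNIV_I p'_bound z(2)[rule_format] G V that])
          have tube_z: "z u \<in> ball (?p u) \<eta>" if "u \<ge> s" for u
            using less_trans[OF close[OF that] \<epsilon>(2)] by (simp add: dist_norm norm_minus_commute)
          have der_z: "(z has_vector_derivative f (z u, \<Lambda> u) /\<^sub>R r) (at u within {s..t})"
            if "u \<in> {s..t}" for u
          proof -
            have "u \<ge> s" using that by simp
            from z(2)[rule_format, OF this] have "(z has_vector_derivative f (z u, \<Lambda> u) /\<^sub>R r) (at u within {s..})"
              unfolding G[OF tube_z[OF \<open>u \<ge> s\<close>]] .
            then show ?thesis by (rule has_vector_derivative_within_subset) auto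
          qed
          have "norm (z t - x t) \<le> sqrt (b / a) * exp (- (t - s) / (2 * r * b)) * norm (z s - x s)"
            by (rule pair_decay[OF r(1,2) elim(3) UNIV_I _ tube_x der_z der]) (use tube_z in auto)
          also have "\<dots> \<le> sqrt (b / a) * exp (- (t - s) / (2 * r * b)) * \<sigma>"
            using y z(1) pos by (intro mult_left_mono) (auto simp: dist_norm norm_minus_commute)
          also have "\<dots> < d" by (rule elim(1))
          finally show "\<exists>z. solves_nonaut f \<Lambda> r {s..t} z \<and> z s = y \<and> dist (z t) (x t) < d"
            using der_z z(1) by (intro exI[of _ z]) (auto simp: solves_nonaut_def dist_norm)
        qed
      qed
    qed (use \<sigma>(1) in auto)
    moreover have "close_tracks \<delta> e \<Lambda> UNIV x"
      using le_less_trans[OF x(2) \<epsilon>(3)] by (simp add: close_tracks_def)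
    ultimately show ?case using sol x_top x_bot unique by blast
  qed
qed

end

theorem theorem7p1:
  fixes f :: "(real^'n) \<times> (real^'d) \<Rightarrow> real^'n"
    and \<Lambda> :: "real \<Rightarrow> real^'d"
    and e :: "real^'d \<Rightarrow> real^'n"
    and lp :: "real^'d"
    and \<tau>\<^sub>0 \<delta> :: real
  assumes f_C1: "C1_on f UNIV"
    and \<Lambda>_C1: "\<Lambda> C1_differentiable_on UNIV"
    and \<Lambda>_exp: "exp_asymptotically_constant \<Lambda> lp"
    and sink: "moving_sink f \<Lambda> e {\<tau>\<^sub>0<..}"
    and \<delta>_pos: "\<delta> > 0"
  shows
    "(\<forall>x0 \<in> basin f (\<Lambda> \<tau>\<^sub>0) (e (\<Lambda> \<tau>\<^sub>0)).
        \<exists>rs>0. \<forall>r. 0 < r \<and> r < rs \<longrightarrow> (\<exists>\<tau>s\<ge>\<tau>\<^sub>0.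
          (\<exists>x. solves_nonaut f \<Lambda> r {\<tau>\<^sub>0..} x \<and> x \<tau>\<^sub>0 = x0) \<and>
          (\<forall>x. solves_nonaut f \<Lambda> r {\<tau>\<^sub>0..} x \<and> x \<tau>\<^sub>0 = x0 \<longrightarrow>
            close_tracks \<delta> e \<Lambda> {\<tau>s<..} x \<and>
            end_point_tracks f \<Lambda> r e lp {\<tau>s<..} x)))
     \<and>
     (\<forall>lm. exp_bi_asymptotically_constant \<Lambda> lm lp \<and> moving_sink f \<Lambda> e UNIV \<longrightarrow>
        (\<exists>rs>0. \<forall>r. 0 < r \<and> r < rs \<longrightarrow>
          (\<exists>x. solves_nonaut f \<Lambda> r UNIV x \<and> (x \<longlongrightarrow> e lm) at_bot \<and>
            (\<forall>T y. solves_nonaut f \<Lambda> r {..<T} y \<and> (y \<longlongrightarrow> e lm) at_bot \<longrightarrow>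
              (\<forall>\<tau><T. y \<tau> = x \<tau>)) \<and>
            local_pullback_attractor f \<Lambda> r x \<and>
            close_tracks \<delta> e \<Lambda> UNIV x \<and>
            end_point_tracks f \<Lambda> r e lp UNIV x)))"
proof -
  obtain U h f' where "UNIV \<subseteq> U" "\<forall>z\<in>UNIV. h z = f z"
    "\<forall>z\<in>U. (h has_derivative blinfun_apply (f' z)) (at z)"
    "continuous_on U (f' :: (real^'n) \<times> (real^'d) \<Rightarrow> ((real^'n) \<times> (real^'d)) \<Rightarrow>\<^sub>L (real^'n))"
    using f_C1 unfolding C1_on_def by blast
  moreover from this have "h = f" "U = UNIV" by auto
  ultimately have f': "(f has_derivative blinfun_apply (f' z)) (at z)" "continuous_on UNIV f'" for z
    by (cases z; auto)+
  define \<Lambda>' where "\<Lambda>' \<tau> = vector_derivative \<Lambda> (at \<tau>)" for \<tau>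
  have \<Lambda>': "(\<Lambda> has_vector_derivative \<Lambda>' \<tau>) (at \<tau>)" "continuous_on UNIV \<Lambda>'" for \<tau>
    using \<Lambda>_C1 unfolding C1_differentiable_on_eq \<Lambda>'_def
    by (auto simp: vector_derivative_works)
  have lim: "(\<Lambda> \<longlongrightarrow> lp) at_top" using \<Lambda>_exp by (simp add: exp_asymptotically_constant_def)
  obtain \<rho> L where "\<rho> > 0" and L: "((\<lambda>\<tau>. \<Lambda>' \<tau> /\<^sub>R exp (- \<rho> * \<tau>)) \<longlongrightarrow> L) at_top"
    using \<Lambda>_exp unfolding exp_asymptotically_constant_def \<Lambda>'_def by blast
  have lim': "(\<Lambda>' \<longlongrightarrow> 0) at_top"
    by (rule tendsto_0_of_exp_rate[OF L])
      (rule filterlim_tendsto_neg_mult_at_bot[OF tendsto_const], use \<open>\<rho> > 0\<close> in \<open>auto intro: filterlim_ident\<close>)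
  interpret smooth_input f f' \<Lambda> \<Lambda>' e lp
    by standard (rule f' \<Lambda>' lim lim')+
  show ?thesis
  proof (intro conjI ballI allI impI)
    fix x0 assume x0: "x0 \<in> basin f (\<Lambda> \<tau>\<^sub>0) (e (\<Lambda> \<tau>\<^sub>0))"
    from forward_tracking[OF sink \<delta>_pos x0] obtain rs where rs: "rs > 0"
      "\<And>r. 0 < r \<Longrightarrow> r < rs \<Longrightarrow> \<exists>\<tau>s\<ge>\<tau>\<^sub>0. \<exists>x. solves_nonaut f \<Lambda> r {\<tau>\<^sub>0..} x \<and> x \<tau>\<^sub>0 = x0 \<and>
        close_tracks \<delta> e \<Lambda> {\<tau>s<..} x \<and> (x \<longlongrightarrow> e lp) at_top"
      unfolding eventually_at_right_field by blast
    show "\<exists>rs>0. \<forall>r. 0 < r \<and> r < rs \<longrightarrow> (\<exists>\<tau>s\<ge>\<tau>\<^sub>0.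
          (\<exists>x. solves_nonaut f \<Lambda> r {\<tau>\<^sub>0..} x \<and> x \<tau>\<^sub>0 = x0) \<and>
          (\<forall>x. solves_nonaut f \<Lambda> r {\<tau>\<^sub>0..} x \<and> x \<tau>\<^sub>0 = x0 \<longrightarrow>
            close_tracks \<delta> e \<Lambda> {\<tau>s<..} x \<and> end_point_tracks f \<Lambda> r e lp {\<tau>s<..} x))"
    proof (rule exI[of _ rs], intro conjI rs(1) allI impI, elim conjE)
      fix r assume r: "0 < r" "r < rs"
      obtain \<tau>s x where \<tau>s: "\<tau>s \<ge> \<tau>\<^sub>0" and x: "solves_nonaut f \<Lambda> r {\<tau>\<^sub>0..} x" "x \<tau>\<^sub>0 = x0"
        "close_tracks \<delta> e \<Lambda> {\<tau>s<..} x" "(x \<longlongrightarrow> e lp) at_top"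
        using rs(2)[OF r] by blast
      \<comment> \<open>One tracking solution is at hand; uniqueness on the half-line transfers its
        properties to every solution with this initial value.\<close>
      have "close_tracks \<delta> e \<Lambda> {\<tau>s<..} y \<and> end_point_tracks f \<Lambda> r e lp {\<tau>s<..} y"
        if y: "solves_nonaut f \<Lambda> r {\<tau>\<^sub>0..} y" "y \<tau>\<^sub>0 = x0" for y
      proof -
        have eq: "y t = x t" if "t \<ge> \<tau>\<^sub>0" for t
          by (rule solves_nonaut_unique[OF f' \<Lambda>_continuous r(1) that])
            (use x(2) y(2) in \<open>auto intro: solves_nonaut_subset[OF x(1)] solves_nonaut_subset[OF y(1)]\<close>)
        have "(y \<longlongrightarrow> e lp) at_top"
        proof (rule Lim_transform_eventually[OF x(4)])
          show "\<forall>\<^sub>F t in at_top. x t = y t"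
            by (rule eventually_mono[OF eventually_ge_at_top[of \<tau>\<^sub>0]]) (simp add: eq)
        qed
        moreover have "solves_nonaut f \<Lambda> r {\<tau>s<..} y"
          by (rule solves_nonaut_subset[OF y(1)]) (use \<tau>s in auto)
        moreover have "close_tracks \<delta> e \<Lambda> {\<tau>s<..} y"
          using x(3) eq \<tau>s by (auto simp: close_tracks_def)
        ultimately show ?thesis by (simp add: end_point_tracks_def)
      qed
      with \<tau>s x show "\<exists>\<tau>s\<ge>\<tau>\<^sub>0. (\<exists>x. solves_nonaut f \<Lambda> r {\<tau>\<^sub>0..} x \<and> x \<tau>\<^sub>0 = x0) \<and>
          (\<forall>x. solves_nonaut f \<Lambda> r {\<tau>\<^sub>0..} x \<and> x \<tau>\<^sub>0 = x0 \<longrightarrow>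
            close_tracks \<delta> e \<Lambda> {\<tau>s<..} x \<and> end_point_tracks f \<Lambda> r e lp {\<tau>s<..} x)"
        by blast
    qed
  next
    fix lm assume lm: "exp_bi_asymptotically_constant \<Lambda> lm lp \<and> moving_sink f \<Lambda> e UNIV"
    then have lim_bot: "(\<Lambda> \<longlongrightarrow> lm) at_bot" by (simp add: exp_bi_asymptotically_constant_def)
    obtain \<rho> L where "\<rho> > 0" and L: "((\<lambda>\<tau>. \<Lambda>' \<tau> /\<^sub>R exp (\<rho> * \<tau>)) \<longlongrightarrow> L) at_bot"
      using lm unfolding exp_bi_asymptotically_constant_def \<Lambda>'_def by blast
    have "filterlim (\<lambda>\<tau>. \<rho> * \<tau>) at_bot at_bot"
      by (rule filterlim_tendsto_pos_mult_at_bot[OF tendsto_const \<open>\<rho> > 0\<close> filterlim_ident])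
    from tendsto_0_of_exp_rate[OF L this] have lim_bot': "(\<Lambda>' \<longlongrightarrow> 0) at_bot" .
    have "\<forall>\<^sub>F r in at_right 0. \<exists>x. solves_nonaut f \<Lambda> r UNIV x \<and> (x \<longlongrightarrow> e lm) at_bot \<and>
        (\<forall>T y. solves_nonaut f \<Lambda> r {..<T} y \<and> (y \<longlongrightarrow> e lm) at_bot \<longrightarrow> (\<forall>\<tau><T. y \<tau> = x \<tau>)) \<and>
        local_pullback_attractor f \<Lambda> r x \<and> close_tracks \<delta> e \<Lambda> UNIV x \<and>
        end_point_tracks f \<Lambda> r e lp UNIV x"
      by (rule eventually_mono[OF pullback_tracking[OF conjunct2[OF lm] \<delta>_pos lim_bot lim_bot']])
        (unfold end_point_tracks_def, blast)
    then show "\<exists>rs>0. \<forall>r. 0 < r \<and> r < rs \<longrightarrow>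
          (\<exists>x. solves_nonaut f \<Lambda> r UNIV x \<and> (x \<longlongrightarrow> e lm) at_bot \<and>
            (\<forall>T y. solves_nonaut f \<Lambda> r {..<T} y \<and> (y \<longlongrightarrow> e lm) at_bot \<longrightarrow> (\<forall>\<tau><T. y \<tau> = x \<tau>)) \<and>
            local_pullback_attractor f \<Lambda> r x \<and> close_tracks \<delta> e \<Lambda> UNIV x \<and>
            end_point_tracks f \<Lambda> r e lp UNIV x)"
      unfolding eventually_at_right_field by blast
  qed
qed

end
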